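(* For any nonnegative $f\in L^2(S^2)$, $$\|f\sigma*f\sigma\|_{L^2(\mathbb{R}^3)}\le\|f_\star\sigma*f_\star\sigma\|_{L^2(\mathbb{R}^3)},$$ with strict inequality unless $f=f_\star$ almost everywhere. Consequently, any extremizer, that is, any complex-valued $0\ne f\in L^2(S^2)$ with $\|\widehat{f\sigma}\|_{L^4(\mathbb{R}^3)}=\mathcal{R}\|f\|_{L^2(S^2)}$, satisfies $|f(-x)|=|f(x)|$ for almost every $x\in S^2$.
   Context: $S^2\subset\mathbb{R}^3$ is the unit sphere with surface measure $\sigma$, and $L^2(S^2)=L^2(S^2,\sigma)$. For nonnegative $f\in L^2(S^2)$, the antipodally symmetric rearrangement $f_\star$ is the unique nonnegative element of $L^2(S^2)$ satisfying $f_\star(-x)=f_\star(x)$ and $f_\star(x)^2+f_\star(-x)^2=f(x)^2+f(-x)^2$ for all $x\in S^2$. $f\sigma*g\sigma$ denotes convolution of measures on $\mathbb{R}^3$, identified with its density, which lies in $L^2(\mathbb{R}^3)$ when $f,g\in L^2(S^2)$. $\widehat{f\sigma}(\xi)=\int_{S^2} e^{-ix\cdot\xi}f(x)\,d\sigma(x)$, and $\mathcal{R}=\sup_{0\ne g\in L^2(S^2)}\|\widehat{g\sigma}\|_{L^4(\mathbb{R}^3)}/\|g\|_{L^2(S^2,\sigma)}<\infty$. *)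

theory Defs
  imports "HOL-Probability.Probability"
begin

section \<open>Surface measure on the unit sphere\<close>

text \<open>
  The surface measure of a Borel set \<open>A\<close> of the unit sphere is \<open>3\<close> (the dimension) times the
  volume of the cone \<open>{r x | 0 < r < 1, x \<in> A}\<close>, as in polar coordinates. It is obtained here by
  projecting \<open>3\<close> times Lebesgue measure on the unit ball radially onto the sphere, and it is
  regarded as a Borel measure on the whole of \<open>\<real>\<^sup>3\<close> that is concentrated on \<open>sphere 0 1\<close>. Functions
  on the sphere are accordingly functions on \<open>\<real>\<^sup>3\<close> of which only the values on the sphere matter.
\<close>

definition sphere_measure :: "(real^3) measure" where
  "sphere_measure = distr (density lborel (\<lambda>x. 3 * indicator (ball 0 1) x)) borel sgn"

lemma sets_sphere_measure [simp, measurable_cong]: "sets sphere_measure = sets borel"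
  and space_sphere_measure [simp]: "space sphere_measure = UNIV"
  by (simp_all add: sphere_measure_def)

lemma borel_measurable_sgn_vec [measurable]: "(sgn :: real^3 \<Rightarrow> real^3) \<in> borel_measurable borel"
  unfolding sgn_div_norm[abs_def] by measurable

lemma emeasure_sphere_measure:
  assumes [measurable]: "A \<in> sets borel"
  shows "emeasure sphere_measure A = 3 * emeasure lborel (ball 0 1 \<inter> sgn -` A)"
proof -
  have [measurable]: "sgn -` A \<in> sets borel"
    using measurable_sets_borel[OF borel_measurable_sgn_vec assms] by simp
  have [measurable]: "ball (0::real^3) 1 \<in> sets borel" by simp
  have "emeasure sphere_measure A = emeasure (density lborel (\<lambda>x. 3 * indicator (ball 0 1) x)) (sgn -` A)"
    by (simp add: sphere_measure_def emeasure_distr)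
  also have "\<dots> = (\<integral>\<^sup>+x. 3 * indicator (ball 0 1 \<inter> sgn -` A) x \<partial>lborel)"
    by (subst emeasure_density) (auto intro!: nn_integral_cong split: split_indicator)
  also have "\<dots> = 3 * emeasure lborel (ball 0 1 \<inter> sgn -` A)"
    by (subst nn_integral_cmult_indicator) auto
  finally show ?thesis .
qed

lemma emeasure_sphere_measure_cone:
  assumes [measurable]: "A \<in> sets borel" and A: "A \<subseteq> sphere 0 1"
  shows "emeasure sphere_measure A
       = 3 * emeasure lborel {r *\<^sub>R x | r x. 0 < r \<and> r < 1 \<and> x \<in> A}"
proof -
  have "ball 0 1 \<inter> sgn -` A = {r *\<^sub>R x | r x. 0 < r \<and> r < 1 \<and> x \<in> A}"
  proof (intro equalityI subsetI)
    fix y :: "real^3" assume y: "y \<in> ball 0 1 \<inter> sgn -` A"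
    then have "y \<noteq> 0" using A by auto
    then have "y = norm y *\<^sub>R sgn y" "0 < norm y" "norm y < 1" "sgn y \<in> A"
      using y by (auto simp: sgn_div_norm)
    then show "y \<in> {r *\<^sub>R x | r x. 0 < r \<and> r < 1 \<and> x \<in> A}" by blast
  next
    fix y :: "real^3" assume "y \<in> {r *\<^sub>R x | r x. 0 < r \<and> r < 1 \<and> x \<in> A}"
    then obtain r x where y: "y = r *\<^sub>R x" "0 < r" "r < 1" "x \<in> A" by blast
    then have "norm x = 1" using A by auto
    with y show "y \<in> ball 0 1 \<inter> sgn -` A"
      by (auto simp: sgn_div_norm)
  qed
  then show ?thesis by (simp add: emeasure_sphere_measure)
qed

lemma emeasure_sphere_measure_UNIV: "emeasure sphere_measure UNIV = ennreal (4 * pi)"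
proof -
  have "emeasure sphere_measure UNIV = 3 * emeasure lborel (ball (0::real^3) 1)"
    by (simp add: emeasure_sphere_measure)
  also have "emeasure lborel (ball (0::real^3) 1) = ennreal (unit_ball_vol 3)"
    by (simp add: emeasure_ball)
  also have "unit_ball_vol 3 = 4 / 3 * pi"
    by (simp add: unit_ball_vol_3)
  also have "3 * ennreal (4 / 3 * pi) = ennreal 3 * ennreal (4 / 3 * pi)" by simp
  also have "\<dots> = ennreal (4 * pi)" by (subst ennreal_mult[symmetric]) auto
  finally show ?thesis .
qed

lemma AE_sphere_measure: "AE x in sphere_measure. x \<in> sphere 0 1"
proof (rule AE_I)
  show "{x \<in> space sphere_measure. x \<notin> sphere 0 1} \<subseteq> - sphere 0 1" by auto
  have "(- sphere 0 1 :: (real^3) set) \<in> sets borel" by measurable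
  then show "- sphere 0 1 \<in> sets sphere_measure" by simp
  have "ball 0 1 \<inter> sgn -` (- sphere 0 1) = {0 :: real^3}"
    by (auto simp: norm_sgn split: if_splits)
  then show "emeasure sphere_measure (- sphere 0 1) = 0"
    by (simp add: emeasure_sphere_measure)
qed

lemma distr_sphere_measure_uminus: "distr sphere_measure borel uminus = sphere_measure"
proof (rule measure_eqI)
  fix A :: "(real^3) set" assume "A \<in> sets (distr sphere_measure borel uminus)"
  then have A [measurable]: "A \<in> sets borel" by simp
  have sgnA [measurable]: "sgn -` B \<in> sets borel" if "B \<in> sets borel" for B :: "(real^3) set"
    using measurable_sets_borel[OF borel_measurable_sgn_vec that] by simp
  have U [measurable]: "uminus -` A \<in> sets borel"
    using measurable_sets_borel[of uminus borel A] by simp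
  have eq: "(lborel :: (real^3) measure) = distr lborel borel uminus"
    using lborel_affine[of "-1" "0 :: real^3"]
    by (simp add: density_1)
  have "emeasure lborel (ball 0 1 \<inter> sgn -` A) =
        emeasure (distr lborel borel uminus) (ball 0 1 \<inter> sgn -` A :: (real^3) set)"
    using eq by simp
  also have "\<dots> = emeasure lborel (uminus -` (ball 0 1 \<inter> sgn -` A) :: (real^3) set)"
    by (subst emeasure_distr) auto
  also have "uminus -` (ball 0 1 \<inter> sgn -` A) = ball 0 1 \<inter> sgn -` (uminus -` A :: (real^3) set)"
    by (auto simp: sgn_minus)
  finally show "emeasure (distr sphere_measure borel uminus) A = emeasure sphere_measure A"
    by (simp add: emeasure_distr emeasure_sphere_measure U)
qed simp

section \<open>Lebesgue norms\<close>

definition square_integrable :: "'a measure \<Rightarrow> ('a \<Rightarrow> 'b::{banach,second_countable_topology}) \<Rightarrow> bool" where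
  "square_integrable M f \<longleftrightarrow> f \<in> borel_measurable M \<and> integrable M (\<lambda>x. (norm (f x))\<^sup>2)"

definition ennroot :: "nat \<Rightarrow> ennreal \<Rightarrow> ennreal" where
  "ennroot p a = (if a = \<top> then \<top> else ennreal (root p (enn2real a)))"

text \<open>
  Norms take values in \<open>[0, \<infinity>]\<close>, so that no integrability is hidden in the notation.
\<close>

definition Lp_norm :: "nat \<Rightarrow> 'a measure \<Rightarrow> ('a \<Rightarrow> ennreal) \<Rightarrow> ennreal" where
  "Lp_norm p M F = ennroot p (\<integral>\<^sup>+x. F x ^ p \<partial>M)"

text \<open>
  A measure on \<open>\<real>\<^sup>3\<close> is identified with its density with respect to Lebesgue measure; a measure
  without a density has norm \<open>\<infinity>\<close>.
\<close>

definition measure_L2_norm :: "(real^3) measure \<Rightarrow> ennreal" where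
  "measure_L2_norm \<mu> =
     (if absolutely_continuous lborel \<mu> then Lp_norm 2 lborel (RN_deriv lborel \<mu>) else \<top>)"

lemma measure_L2_norm_density:
  assumes [measurable]: "h \<in> borel_measurable borel"
  shows "measure_L2_norm (density lborel h) = Lp_norm 2 lborel h"
proof -
  have "AE x in lborel. h x = RN_deriv lborel (density lborel h) x"
    by (rule sigma_finite_measure.RN_deriv_unique) (auto intro: lborel.sigma_finite_measure_axioms)
  then have "(\<integral>\<^sup>+x. h x ^ 2 \<partial>lborel) = (\<integral>\<^sup>+x. RN_deriv lborel (density lborel h) x ^ 2 \<partial>lborel)"
    by (intro nn_integral_cong_AE) auto
  moreover have "absolutely_continuous lborel (density lborel h)"
    by (intro absolutely_continuousI_density) simp
  ultimately show ?thesis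
    by (simp add: measure_L2_norm_def Lp_norm_def)
qed

section \<open>Convolution, Fourier transform and the extremal constant\<close>

definition sphere_convolution :: "(real^3 \<Rightarrow> real) \<Rightarrow> (real^3 \<Rightarrow> real) \<Rightarrow> (real^3) measure" where
  "sphere_convolution f g =
     convolution (density sphere_measure (\<lambda>x. ennreal (f x)))
                 (density sphere_measure (\<lambda>x. ennreal (g x)))"

definition sphere_fourier :: "(real^3 \<Rightarrow> complex) \<Rightarrow> real^3 \<Rightarrow> complex" where
  "sphere_fourier f \<xi> = (LINT x|sphere_measure. exp (- \<i> * complex_of_real (x \<bullet> \<xi>)) * f x)"

definition fourier_L4_norm :: "(real^3 \<Rightarrow> complex) \<Rightarrow> ennreal" where
  "fourier_L4_norm f = Lp_norm 4 lborel (\<lambda>\<xi>. ennreal (norm (sphere_fourier f \<xi>)))"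

definition sphere_L2_norm :: "(real^3 \<Rightarrow> complex) \<Rightarrow> ennreal" where
  "sphere_L2_norm f = Lp_norm 2 sphere_measure (\<lambda>x. ennreal (norm (f x)))"

definition nonzero_L2 :: "(real^3 \<Rightarrow> complex) set" where
  "nonzero_L2 = {f. square_integrable sphere_measure f \<and> \<not> (AE x in sphere_measure. f x = 0)}"

definition extension_constant :: ennreal where
  "extension_constant = (SUP g\<in>nonzero_L2. fourier_L4_norm g / sphere_L2_norm g)"

definition extremizer :: "(real^3 \<Rightarrow> complex) \<Rightarrow> bool" where
  "extremizer f \<longleftrightarrow> f \<in> nonzero_L2 \<and> fourier_L4_norm f = extension_constant * sphere_L2_norm f"

section \<open>Antipodally symmetric rearrangement\<close>

text \<open>
  Elements of \<open>L\<^sup>2\<close> are represented by functions, hence the defining properties hold almost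
  everywhere, and the rearrangement is unique up to equality almost everywhere.
\<close>

definition antipodal_rearrangement :: "(real^3 \<Rightarrow> real) \<Rightarrow> (real^3 \<Rightarrow> real) \<Rightarrow> bool" where
  "antipodal_rearrangement f h \<longleftrightarrow>
     square_integrable sphere_measure h \<and>
     (AE x in sphere_measure. 0 \<le> h x) \<and>
     (AE x in sphere_measure. h (- x) = h x) \<and>
     (AE x in sphere_measure. (h x)\<^sup>2 + (h (- x))\<^sup>2 = (f x)\<^sup>2 + (f (- x))\<^sup>2)"

lemma antipodal_rearrangement_exists:
  assumes "square_integrable sphere_measure f"
  shows "antipodal_rearrangement f (\<lambda>x. sqrt (((f x)\<^sup>2 + (f (- x))\<^sup>2) / 2))"
proof -
  have f [measurable]: "f \<in> borel_measurable borel"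
    and i: "integrable sphere_measure (\<lambda>x. (f x)\<^sup>2)"
    using assms by (auto simp: square_integrable_def cong: measurable_cong_sets)
  have "integrable (distr sphere_measure borel uminus) (\<lambda>x. (f x)\<^sup>2)"
    using i by (simp add: distr_sphere_measure_uminus)
  then have "integrable sphere_measure (\<lambda>x. (f (- x))\<^sup>2)"
    by (subst (asm) integrable_distr_eq) auto
  with i show ?thesis
    by (auto simp: antipodal_rearrangement_def square_integrable_def add.commute)
qed

lemma antipodal_rearrangement_unique:
  assumes "antipodal_rearrangement f h" "antipodal_rearrangement f k"
  shows "AE x in sphere_measure. h x = k x"
proof -
  have *: "a = b"
    if "0 \<le> a" "0 \<le> b" "a' = a" "b' = b" "a\<^sup>2 + a'\<^sup>2 = c" "b\<^sup>2 + b'\<^sup>2 = c"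
    for a b a' b' c :: real
  proof (rule power2_eq_imp_eq)
    have "a\<^sup>2 + a\<^sup>2 = c" "b\<^sup>2 + b\<^sup>2 = c"
      using that by (simp_all only:)
    then show "a\<^sup>2 = b\<^sup>2" by linarith
  qed fact+
  have "AE x in sphere_measure. 0 \<le> h x" "AE x in sphere_measure. 0 \<le> k x"
    "AE x in sphere_measure. h (- x) = h x" "AE x in sphere_measure. k (- x) = k x"
    "AE x in sphere_measure. (h x)\<^sup>2 + (h (- x))\<^sup>2 = (f x)\<^sup>2 + (f (- x))\<^sup>2"
    "AE x in sphere_measure. (k x)\<^sup>2 + (k (- x))\<^sup>2 = (f x)\<^sup>2 + (f (- x))\<^sup>2"
    using assms by (simp_all add: antipodal_rearrangement_def)
  then show ?thesis
    by eventually_elim (rule *)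
qed

end

theory Submission
  imports Defs
begin

text \<open>
  By Plancherel's theorem \<open>(2 \<pi>)\<^sup>3\<close> times the square of the \<open>L\<^sup>2\<close> norm of \<open>f\<sigma> * f\<sigma>\<close> is the fourth power of the
  \<open>L\<^sup>4\<close> norm of the Fourier transform of \<open>f\<sigma>\<close>, and formally that square is the integral of \<open>f(a) f(b) f(c) f(d)\<close> over the
  quadruples of unit vectors with \<open>a + b = c + d\<close>. Substituting \<open>- c\<close> and \<open>- d\<close>, one integrates
  \<open>f(a) f(b) f(- c) f(- d)\<close> over \<open>a + b + c + d = 0\<close>. This set is invariant under permutations, so the two
  reflected factors may be any two of the four; averaging over the six choices reduces the inequality to
  an elementary one for the values of \<open>f\<close> at eight points, \<open>six_products_le\<close>. The elementary inequality has a
  surplus, a multiple of the product over the four points of the function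
  \<open>k(x) = ((f(x) - f(- x)) / 2)\<^sup>2 / f\<^sub>\<star>(x)\<close>. Hence the square of the convolution norm for \<open>f\<^sub>\<star>\<close> exceeds that
  for \<open>f\<close> by at least a multiple of that for \<open>k\<close>, which is positive unless \<open>k = 0\<close> almost everywhere, that is, unless \<open>f\<close> is even.

  Instead of the singular measure on the quadruples, the proof uses Gaussian kernels in \<open>a + b + c + d\<close>, and the
  argument above applies to them without change (\<open>sphere_form_symmetrization\<close>). On the Fourier side
  the kernel is the weight \<open>exp (- e\<^sup>2 |\<xi>|\<^sup>2)\<close>, which increases to \<open>1\<close> as \<open>e\<close> decreases to \<open>0\<close>, so the
  limit is a case of monotone convergence (\<open>gaussian_weighted_plancherel\<close>, \<open>fourier_L4_eq_SUP\<close>).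

  Strictness requires finite norms, that is, the estimate that the Fourier transform of \<open>f\<sigma>\<close> is in \<open>L\<^sup>4\<close> for \<open>f\<close>
  in \<open>L\<^sup>2\<close>. For even \<open>f\<close> it follows from \<open>sphere_form_bound\<close>: among unit vectors with \<open>a + b + c + d = 0\<close> one of
  the sums \<open>a + b\<close>, \<open>a + c\<close>, \<open>a + d\<close> has length at least \<open>1\<close>, and away from the origin the density of \<open>\<sigma> * \<sigma>\<close> is
  bounded. The symmetrization inequality carries it over to all \<open>f\<close>. The density of \<open>f\<sigma> * f\<sigma>\<close> is then obtained
  from a general fact: a finite measure whose Gaussian mollifications are bounded in \<open>L\<^sup>2\<close> has a density in
  \<open>L\<^sup>2\<close>, with norm the limit of the norms of the mollifications
  (\<open>absolutely_continuous_of_mollify_bound\<close>, \<open>density_square_le_of_mollify_bound\<close>).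

  For an extremizer \<open>f\<close>, replacing \<open>f\<close> by \<open>|f|\<close> does not decrease the Fourier norm, and passing to \<open>|f|\<^sub>\<star>\<close>
  increases it strictly unless \<open>|f|\<close> is even, while the norm in \<open>L\<^sup>2(S\<^sup>2)\<close> stays the same.
\<close>

section \<open>Fourier transform of Gaussians\<close>

lemma gaussian_fourier_transform_real:
  fixes e t :: real
  assumes e: "0 < e"
  shows "integrable lborel (\<lambda>x. exp (\<i> * complex_of_real (t * x)) * complex_of_real (exp (- e\<^sup>2 * x\<^sup>2)))"
    and "(LINT x|lborel. exp (\<i> * complex_of_real (t * x)) * complex_of_real (exp (- e\<^sup>2 * x\<^sup>2)))
       = complex_of_real (sqrt pi / e * exp (- t\<^sup>2 / (4 * e\<^sup>2)))"
proof -
  let ?g = "\<lambda>x. std_normal_density x *\<^sub>R exp (\<i> * complex_of_real (t / (sqrt 2 * e) * x))"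
  have int: "integrable lborel ?g"
    by (rule Bochner_Integration.integrable_bound[of _ std_normal_density])
       (auto intro!: integrable_normal_density normal_density_nonneg)
  have val: "(LINT x|lborel. ?g x) = complex_of_real (exp (- (t / (sqrt 2 * e))\<^sup>2 / 2))"
  proof -
    have "complex_of_real (exp (- (t / (sqrt 2 * e))\<^sup>2 / 2)) = char std_normal_distribution (t / (sqrt 2 * e))"
      by (simp add: char_std_normal_distribution)
    also have "\<dots> = (LINT x|lborel. ?g x)"
      unfolding char_def by (subst integral_density) (auto simp: normal_density_nonneg)
    finally show ?thesis by simp
  qed
  have c: "sqrt 2 * e \<noteq> 0" using e by simp
  have eq: "?g (0 + sqrt 2 * e * x) = complex_of_real (1 / sqrt (2 * pi)) *
      (exp (\<i> * complex_of_real (t * x)) * complex_of_real (exp (- e\<^sup>2 * x\<^sup>2)))" for x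
    using e by (simp add: std_normal_density_def power_mult_distrib scaleR_conv_of_real)
  have "integrable lborel (\<lambda>x. complex_of_real (sqrt (2 * pi)) * ?g (0 + sqrt 2 * e * x))"
    by (intro integrable_mult_right lborel_integrable_real_affine[OF int c])
  moreover have "complex_of_real (sqrt (2 * pi)) * ?g (0 + sqrt 2 * e * x)
      = exp (\<i> * complex_of_real (t * x)) * complex_of_real (exp (- e\<^sup>2 * x\<^sup>2))" for x
    unfolding eq by simp
  ultimately show "integrable lborel (\<lambda>x. exp (\<i> * complex_of_real (t * x)) * complex_of_real (exp (- e\<^sup>2 * x\<^sup>2)))"
    by (simp only:)
  have "complex_of_real (exp (- (t / (sqrt 2 * e))\<^sup>2 / 2)) = \<bar>sqrt 2 * e\<bar> *\<^sub>R (LINT x|lborel. ?g (0 + sqrt 2 * e * x))"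
    using val lborel_integral_real_affine[OF c, of ?g 0] by simp
  also have "\<dots> = complex_of_real (e / sqrt pi) *
      (LINT x|lborel. exp (\<i> * complex_of_real (t * x)) * complex_of_real (exp (- e\<^sup>2 * x\<^sup>2)))"
    unfolding eq using e by (simp add: scaleR_conv_of_real real_sqrt_mult)
  finally show "(LINT x|lborel. exp (\<i> * complex_of_real (t * x)) * complex_of_real (exp (- e\<^sup>2 * x\<^sup>2)))
       = complex_of_real (sqrt pi / e * exp (- t\<^sup>2 / (4 * e\<^sup>2)))"
    using e by (simp add: field_simps power_mult_distrib power_divide)
qed

text \<open>
  The Fourier transform of \<open>exp (- e\<^sup>2 |\<xi>|\<^sup>2)\<close>. Up to the factor \<open>(2 \<pi>)\<^sup>d\<close>, where \<open>d\<close> is the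
  dimension, it is a probability density that concentrates at the origin as \<open>e\<close> tends to \<open>0\<close>.
\<close>

definition gauss_kernel :: "real \<Rightarrow> 'a::euclidean_space \<Rightarrow> real" where
  "gauss_kernel e w = (sqrt pi / e) ^ DIM('a) * exp (- (norm w)\<^sup>2 / (4 * e\<^sup>2))"

lemma gauss_kernel_measurable [measurable]:
  assumes [measurable]: "f \<in> borel_measurable M"
  shows "(\<lambda>x. gauss_kernel e (f x)) \<in> borel_measurable M"
  unfolding gauss_kernel_def by measurable

lemma gauss_kernel_minus_commute: "gauss_kernel e (x - y) = gauss_kernel e (y - x)"
  by (simp add: gauss_kernel_def norm_minus_commute)

lemma gauss_kernel_nonneg: "0 < e \<Longrightarrow> 0 \<le> gauss_kernel e w"
  by (simp add: gauss_kernel_def)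

lemma gauss_kernel_le: "0 < e \<Longrightarrow> gauss_kernel e (w::'a::euclidean_space) \<le> (sqrt pi / e) ^ DIM('a)"
  by (simp add: gauss_kernel_def mult_left_le)

lemma norm_power2_Basis: "(norm (x::'a::euclidean_space))\<^sup>2 = (\<Sum>b\<in>Basis. (x \<bullet> b)\<^sup>2)"
proof -
  have "(norm x)\<^sup>2 = x \<bullet> x" by (rule power2_norm_eq_inner)
  also have "\<dots> = (\<Sum>b\<in>Basis. (x \<bullet> b)\<^sup>2)"
    by (subst euclidean_inner) (simp only: power2_eq_square)
  finally show ?thesis .
qed

text \<open>
  The integrand is a product over an orthonormal basis, so the one-dimensional case suffices.
\<close>

theorem gaussian_fourier_transform:
  fixes e :: real and w :: "'a::euclidean_space"
  assumes e: "0 < e"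
  shows "integrable lborel (\<lambda>\<xi>. exp (\<i> * complex_of_real (w \<bullet> \<xi>)) * complex_of_real (exp (- e\<^sup>2 * (norm \<xi>)\<^sup>2)))"
    and "(LINT \<xi>|lborel. exp (\<i> * complex_of_real (w \<bullet> \<xi>)) * complex_of_real (exp (- e\<^sup>2 * (norm \<xi>)\<^sup>2)))
       = complex_of_real (gauss_kernel e w)"
proof -
  interpret product_sigma_finite "\<lambda>b::'a. lborel :: real measure" ..
  let ?h = "\<lambda>b x. exp (\<i> * complex_of_real ((w \<bullet> b) * x)) * complex_of_real (exp (- e\<^sup>2 * x\<^sup>2))"
  let ?S = "\<lambda>f. \<Sum>b\<in>Basis. f b *\<^sub>R b :: 'a"
  have eq: "exp (\<i> * complex_of_real (w \<bullet> ?S f)) * complex_of_real (exp (- e\<^sup>2 * (norm (?S f))\<^sup>2))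
       = (\<Prod>b\<in>Basis. ?h b (f b))" for f
  proof -
    have "w \<bullet> ?S f = (\<Sum>b\<in>Basis. (w \<bullet> b) * f b)"
      by (simp add: inner_sum_right mult.commute)
    moreover have "(norm (?S f))\<^sup>2 = (\<Sum>b\<in>Basis. (f b)\<^sup>2)"
      unfolding norm_power2_Basis by simp
    ultimately show ?thesis
      by (simp add: prod.distrib exp_sum sum_distrib_left of_real_prod sum_negf[symmetric])
  qed
  have int: "integrable (Pi\<^sub>M Basis (\<lambda>b. lborel)) (\<lambda>f. \<Prod>b\<in>Basis. ?h b (f b))"
    by (intro product_integrable_prod gaussian_fourier_transform_real e) auto
  have [measurable]: "?S \<in> borel_measurable (Pi\<^sub>M Basis (\<lambda>b. lborel))"
    by measurable
  show "integrable lborel (\<lambda>\<xi>. exp (\<i> * complex_of_real (w \<bullet> \<xi>)) * complex_of_real (exp (- e\<^sup>2 * (norm \<xi>)\<^sup>2)))"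
    by (subst lborel_eq, subst integrable_distr_eq) (simp_all only: eq int, simp_all)
  have "(LINT \<xi>|lborel. exp (\<i> * complex_of_real (w \<bullet> \<xi>)) * complex_of_real (exp (- e\<^sup>2 * (norm \<xi>)\<^sup>2)))
     = (LINT f|(Pi\<^sub>M Basis (\<lambda>b. lborel)). (\<Prod>b\<in>Basis. ?h b (f b)))"
    by (subst lborel_eq, subst integral_distr) (simp_all only: eq, simp_all)
  also have "\<dots> = (\<Prod>b\<in>Basis. (LINT x|lborel. ?h b x))"
    by (intro product_integral_prod gaussian_fourier_transform_real e) auto
  also have "\<dots> = (\<Prod>b\<in>(Basis::'a set). complex_of_real (sqrt pi / e * exp (- (w \<bullet> b)\<^sup>2 / (4 * e\<^sup>2))))"
    by (intro prod.cong refl gaussian_fourier_transform_real e)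
  also have "\<dots> = complex_of_real ((sqrt pi / e) ^ DIM('a) * exp (\<Sum>b\<in>(Basis::'a set). - (w \<bullet> b)\<^sup>2 / (4 * e\<^sup>2)))"
    by (simp add: prod.distrib prod_dividef exp_sum prod_constant power_divide)
  also have "(\<Sum>b\<in>(Basis::'a set). - (w \<bullet> b)\<^sup>2 / (4 * e\<^sup>2)) = - (norm w)\<^sup>2 / (4 * e\<^sup>2)"
    unfolding norm_power2_Basis by (simp add: sum_divide_distrib[symmetric] sum_negf)
  finally show "(LINT \<xi>|lborel. exp (\<i> * complex_of_real (w \<bullet> \<xi>)) * complex_of_real (exp (- e\<^sup>2 * (norm \<xi>)\<^sup>2)))
       = complex_of_real (gauss_kernel e w)" by (simp only: gauss_kernel_def)
qed

lemma nn_integral_gaussian: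
  assumes e: "0 < e"
  shows "(\<integral>\<^sup>+\<xi>. ennreal (exp (- e\<^sup>2 * (norm (\<xi> - y :: 'a::euclidean_space))\<^sup>2)) \<partial>lborel) = ennreal ((sqrt pi / e) ^ DIM('a))"
proof -
  let ?E = "\<lambda>\<xi>::'a. exp (- e\<^sup>2 * (norm \<xi>)\<^sup>2)"
  have i: "integrable lborel (\<lambda>\<xi>. complex_of_real (?E \<xi>))"
    and v: "(LINT \<xi>|lborel. complex_of_real (?E \<xi>)) = complex_of_real ((sqrt pi / e) ^ DIM('a))"
    using gaussian_fourier_transform[OF e, of "0::'a"] by (simp_all add: gauss_kernel_def)
  have i': "integrable lborel ?E" using i
    by (simp only: complex_of_real_integrable_eq)
  have v': "(LINT \<xi>|lborel. ?E \<xi>) = (sqrt pi / e) ^ DIM('a)"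
    using v by (simp only: integral_complex_of_real of_real_eq_iff)
  have "(\<integral>\<^sup>+\<xi>. ennreal (?E (\<xi> - y)) \<partial>lborel) = (\<integral>\<^sup>+\<xi>. ennreal (?E (\<xi> - y)) \<partial>distr lborel borel (\<lambda>x. y + x))"
    by (simp add: lborel_distr_plus)
  also have "\<dots> = (\<integral>\<^sup>+\<xi>. ennreal (?E \<xi>) \<partial>lborel)"
    by (subst nn_integral_distr) simp_all
  also have "\<dots> = ennreal ((sqrt pi / e) ^ DIM('a))"
    by (subst nn_integral_eq_integral[OF i']) (use v' in auto)
  finally show ?thesis .
qed

section \<open>Plancherel identity with a Gaussian weight\<close>

lemma (in pair_sigma_finite) integrable_product_mult:
  fixes f :: "'a \<Rightarrow> 'c::{real_normed_field,banach,second_countable_topology}"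
  assumes f: "integrable M1 f" and g: "integrable M2 g"
  shows "integrable (M1 \<Otimes>\<^sub>M M2) (\<lambda>z. f (fst z) * g (snd z))"
proof (rule Fubini_integrable)
  have [measurable]: "f \<in> borel_measurable M1" "g \<in> borel_measurable M2" using f g by auto
  show "(\<lambda>z. f (fst z) * g (snd z)) \<in> borel_measurable (M1 \<Otimes>\<^sub>M M2)" by measurable
  have "integrable M1 (\<lambda>x. norm (f x) * (LINT y|M2. norm (g y)))"
    using f by simp
  then show "integrable M1 (\<lambda>x. LINT y|M2. norm (f (fst (x, y)) * g (snd (x, y))))"
    by (simp add: norm_mult)
  show "AE x in M1. integrable M2 (\<lambda>y. f (fst (x, y)) * g (snd (x, y)))"
    using g by simp
qed

lemma (in pair_sigma_finite) integral_product_mult: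
  fixes f :: "'a \<Rightarrow> 'c::{real_normed_field,banach,second_countable_topology}"
  assumes f: "integrable M1 f" and g: "integrable M2 g"
  shows "(LINT z|(M1 \<Otimes>\<^sub>M M2). f (fst z) * g (snd z)) = (LINT x|M1. f x) * (LINT y|M2. g y)"
proof -
  have "(LINT z|(M1 \<Otimes>\<^sub>M M2). f (fst z) * g (snd z)) = (LINT x|M1. LINT y|M2. f x * g y)"
    using integral_fst'[OF integrable_product_mult[OF f g]] by simp
  then show ?thesis by simp
qed

text \<open>
  The Fourier transform of the image of the complex measure \<open>F N\<close> under \<open>s\<close>. Taking for \<open>s\<close> the
  sum of two points of the sphere gives the transform of a convolution without forming that
  convolution, which is useful when \<open>F\<close> is complex.
\<close>

definition fourier_integral :: "'p measure \<Rightarrow> ('p \<Rightarrow> 'a::euclidean_space) \<Rightarrow> ('p \<Rightarrow> complex) \<Rightarrow> 'a \<Rightarrow> complex" where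
  "fourier_integral N s F \<xi> = (LINT p|N. exp (- \<i> * complex_of_real (s p \<bullet> \<xi>)) * F p)"

lemma borel_measurable_cnj' [measurable]:
  assumes "f \<in> borel_measurable M"
  shows "(\<lambda>x. cnj (f x)) \<in> borel_measurable M"
  using measurable_compose[OF assms borel_measurable_continuous_onI[of cnj]]
  by (auto intro: continuous_intros)

lemma integrable_unimodular_mult:
  fixes F :: "'p \<Rightarrow> complex" and s :: "'p \<Rightarrow> 'a::euclidean_space"
  assumes "integrable N F" "s \<in> borel_measurable N"
  shows "integrable N (\<lambda>p. exp (- \<i> * complex_of_real (s p \<bullet> \<xi>)) * F p)"
proof (rule Bochner_Integration.integrable_bound[OF assms(1)])
  have [measurable]: "F \<in> borel_measurable N" "s \<in> borel_measurable N" using assms by auto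
  show "(\<lambda>p. exp (- \<i> * complex_of_real (s p \<bullet> \<xi>)) * F p) \<in> borel_measurable N" by measurable
qed (auto simp: norm_mult)

text \<open>
  Expand the square into a double integral over \<open>N\<close> and integrate over \<open>\<xi>\<close> first. The Gaussian
  weight makes the triple integral absolutely convergent; it is what makes Fubini's theorem
  applicable, and letting \<open>e\<close> tend to \<open>0\<close> recovers Plancherel's theorem.
\<close>

theorem gaussian_weighted_plancherel:
  fixes F :: "'p \<Rightarrow> complex" and s :: "'p \<Rightarrow> 'a::euclidean_space"
  assumes N: "sigma_finite_measure N" and F: "integrable N F" and s [measurable]: "s \<in> borel_measurable N" and e: "0 < e"
  shows "integrable lborel (\<lambda>\<xi>. (norm (fourier_integral N s F \<xi>))\<^sup>2 * exp (- e\<^sup>2 * (norm \<xi>)\<^sup>2))"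
    and "complex_of_real (LINT \<xi>|lborel. (norm (fourier_integral N s F \<xi>))\<^sup>2 * exp (- e\<^sup>2 * (norm \<xi>)\<^sup>2))
       = (LINT z|(N \<Otimes>\<^sub>M N). F (fst z) * cnj (F (snd z)) * complex_of_real (gauss_kernel e (s (fst z) - s (snd z))))"
proof -
  interpret N: sigma_finite_measure N by fact
  interpret NN: pair_sigma_finite N N ..
  interpret P: sigma_finite_measure "N \<Otimes>\<^sub>M N" by (rule sigma_finite_pair_measure) fact+
  interpret L: pair_sigma_finite "lborel :: 'a measure" "N \<Otimes>\<^sub>M N" ..
  have [measurable]: "F \<in> borel_measurable N" using F by auto
  let ?E = "\<lambda>\<xi>::'a. complex_of_real (exp (- e\<^sup>2 * (norm \<xi>)\<^sup>2))"
  let ?G = "\<lambda>z. F (fst z) * cnj (F (snd z))"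
  let ?H = "\<lambda>\<xi> z. exp (\<i> * complex_of_real ((s (snd z) - s (fst z)) \<bullet> \<xi>)) * ?E \<xi> * ?G z"
  have cnjF: "integrable N (\<lambda>p. cnj (F p))" using F by simp
  have intG: "integrable (N \<Otimes>\<^sub>M N) ?G"
    by (rule NN.integrable_product_mult[OF F cnjF])
  have intE: "integrable lborel ?E"
    using gaussian_fourier_transform(1)[OF e, of "0::'a"] by simp
  have "integrable (lborel \<Otimes>\<^sub>M (N \<Otimes>\<^sub>M N)) (\<lambda>y. ?E (fst y) * ?G (snd y))"
    by (rule L.integrable_product_mult[OF intE intG])
  then have intH: "integrable (lborel \<Otimes>\<^sub>M (N \<Otimes>\<^sub>M N)) (\<lambda>(\<xi>, z). ?H \<xi> z)"
    by (rule Bochner_Integration.integrable_bound) (measurable, auto simp: norm_mult)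
  have inner: "(LINT z|(N \<Otimes>\<^sub>M N). ?H \<xi> z) = complex_of_real ((norm (fourier_integral N s F \<xi>))\<^sup>2 * exp (- e\<^sup>2 * (norm \<xi>)\<^sup>2))" for \<xi>
  proof -
    let ?f = "\<lambda>p. exp (- \<i> * complex_of_real (s p \<bullet> \<xi>)) * F p"
    have f: "integrable N ?f" by (rule integrable_unimodular_mult[OF F s])
    then have cf: "integrable N (\<lambda>p. cnj (?f p))" by (simp only: complex_integrable_cnj)
    have H: "?H \<xi> z = ?E \<xi> * (?f (fst z) * cnj (?f (snd z)))" for z
    proof -
      have "exp (\<i> * complex_of_real ((s (snd z) - s (fst z)) \<bullet> \<xi>))
          = exp (- \<i> * complex_of_real (s (fst z) \<bullet> \<xi>)) * cnj (exp (- \<i> * complex_of_real (s (snd z) \<bullet> \<xi>)))"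
        by (simp add: exp_cnj mult_exp_exp inner_diff_left algebra_simps)
      then show ?thesis by (simp only: complex_cnj_mult mult_ac)
    qed
    have "(LINT z|(N \<Otimes>\<^sub>M N). ?H \<xi> z) = ?E \<xi> * (LINT z|(N \<Otimes>\<^sub>M N). ?f (fst z) * cnj (?f (snd z)))"
      unfolding H by (rule integral_mult_right_zero)
    also have "(LINT z|(N \<Otimes>\<^sub>M N). ?f (fst z) * cnj (?f (snd z))) = (LINT p|N. ?f p) * (LINT p|N. cnj (?f p))"
      by (rule NN.integral_product_mult[OF f cf])
    also have "(LINT p|N. cnj (?f p)) = cnj (LINT p|N. ?f p)"
      by (rule Bochner_Integration.integral_cnj)
    also have "(LINT p|N. ?f p) * cnj (LINT p|N. ?f p) = complex_of_real ((norm (fourier_integral N s F \<xi>))\<^sup>2)"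
      unfolding fourier_integral_def by (rule complex_norm_square[symmetric])
    finally show ?thesis by (simp add: mult.commute)
  qed
  have "integrable lborel (\<lambda>\<xi>. LINT z|(N \<Otimes>\<^sub>M N). ?H \<xi> z)"
    by (rule L.integrable_fst[OF intH])
  then show "integrable lborel (\<lambda>\<xi>. (norm (fourier_integral N s F \<xi>))\<^sup>2 * exp (- e\<^sup>2 * (norm \<xi>)\<^sup>2))"
    unfolding inner by (simp only: complex_of_real_integrable_eq)
  have "complex_of_real (LINT \<xi>|lborel. (norm (fourier_integral N s F \<xi>))\<^sup>2 * exp (- e\<^sup>2 * (norm \<xi>)\<^sup>2))
     = (LINT \<xi>|lborel. LINT z|(N \<Otimes>\<^sub>M N). ?H \<xi> z)"
    unfolding inner by (rule integral_complex_of_real[symmetric])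
  also have "\<dots> = (LINT z|(N \<Otimes>\<^sub>M N). LINT \<xi>|lborel. ?H \<xi> z)"
    by (rule L.Fubini_integral[OF intH, symmetric])
  also have "\<dots> = (LINT z|(N \<Otimes>\<^sub>M N). ?G z * complex_of_real (gauss_kernel e (s (fst z) - s (snd z))))"
  proof (rule Bochner_Integration.integral_cong[OF refl])
    fix z
    have "(LINT \<xi>|lborel. ?H \<xi> z) = (LINT \<xi>|lborel. exp (\<i> * complex_of_real ((s (snd z) - s (fst z)) \<bullet> \<xi>)) * ?E \<xi>) * ?G z"
      by (rule integral_mult_left_zero)
    also have "\<dots> = complex_of_real (gauss_kernel e (s (snd z) - s (fst z))) * ?G z"
      by (subst gaussian_fourier_transform(2)[OF e]) (rule refl)
    finally show "(LINT \<xi>|lborel. ?H \<xi> z) = ?G z * complex_of_real (gauss_kernel e (s (fst z) - s (snd z)))"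
      by (simp only: gauss_kernel_minus_commute[of e "s (snd z)"] mult.commute)
  qed
  finally show "complex_of_real (LINT \<xi>|lborel. (norm (fourier_integral N s F \<xi>))\<^sup>2 * exp (- e\<^sup>2 * (norm \<xi>)\<^sup>2))
     = (LINT z|(N \<Otimes>\<^sub>M N). ?G z * complex_of_real (gauss_kernel e (s (fst z) - s (snd z))))" .
qed

lemma integrable_gauss_kernel_energy:
  fixes F :: "'p \<Rightarrow> complex" and s :: "'p \<Rightarrow> 'a::euclidean_space"
  assumes N: "sigma_finite_measure N" and F: "integrable N F" and s [measurable]: "s \<in> borel_measurable N" and e: "0 < e"
  shows "integrable (N \<Otimes>\<^sub>M N) (\<lambda>z. F (fst z) * cnj (F (snd z)) * complex_of_real (gauss_kernel e (s (fst z) - s (snd z))))"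
proof -
  interpret N: sigma_finite_measure N by fact
  interpret NN: pair_sigma_finite N N ..
  have [measurable]: "F \<in> borel_measurable N" using F by auto
  have "integrable (N \<Otimes>\<^sub>M N) (\<lambda>z. F (fst z) * cnj (F (snd z)))"
    by (rule NN.integrable_product_mult) (use F in auto)
  then have "integrable (N \<Otimes>\<^sub>M N) (\<lambda>z. complex_of_real ((sqrt pi / e) ^ DIM('a)) * (F (fst z) * cnj (F (snd z))))"
    by (rule integrable_mult_right)
  then show ?thesis
  proof (rule Bochner_Integration.integrable_bound)
    show "(\<lambda>z. F (fst z) * cnj (F (snd z)) * complex_of_real (gauss_kernel e (s (fst z) - s (snd z)))) \<in> borel_measurable (N \<Otimes>\<^sub>M N)"
      by measurable
    show "AE z in N \<Otimes>\<^sub>M N. norm (F (fst z) * cnj (F (snd z)) * complex_of_real (gauss_kernel e (s (fst z) - s (snd z))))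
       \<le> norm (complex_of_real ((sqrt pi / e) ^ DIM('a)) * (F (fst z) * cnj (F (snd z))))"
    proof (rule AE_I2)
      fix z
      have "\<bar>gauss_kernel e (s (fst z) - s (snd z))\<bar> \<le> \<bar>(sqrt pi / e) ^ DIM('a)\<bar>"
        using gauss_kernel_le[OF e, of "s (fst z) - s (snd z)"] gauss_kernel_nonneg[OF e, of "s (fst z) - s (snd z)"]
        by simp
      from mult_right_mono[OF this norm_ge_zero[of "F (fst z) * cnj (F (snd z))"]]
      show "norm (F (fst z) * cnj (F (snd z)) * complex_of_real (gauss_kernel e (s (fst z) - s (snd z))))
       \<le> norm (complex_of_real ((sqrt pi / e) ^ DIM('a)) * (F (fst z) * cnj (F (snd z))))"
        by (simp only: norm_mult norm_of_real mult.commute)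
    qed
  qed
qed

text \<open>
  The energy of the image of \<open>F N\<close> under \<open>s\<close>, with the Gaussian as interaction potential.
\<close>

definition gauss_energy :: "real \<Rightarrow> 'p measure \<Rightarrow> ('p \<Rightarrow> 'a::euclidean_space) \<Rightarrow> ('p \<Rightarrow> real) \<Rightarrow> ennreal" where
  "gauss_energy e N s F = (\<integral>\<^sup>+z. ennreal (F (fst z) * F (snd z) * gauss_kernel e (s (fst z) - s (snd z))) \<partial>(N \<Otimes>\<^sub>M N))"

text \<open>
  The kernel is positive, so replacing \<open>F\<close> by its modulus can only increase the energy. This is
  how the modulus enters the study of complex extremizers.
\<close>

lemma nn_integral_fourier_le_gauss_energy:
  fixes F :: "'p \<Rightarrow> complex" and s :: "'p \<Rightarrow> 'a::euclidean_space"
  assumes N: "sigma_finite_measure N" and F: "integrable N F" and s [measurable]: "s \<in> borel_measurable N" and e: "0 < e"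
  shows "(\<integral>\<^sup>+\<xi>. ennreal ((norm (fourier_integral N s F \<xi>))\<^sup>2 * exp (- e\<^sup>2 * (norm \<xi>)\<^sup>2)) \<partial>lborel)
     \<le> gauss_energy e N s (\<lambda>p. norm (F p))"
    and "(\<And>p. F p = complex_of_real (norm (F p))) \<Longrightarrow> (\<integral>\<^sup>+\<xi>. ennreal ((norm (fourier_integral N s F \<xi>))\<^sup>2 * exp (- e\<^sup>2 * (norm \<xi>)\<^sup>2)) \<partial>lborel)
     = gauss_energy e N s (\<lambda>p. norm (F p))"
proof -
  note pl = gaussian_weighted_plancherel[OF assms]
  let ?A = "LINT \<xi>|lborel. (norm (fourier_integral N s F \<xi>))\<^sup>2 * exp (- e\<^sup>2 * (norm \<xi>)\<^sup>2)"
  let ?K = "\<lambda>z. F (fst z) * cnj (F (snd z)) * complex_of_real (gauss_kernel e (s (fst z) - s (snd z)))"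
  let ?R = "\<lambda>z. norm (F (fst z)) * norm (F (snd z)) * gauss_kernel e (s (fst z) - s (snd z))"
  note iK = integrable_gauss_kernel_energy[OF assms]
  have nK: "norm (?K z) = ?R z" for z
    using gauss_kernel_nonneg[OF e, of "s (fst z) - s (snd z)"] by (simp add: norm_mult)
  have l: "(\<integral>\<^sup>+\<xi>. ennreal ((norm (fourier_integral N s F \<xi>))\<^sup>2 * exp (- e\<^sup>2 * (norm \<xi>)\<^sup>2)) \<partial>lborel) = ennreal ?A"
    by (rule nn_integral_eq_integral[OF pl(1)]) simp
  have R: "gauss_energy e N s (\<lambda>p. norm (F p)) = ennreal (LINT z|(N \<Otimes>\<^sub>M N). ?R z)"
    unfolding gauss_energy_def
  proof (rule nn_integral_eq_integral)
    show "integrable (N \<Otimes>\<^sub>M N) ?R" using integrable_norm[OF iK] unfolding nK .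
  qed (auto simp: gauss_kernel_nonneg[OF e])
  have "0 \<le> ?A" by (intro Bochner_Integration.integral_nonneg) simp
  then have "?A = norm (complex_of_real ?A)" by simp
  also have "\<dots> = norm (LINT z|(N \<Otimes>\<^sub>M N). ?K z)" by (simp only: pl(2))
  also have "\<dots> \<le> (LINT z|(N \<Otimes>\<^sub>M N). norm (?K z))" by (rule integral_norm_bound)
  finally have "?A \<le> (LINT z|(N \<Otimes>\<^sub>M N). ?R z)" unfolding nK .
  then show "(\<integral>\<^sup>+\<xi>. ennreal ((norm (fourier_integral N s F \<xi>))\<^sup>2 * exp (- e\<^sup>2 * (norm \<xi>)\<^sup>2)) \<partial>lborel)
     \<le> gauss_energy e N s (\<lambda>p. norm (F p))"
    unfolding l R by (rule ennreal_leI)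
  assume pos: "\<And>p. F p = complex_of_real (norm (F p))"
  have "?K z = complex_of_real (?R z)" for z
    by (subst (1 2) pos) simp
  then have "complex_of_real ?A = complex_of_real (LINT z|(N \<Otimes>\<^sub>M N). ?R z)"
    unfolding pl(2) by (simp only: integral_complex_of_real)
  then have "?A = (LINT z|(N \<Otimes>\<^sub>M N). ?R z)" by (simp only: of_real_eq_iff)
  then show "(\<integral>\<^sup>+\<xi>. ennreal ((norm (fourier_integral N s F \<xi>))\<^sup>2 * exp (- e\<^sup>2 * (norm \<xi>)\<^sup>2)) \<partial>lborel)
     = gauss_energy e N s (\<lambda>p. norm (F p))"
    unfolding l R by simp
qed

section \<open>Densities of measures with bounded Gaussian energy\<close>

definition heat_kernel :: "real \<Rightarrow> 'a::euclidean_space \<Rightarrow> real" where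
  "heat_kernel e x = (1 / (sqrt (2 * pi) * e)) ^ DIM('a) * exp (- (norm x)\<^sup>2 / (2 * e\<^sup>2))"

lemma heat_kernel_measurable [measurable]:
  assumes [measurable]: "f \<in> borel_measurable M"
  shows "(\<lambda>x. heat_kernel e (f x)) \<in> borel_measurable M"
  unfolding heat_kernel_def by measurable

lemma heat_kernel_nonneg: "0 < e \<Longrightarrow> 0 \<le> heat_kernel e x"
  by (simp add: heat_kernel_def)

lemma nn_integral_heat_kernel:
  assumes e: "0 < e"
  shows "(\<integral>\<^sup>+x. ennreal (heat_kernel e (x - y :: 'a::euclidean_space)) \<partial>lborel) = 1"
proof -
  let ?c = "(1 / (sqrt (2 * pi) * e)) ^ DIM('a)"
  have pos: "0 < 1 / (sqrt 2 * e)" and c: "0 \<le> ?c" using e by auto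
  have "heat_kernel e z = ?c * exp (- (1 / (sqrt 2 * e))\<^sup>2 * (norm z)\<^sup>2)" for z :: 'a
    by (simp add: heat_kernel_def power_mult_distrib power_divide)
  then have "(\<integral>\<^sup>+x. ennreal (heat_kernel e (x - y :: 'a)) \<partial>lborel)
      = (\<integral>\<^sup>+x. ennreal ?c * ennreal (exp (- (1 / (sqrt 2 * e))\<^sup>2 * (norm (x - y :: 'a))\<^sup>2)) \<partial>lborel)"
    by (simp add: ennreal_mult[OF c])
  also have "\<dots> = ennreal ?c * ennreal ((sqrt pi / (1 / (sqrt 2 * e))) ^ DIM('a))"
    by (subst nn_integral_cmult) (simp_all only: nn_integral_gaussian[OF pos], measurable)
  also have "\<dots> = ennreal (?c * (sqrt pi / (1 / (sqrt 2 * e))) ^ DIM('a))"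
    using e by (intro ennreal_mult[symmetric]) auto
  also have "?c * (sqrt pi / (1 / (sqrt 2 * e))) ^ DIM('a) = 1"
    using e by (simp add: power_mult_distrib[symmetric] real_sqrt_mult)
  finally show ?thesis by simp
qed

text \<open>
  By the parallelogram law the product of two Gaussians centred at \<open>x\<close> and \<open>y\<close> is a Gaussian
  centred at the midpoint, times a Gaussian in \<open>x - y\<close>. So \<open>gauss_kernel\<close> factors through the
  heat kernel, and a Gaussian energy becomes the square of an \<open>L\<^sup>2\<close> norm.
\<close>

lemma heat_kernel_semigroup:
  assumes e: "0 < e"
  shows "(\<integral>\<^sup>+z. ennreal (heat_kernel e (z - x)) * ennreal (heat_kernel e (z - y :: 'a::euclidean_space)) \<partial>lborel)
     = ennreal (gauss_kernel e (x - y) / (2 * pi) ^ DIM('a))"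
proof -
  define m where "m = (1/2) *\<^sub>R (x + y)"
  let ?c = "((1 / (sqrt (2 * pi) * e)) ^ DIM('a))\<^sup>2 * exp (- (norm (x - y))\<^sup>2 / (4 * e\<^sup>2))"
  have pos: "0 < 1 / e" and c: "0 \<le> ?c" using e by auto
  have par: "(norm (z - x))\<^sup>2 + (norm (z - y))\<^sup>2 = 2 * (norm (z - m))\<^sup>2 + (norm (x - y))\<^sup>2 / 2" for z
    unfolding m_def power2_norm_eq_inner
    by (simp add: inner_diff_left inner_diff_right inner_add_left inner_add_right inner_commute algebra_simps)
       (simp add: field_simps)
  have "heat_kernel e (z - x) * heat_kernel e (z - y) = ?c * exp (- (1 / e)\<^sup>2 * (norm (z - m))\<^sup>2)" for z
  proof -
    have "- (norm (z - x))\<^sup>2 / (2 * e\<^sup>2) + - (norm (z - y))\<^sup>2 / (2 * e\<^sup>2)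
        = - ((norm (z - x))\<^sup>2 + (norm (z - y))\<^sup>2) / (2 * e\<^sup>2)"
      by (simp add: add_divide_distrib diff_divide_distrib)
    also have "\<dots> = - (norm (x - y))\<^sup>2 / (4 * e\<^sup>2) + - (1 / e)\<^sup>2 * (norm (z - m))\<^sup>2"
      unfolding par using e by (simp add: field_simps power2_eq_square)
    finally show ?thesis
      unfolding heat_kernel_def by (simp add: power2_eq_square mult_exp_exp mult_ac)
  qed
  then have "(\<integral>\<^sup>+z. ennreal (heat_kernel e (z - x)) * ennreal (heat_kernel e (z - y)) \<partial>lborel)
     = (\<integral>\<^sup>+z. ennreal ?c * ennreal (exp (- (1 / e)\<^sup>2 * (norm (z - m))\<^sup>2)) \<partial>lborel)"
    by (simp only: ennreal_mult[symmetric] heat_kernel_nonneg[OF e] c exp_ge_zero)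
  also have "\<dots> = ennreal ?c * ennreal ((sqrt pi / (1 / e)) ^ DIM('a))"
    by (subst nn_integral_cmult) (simp_all only: nn_integral_gaussian[OF pos], measurable)
  also have "\<dots> = ennreal (?c * (sqrt pi / (1 / e)) ^ DIM('a))"
    using e by (intro ennreal_mult[symmetric]) auto
  also have "?c * (sqrt pi / (1 / e)) ^ DIM('a) = gauss_kernel e (x - y) / (2 * pi) ^ DIM('a)"
  proof -
    have "(1 / (sqrt (2 * pi) * e))\<^sup>2 * (sqrt pi / (1 / e)) = sqrt pi / e / (2 * pi)"
      using e by (simp add: power2_eq_square field_simps)
    then have "((1 / (sqrt (2 * pi) * e))\<^sup>2 * (sqrt pi / (1 / e))) ^ DIM('a) = (sqrt pi / e / (2 * pi)) ^ DIM('a)"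
      by simp
    then have "((1 / (sqrt (2 * pi) * e)) ^ DIM('a))\<^sup>2 * (sqrt pi / (1 / e)) ^ DIM('a) = (sqrt pi / e) ^ DIM('a) / (2 * pi) ^ DIM('a)"
      by (simp only: power_mult_distrib power_divide power_mult[symmetric] mult.commute[of 2])
    then have "a * E * b = d * E / f" if "a = ((1 / (sqrt (2 * pi) * e)) ^ DIM('a))\<^sup>2" "b = (sqrt pi / (1 / e)) ^ DIM('a)"
        "d = (sqrt pi / e) ^ DIM('a)" "f = (2 * pi) ^ DIM('a)" for a b d f E :: real
      unfolding that[symmetric] by (metis mult.assoc mult.commute times_divide_eq_left)
    then show ?thesis unfolding gauss_kernel_def by blast
  qed
  finally show ?thesis .
qed

definition mollify :: "real \<Rightarrow> 'a::euclidean_space measure \<Rightarrow> 'a \<Rightarrow> ennreal" where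
  "mollify e \<mu> x = (\<integral>\<^sup>+y. ennreal (heat_kernel e (x - y)) \<partial>\<mu>)"

locale finite_borel_measure = finite_measure \<mu> for \<mu> :: "'a::euclidean_space measure" +
  assumes sets_eq [simp, measurable_cong]: "sets \<mu> = sets borel"
begin

lemma space_eq [simp]: "space \<mu> = UNIV"
  using sets_eq_imp_space_eq[OF sets_eq] by simp

sublocale LM: pair_sigma_finite lborel \<mu> ..

lemma mollify_measurable [measurable]: "mollify e \<mu> \<in> borel_measurable borel"
  unfolding mollify_def[abs_def] by measurable

lemma nn_integral_mollify_square:
  assumes e: "0 < e"
  shows "(\<integral>\<^sup>+x. (mollify e \<mu> x)\<^sup>2 \<partial>lborel) = ennreal (1 / (2 * pi) ^ DIM('a)) * gauss_energy e \<mu> (\<lambda>x. x) (\<lambda>_. 1)"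
proof -
  have "(mollify e \<mu> z)\<^sup>2 = (\<integral>\<^sup>+x. \<integral>\<^sup>+y. ennreal (heat_kernel e (z - x)) * ennreal (heat_kernel e (z - y)) \<partial>\<mu> \<partial>\<mu>)" for z
    unfolding power2_eq_square mollify_def
    by (subst nn_integral_multc[symmetric]) (auto intro!: nn_integral_cong nn_integral_cmult[symmetric])
  then have "(\<integral>\<^sup>+z. (mollify e \<mu> z)\<^sup>2 \<partial>lborel) =
      (\<integral>\<^sup>+z. \<integral>\<^sup>+x. \<integral>\<^sup>+y. ennreal (heat_kernel e (z - x)) * ennreal (heat_kernel e (z - y)) \<partial>\<mu> \<partial>\<mu> \<partial>lborel)"
    by simp
  also have "\<dots> = (\<integral>\<^sup>+x. \<integral>\<^sup>+z. \<integral>\<^sup>+y. ennreal (heat_kernel e (z - x)) * ennreal (heat_kernel e (z - y)) \<partial>\<mu> \<partial>lborel \<partial>\<mu>)"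
    by (rule LM.Fubini'[symmetric]) measurable
  also have "\<dots> = (\<integral>\<^sup>+x. \<integral>\<^sup>+y. \<integral>\<^sup>+z. ennreal (heat_kernel e (z - x)) * ennreal (heat_kernel e (z - y)) \<partial>lborel \<partial>\<mu> \<partial>\<mu>)"
    by (intro nn_integral_cong LM.Fubini'[symmetric]) measurable
  also have "\<dots> = (\<integral>\<^sup>+x. \<integral>\<^sup>+y. ennreal (1 / (2 * pi) ^ DIM('a)) * ennreal (gauss_kernel e (x - y)) \<partial>\<mu> \<partial>\<mu>)"
  proof -
    have "ennreal (gauss_kernel e (x - y) / (2 * pi) ^ DIM('a))
        = ennreal (1 / (2 * pi) ^ DIM('a)) * ennreal (gauss_kernel e (x - y))" for x y :: 'a
      using gauss_kernel_nonneg[OF e, of "x - y"] by (subst ennreal_mult[symmetric]) auto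
    then show ?thesis by (simp only: heat_kernel_semigroup[OF e])
  qed
  also have "\<dots> = ennreal (1 / (2 * pi) ^ DIM('a)) * (\<integral>\<^sup>+x. \<integral>\<^sup>+y. ennreal (gauss_kernel e (x - y)) \<partial>\<mu> \<partial>\<mu>)"
    by (simp add: nn_integral_cmult)
  also have "(\<integral>\<^sup>+x. \<integral>\<^sup>+y. ennreal (gauss_kernel e (x - y)) \<partial>\<mu> \<partial>\<mu>) = gauss_energy e \<mu> (\<lambda>x. x) (\<lambda>_. 1)"
    unfolding gauss_energy_def
    by (subst nn_integral_fst[symmetric]) auto
  finally show ?thesis .
qed

text \<open>
  Fatou's lemma twice: the average of a lower semicontinuous \<open>\<psi>\<close> against a concentrating Gaussian
  is asymptotically at least \<open>\<psi> y\<close>. Lower semicontinuity appears in the strong local form in which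
  finite combinations of indicators of open sets have it.
\<close>

lemma nn_integral_le_liminf_mollify:
  fixes \<psi> :: "'a \<Rightarrow> ennreal" and e :: "nat \<Rightarrow> real"
  assumes [measurable]: "\<psi> \<in> borel_measurable borel"
    and lsc: "\<And>y. \<forall>\<^sub>F x in nhds y. \<psi> y \<le> \<psi> x"
    and e: "\<And>n. 0 < e n" and lim: "e \<longlonglongrightarrow> 0"
  shows "(\<integral>\<^sup>+x. \<psi> x \<partial>\<mu>) \<le> liminf (\<lambda>n. \<integral>\<^sup>+x. \<psi> x * mollify (e n) \<mu> x \<partial>lborel)"
proof -
  have [measurable]: "(\<lambda>x. \<psi> (y + c *\<^sub>R x)) \<in> borel_measurable borel" for y :: 'a and c
    by measurable
  let ?I = "\<lambda>n y. \<integral>\<^sup>+x. \<psi> x * ennreal (heat_kernel (e n) (x - y)) \<partial>lborel"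
  have pw: "\<psi> y \<le> liminf (\<lambda>n. ?I n y)" for y
  proof -
    have I: "?I n y = (\<integral>\<^sup>+z. \<psi> (y + e n *\<^sub>R z) * ennreal (heat_kernel 1 z) \<partial>lborel)" for n
    proof -
      have "?I n y = (\<integral>\<^sup>+z. ennreal (\<bar>e n\<bar> ^ DIM('a)) * (\<psi> (y + e n *\<^sub>R z) * ennreal (heat_kernel (e n) (y + e n *\<^sub>R z - y))) \<partial>lborel)"
        using e[of n] by (subst lborel_affine[of "e n" y]) (simp_all add: nn_integral_density nn_integral_distr)
      also have "\<dots> = (\<integral>\<^sup>+z. \<psi> (y + e n *\<^sub>R z) * ennreal (heat_kernel 1 z) \<partial>lborel)"
      proof (rule nn_integral_cong)
        fix z :: 'a
        have "heat_kernel 1 z = \<bar>e n\<bar> ^ DIM('a) * heat_kernel (e n) (y + e n *\<^sub>R z - y)"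
          using e[of n] by (simp add: heat_kernel_def power_mult_distrib power_divide)
        then have "ennreal (heat_kernel 1 z) = ennreal (\<bar>e n\<bar> ^ DIM('a)) * ennreal (heat_kernel (e n) (y + e n *\<^sub>R z - y))"
          using heat_kernel_nonneg[OF e, of n "y + e n *\<^sub>R z - y"] by (simp only: ennreal_mult zero_le_power abs_ge_zero)
        then show "ennreal (\<bar>e n\<bar> ^ DIM('a)) * (\<psi> (y + e n *\<^sub>R z) * ennreal (heat_kernel (e n) (y + e n *\<^sub>R z - y)))
           = \<psi> (y + e n *\<^sub>R z) * ennreal (heat_kernel 1 z)"
          by (simp only: mult_ac)
      qed
      finally show ?thesis .
    qed
    have "\<psi> y = (\<integral>\<^sup>+z. \<psi> y * ennreal (heat_kernel 1 (z::'a)) \<partial>lborel)"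
      using nn_integral_heat_kernel[of 1 "0::'a"] by (subst nn_integral_cmult) auto
    also have "\<dots> \<le> (\<integral>\<^sup>+z. liminf (\<lambda>n. \<psi> (y + e n *\<^sub>R z) * ennreal (heat_kernel 1 z)) \<partial>lborel)"
    proof (intro nn_integral_mono Liminf_bounded)
      fix z :: 'a
      have "((\<lambda>n. y + e n *\<^sub>R z) \<longlongrightarrow> y + 0 *\<^sub>R z) sequentially"
        by (intro tendsto_intros lim)
      then have "filterlim (\<lambda>n. y + e n *\<^sub>R z) (nhds y) sequentially" by simp
      from eventually_compose_filterlim[OF lsc this]
      show "\<forall>\<^sub>F n in sequentially. \<psi> y * ennreal (heat_kernel 1 z) \<le> \<psi> (y + e n *\<^sub>R z) * ennreal (heat_kernel 1 z)"
        by eventually_elim (rule mult_right_mono, auto)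
    qed
    also have "\<dots> \<le> liminf (\<lambda>n. ?I n y)"
      unfolding I by (rule nn_integral_liminf) measurable
    finally show ?thesis .
  qed
  have swap: "(\<integral>\<^sup>+y. ?I n y \<partial>\<mu>) = (\<integral>\<^sup>+x. \<psi> x * mollify (e n) \<mu> x \<partial>lborel)" for n
  proof -
    have "(\<integral>\<^sup>+y. ?I n y \<partial>\<mu>) = (\<integral>\<^sup>+x. \<integral>\<^sup>+y. \<psi> x * ennreal (heat_kernel (e n) (x - y)) \<partial>\<mu> \<partial>lborel)"
      by (rule LM.Fubini') measurable
    then show ?thesis by (simp add: mollify_def nn_integral_cmult)
  qed
  have "(\<integral>\<^sup>+y. \<psi> y \<partial>\<mu>) \<le> (\<integral>\<^sup>+y. liminf (\<lambda>n. ?I n y) \<partial>\<mu>)"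
    by (intro nn_integral_mono pw)
  also have "\<dots> \<le> liminf (\<lambda>n. \<integral>\<^sup>+y. ?I n y \<partial>\<mu>)"
    by (rule nn_integral_liminf) measurable
  finally show ?thesis unfolding swap .
qed

text \<open>
  The Cauchy--Schwarz inequality turns a uniform \<open>L\<^sup>2\<close> bound for the mollified measures into a bound
  for \<open>\<mu>\<close> as a functional on \<open>L\<^sup>2\<close>, at first for lower semicontinuous test functions.
\<close>

lemma nn_integral_square_le_of_mollify_bound:
  fixes \<psi> :: "'a \<Rightarrow> ennreal" and e :: "nat \<Rightarrow> real"
  assumes [measurable]: "\<psi> \<in> borel_measurable borel"
    and lsc: "\<And>y. \<forall>\<^sub>F x in nhds y. \<psi> y \<le> \<psi> x"
    and e: "\<And>n. 0 < e n" and lim: "e \<longlonglongrightarrow> 0"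
    and B: "\<And>n. (\<integral>\<^sup>+x. (mollify (e n) \<mu> x)\<^sup>2 \<partial>lborel) \<le> B"
  shows "(\<integral>\<^sup>+x. \<psi> x \<partial>\<mu>)\<^sup>2 \<le> B * (\<integral>\<^sup>+x. (\<psi> x)\<^sup>2 \<partial>lborel)"
proof -
  let ?J = "\<lambda>n. \<integral>\<^sup>+x. \<psi> x * mollify (e n) \<mu> x \<partial>lborel"
  let ?C = "B * (\<integral>\<^sup>+x. (\<psi> x)\<^sup>2 \<partial>lborel)"
  have J: "(?J n)\<^sup>2 \<le> ?C" for n
  proof -
    have "(?J n)\<^sup>2 \<le> (\<integral>\<^sup>+x. (\<psi> x)\<^sup>2 \<partial>lborel) * (\<integral>\<^sup>+x. (mollify (e n) \<mu> x)\<^sup>2 \<partial>lborel)"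
      by (rule Cauchy_Schwarz_nn_integral) simp_all
    also have "\<dots> \<le> (\<integral>\<^sup>+x. (\<psi> x)\<^sup>2 \<partial>lborel) * B"
      by (intro mult_left_mono B) simp
    finally show ?thesis by (simp only: mult.commute)
  qed
  show ?thesis
  proof (cases "?C = \<top>")
    case False
    then obtain c where c: "?C = ennreal c" "0 \<le> c" by (cases ?C) auto
    have "?J n \<le> ennreal (sqrt c)" for n
    proof (cases "?J n")
      case (real r)
      then show ?thesis using J[of n] c
        by (auto simp: ennreal_power intro!: ennreal_leI real_le_rsqrt)
    next
      case top
      then show ?thesis using J[of n] False by (simp add: top_power_ennreal top_unique)
    qed
    then have "liminf ?J \<le> ennreal (sqrt c)"
      by (intro Liminf_le) (auto intro: always_eventually)
    then have "(\<integral>\<^sup>+x. \<psi> x \<partial>\<mu>) \<le> ennreal (sqrt c)"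
      using nn_integral_le_liminf_mollify[OF assms(1) lsc e lim] by (rule order_trans[rotated])
    then have "(\<integral>\<^sup>+x. \<psi> x \<partial>\<mu>)\<^sup>2 \<le> (ennreal (sqrt c))\<^sup>2"
      by (intro power_mono) auto
    with c show ?thesis by (simp add: ennreal_power)
  qed simp
qed

end

text \<open>
  Enlarge each level set \<open>A c\<close> of \<open>\<phi>\<close> to an open set \<open>U c\<close> by outer regularity. The two functions
  agree off a set \<open>V\<close> of small measure, on which the new one is at most the sum \<open>C\<close> of the values.
  This extends estimates from lower semicontinuous functions to Borel functions.
\<close>

lemma simple_function_lsc_majorant:
  fixes \<phi> :: "'a::euclidean_space \<Rightarrow> ennreal"
  assumes s: "simple_function borel \<phi>" and fin: "\<And>x. \<phi> x < \<top>" and d: "0 < d"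
  obtains \<psi> where "\<psi> \<in> borel_measurable borel" "\<And>y. \<forall>\<^sub>F x in nhds y. \<psi> y \<le> \<psi> x" "\<And>x. \<phi> x \<le> \<psi> x"
    "(\<integral>\<^sup>+x. (\<psi> x)\<^sup>2 \<partial>lborel) \<le> (\<integral>\<^sup>+x. (\<phi> x)\<^sup>2 \<partial>lborel) + ennreal d"
proof -
  define S where "S = range \<phi> - {0}"
  have finS: "finite S" using simple_functionD(1)[OF s] by (simp add: S_def)
  have S0: "c \<noteq> 0" "c < \<top>" if "c \<in> S" for c using that fin by (auto simp: S_def)
  define A where "A = (\<lambda>c. \<phi> -` {c})"
  have A [measurable]: "A c \<in> sets borel" for c
    using simple_functionD(2)[OF s, of "{c}"] by (simp add: A_def)
  define C where "C = (\<Sum>c\<in>S. c)"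
  have C: "C < \<top>" unfolding C_def using S0 finS by (simp add: less_top[symmetric])
  define k where "k = enn2real C"
  have Ck: "C = ennreal k" "0 \<le> k" using C by (auto simp: k_def)
  \<comment> \<open>The sets \<open>U c - A c\<close> cover \<open>V\<close>; with this bound for each, \<open>C\<^sup>2 |V| \<le> d\<close>. The summands \<open>1\<close> avoid division by zero.\<close>
  define \<eta> where "\<eta> = d / (k\<^sup>2 + 1) / (real (card S) + 1)"
  have \<eta>: "0 < \<eta>" unfolding \<eta>_def using d by (simp add: add_nonneg_pos)
  have "\<exists>U. open U \<and> A c \<subseteq> U \<and> emeasure lborel (U - A c) \<le> ennreal \<eta>" for c
    using outer_regular_lborel_le[OF A \<eta>, of c] by metis
  then obtain U where U: "\<And>c. open (U c)" "\<And>c. A c \<subseteq> U c" "\<And>c. emeasure lborel (U c - A c) \<le> ennreal \<eta>"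
    by metis
  have [measurable]: "U c \<in> sets borel" for c using U(1) by (rule borel_open)
  define \<psi> where "\<psi> x = (\<Sum>c\<in>S. c * indicator (U c) x)" for x
  define V where "V = (\<Union>c\<in>S. U c - A c)"
  have [measurable]: "V \<in> sets borel" unfolding V_def using finS by (intro sets.finite_UN) auto
  have \<psi>m [measurable]: "\<psi> \<in> borel_measurable borel"
    unfolding \<psi>_def[abs_def] by measurable
  have lsc: "\<forall>\<^sub>F x in nhds y. \<psi> y \<le> \<psi> x" for y
  proof -
    have "\<forall>\<^sub>F x in nhds y. \<forall>c\<in>S. y \<in> U c \<longrightarrow> x \<in> U c"
    proof (rule eventually_ball_finite[OF finS], rule ballI)
      fix c assume "c \<in> S"
      show "\<forall>\<^sub>F x in nhds y. y \<in> U c \<longrightarrow> x \<in> U c"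
        using U(1)[of c] by (cases "y \<in> U c") (auto simp: eventually_nhds)
    qed
    then show ?thesis
    proof eventually_elim
      case (elim x)
      then show ?case unfolding \<psi>_def
        by (intro sum_mono mult_left_mono) (auto split: split_indicator)
    qed
  qed
  have ge: "\<phi> x \<le> \<psi> x" for x
  proof (cases "\<phi> x = 0")
    case False
    then have xS: "\<phi> x \<in> S" by (simp add: S_def)
    have "x \<in> U (\<phi> x)" using U(2)[of "\<phi> x"] by (auto simp: A_def)
    then have "\<phi> x = \<phi> x * indicator (U (\<phi> x)) x" by simp
    also have "\<dots> \<le> \<psi> x" unfolding \<psi>_def by (rule member_le_sum[OF xS]) (use finS in auto)
    finally show ?thesis .
  qed simp
  have le: "(\<psi> x)\<^sup>2 \<le> (\<phi> x)\<^sup>2 + C\<^sup>2 * indicator V x" for x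
  proof (cases "x \<in> V")
    case True
    have "\<psi> x \<le> C" unfolding \<psi>_def C_def by (intro sum_mono) (auto split: split_indicator)
    then have "(\<psi> x)\<^sup>2 \<le> C\<^sup>2" by (intro power_mono) auto
    with True show ?thesis by (simp add: add_increasing)
  next
    case False
    have "\<psi> x = (\<Sum>c\<in>S. if \<phi> x = c then c else 0)"
      unfolding \<psi>_def
    proof (rule sum.cong[OF refl])
      fix c assume c: "c \<in> S"
      have "x \<in> U c \<longleftrightarrow> \<phi> x = c"
        using False c U(2)[of c] by (auto simp: V_def A_def)
      then show "c * indicator (U c) x = (if \<phi> x = c then c else 0)" by auto
    qed
    also have "\<dots> \<le> \<phi> x" using finS by (simp add: sum.delta')
    finally have "(\<psi> x)\<^sup>2 \<le> (\<phi> x)\<^sup>2" by (intro power_mono) auto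
    then show ?thesis by (simp add: add_increasing2)
  qed
  have "emeasure lborel V \<le> (\<Sum>c\<in>S. emeasure lborel (U c - A c))"
    unfolding V_def using finS by (intro emeasure_subadditive_finite) auto
  also have "\<dots> \<le> (\<Sum>c\<in>S. ennreal \<eta>)" by (intro sum_mono U(3))
  also have "\<dots> = ennreal (real (card S) * \<eta>)"
    using \<eta> by (simp add: ennreal_of_nat_eq_real_of_nat ennreal_mult[symmetric])
  finally have V: "emeasure lborel V \<le> ennreal (real (card S) * \<eta>)" .
  have "(\<integral>\<^sup>+x. (\<psi> x)\<^sup>2 \<partial>lborel) \<le> (\<integral>\<^sup>+x. (\<phi> x)\<^sup>2 + C\<^sup>2 * indicator V x \<partial>lborel)"
    by (intro nn_integral_mono le)
  also have "\<dots> = (\<integral>\<^sup>+x. (\<phi> x)\<^sup>2 \<partial>lborel) + C\<^sup>2 * emeasure lborel V"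
    using borel_measurable_simple_function[OF s]
    by (subst nn_integral_add) (auto simp: nn_integral_cmult)
  also have "C\<^sup>2 * emeasure lborel V \<le> ennreal (k\<^sup>2) * ennreal (real (card S) * \<eta>)"
    using V Ck by (intro mult_mono) (auto simp: ennreal_power)
  also have "\<dots> = ennreal (k\<^sup>2 * (real (card S) * \<eta>))"
    using \<eta> by (intro ennreal_mult[symmetric]) auto
  also have "\<dots> \<le> ennreal d"
  proof (rule ennreal_leI)
    have "k\<^sup>2 / (k\<^sup>2 + 1) \<le> 1" "real (card S) / (real (card S) + 1) \<le> 1"
      by (auto simp: divide_simps add_nonneg_pos)
    then have "(k\<^sup>2 / (k\<^sup>2 + 1)) * (real (card S) / (real (card S) + 1)) \<le> 1"
      by (intro mult_le_one) auto
    from mult_left_mono[OF this, of d] d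
    show "k\<^sup>2 * (real (card S) * \<eta>) \<le> d" by (simp add: \<eta>_def mult_ac)
  qed
  finally have "(\<integral>\<^sup>+x. (\<psi> x)\<^sup>2 \<partial>lborel) \<le> (\<integral>\<^sup>+x. (\<phi> x)\<^sup>2 \<partial>lborel) + ennreal d" by (simp add: add_left_mono)
  with \<psi>m lsc ge show thesis by (rule that)
qed

context finite_borel_measure
begin

text \<open>
  For open \<open>U\<close> the functional bound reads \<open>\<mu>(U)\<^sup>2 \<le> B |U|\<close>, and null sets have open neighbourhoods
  of arbitrarily small volume.
\<close>

lemma absolutely_continuous_of_mollify_bound:
  fixes e :: "nat \<Rightarrow> real"
  assumes e: "\<And>n. 0 < e n" and lim: "e \<longlonglongrightarrow> 0" and fin: "B < \<top>"
    and B: "\<And>n. (\<integral>\<^sup>+x. (mollify (e n) \<mu> x)\<^sup>2 \<partial>lborel) \<le> B"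
  shows "absolutely_continuous lborel \<mu>"
  unfolding absolutely_continuous_def
proof
  fix N assume N: "N \<in> null_sets (lborel :: 'a measure)"
  then have [measurable]: "N \<in> sets borel" by (simp add: null_sets_def)
  obtain b where b: "B = ennreal b" "0 \<le> b" using fin by (cases B) auto
  have "(emeasure \<mu> N)\<^sup>2 \<le> 0"
  proof (rule ennreal_le_epsilon)
    fix d :: real assume d: "0 < d"
    have "0 < d / (b + 1)" using d b by simp
    from outer_regular_lborel_le[OF \<open>N \<in> sets borel\<close> this] obtain U
      where U: "open U" "N \<subseteq> U" "emeasure lborel (U - N) \<le> ennreal (d / (b + 1))" .
    have [measurable]: "U \<in> sets borel" using U(1) by (rule borel_open)
    have "(emeasure \<mu> N)\<^sup>2 \<le> (emeasure \<mu> U)\<^sup>2"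
      by (intro power_mono emeasure_mono U) auto
    also have "(emeasure \<mu> U)\<^sup>2 = (\<integral>\<^sup>+x. indicator U x \<partial>\<mu>)\<^sup>2" by simp
    also have "\<dots> \<le> B * (\<integral>\<^sup>+x. (indicator U x)\<^sup>2 \<partial>lborel)"
    proof (rule nn_integral_square_le_of_mollify_bound[OF _ _ e lim B])
      fix y show "\<forall>\<^sub>F x in nhds y. indicator U y \<le> (indicator U x :: ennreal)"
      proof (cases "y \<in> U")
        case True
        then have "\<forall>\<^sub>F x in nhds y. x \<in> U" using U(1) by (auto simp: eventually_nhds)
        then show ?thesis by eventually_elim (simp split: split_indicator)
      qed simp
    qed simp
    also have "(\<lambda>x. (indicator U x)\<^sup>2 :: ennreal) = indicator U"
      by (auto simp: fun_eq_iff split: split_indicator)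
    also have "(\<integral>\<^sup>+x. indicator U x \<partial>lborel) = emeasure lborel U" by simp
    also have "emeasure lborel U = emeasure lborel (U - N)"
      using N by (intro emeasure_Diff_null_set[symmetric]) auto
    also have "B * emeasure lborel (U - N) \<le> ennreal b * ennreal (d / (b + 1))"
      using U(3) b by (intro mult_mono) auto
    also have "\<dots> \<le> ennreal d"
      using b d by (subst ennreal_mult[symmetric]) (auto intro!: ennreal_leI simp: divide_simps)
    finally show "(emeasure \<mu> N)\<^sup>2 \<le> 0 + ennreal d" by simp
  qed
  then have "emeasure \<mu> N = 0" by simp
  then show "N \<in> null_sets \<mu>" by (simp add: null_sets_def)
qed

text \<open>
  Duality: test \<open>\<mu>\<close> against a simple function \<open>g \<le> h\<close> with compact support. The functional bound
  gives \<open>(\<integral> g\<^sup>2)\<^sup>2 \<le> B \<integral> g\<^sup>2\<close>, and \<open>\<integral> g\<^sup>2\<close> is finite, so it may be cancelled; then \<open>g\<close> increases to \<open>h\<close>.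
\<close>

lemma density_square_le_of_mollify_bound:
  fixes e :: "nat \<Rightarrow> real"
  assumes h [measurable]: "h \<in> borel_measurable borel" and \<mu>: "\<mu> = density lborel h"
    and e: "\<And>n. 0 < e n" and lim: "e \<longlonglongrightarrow> 0" and fin: "B < \<top>"
    and B: "\<And>n. (\<integral>\<^sup>+x. (mollify (e n) \<mu> x)\<^sup>2 \<partial>lborel) \<le> B"
  shows "(\<integral>\<^sup>+x. (h x)\<^sup>2 \<partial>lborel) \<le> B"
proof -
  obtain b where b: "B = ennreal b" "0 \<le> b" using fin by (cases B) auto
  obtain f where f: "\<And>i. simple_function borel (f i)" "incseq f" "\<And>i x. f i x < \<top>" "\<And>x. (SUP i. f i x) = h x"
    using borel_measurable_implies_simple_function_sequence'[OF h] by metis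
  have fh: "f i x \<le> h x" for i x unfolding f(4)[symmetric] by (rule SUP_upper) simp
  define g where "g i x = f i x * indicator (ball 0 (real i)) x" for i x
  have gs: "simple_function borel (g i)" for i
    unfolding g_def by (intro simple_function_mult f simple_function_indicator) auto
  have [measurable]: "f i \<in> borel_measurable borel" "g i \<in> borel_measurable borel" for i
    using f(1) gs by (auto intro: borel_measurable_simple_function)
  have gf: "g i x < \<top>" for i x using f(3)[of i x] by (auto simp: g_def split: split_indicator)
  have gle: "g i x \<le> h x" for i x using fh[of i x] by (auto simp: g_def split: split_indicator)
  have g2: "(\<integral>\<^sup>+x. (g i x)\<^sup>2 \<partial>lborel) \<le> B" for i
  proof -
    let ?X = "\<integral>\<^sup>+x. (g i x)\<^sup>2 \<partial>lborel"
    have Xfin: "?X < \<top>"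
    proof -
      have fr: "finite (range (f i))" using simple_functionD(1)[OF f(1)[of i]] by simp
      define m where "m = Max (range (f i))"
      have m: "f i x \<le> m" for x unfolding m_def using fr by simp
      have "m \<in> range (f i)" unfolding m_def using fr by (intro Max_in) auto
      then have mf: "m < \<top>" using f(3) by auto
      have "?X \<le> (\<integral>\<^sup>+x. m\<^sup>2 * indicator (ball 0 (real i)) x \<partial>(lborel :: 'a measure))"
        using m by (intro nn_integral_mono) (auto simp: g_def split: split_indicator intro!: power_mono)
      also have "\<dots> = m\<^sup>2 * emeasure lborel (ball (0::'a) (real i))"
        by (rule nn_integral_cmult_indicator) simp
      also have "\<dots> < \<top>"
        using mf emeasure_lborel_ball_finite[of "0::'a" "real i"] by (auto simp: ennreal_mult_less_top power_less_top_ennreal)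
      finally show ?thesis .
    qed
    have "?X \<le> (\<integral>\<^sup>+x. h x * g i x \<partial>lborel)"
      unfolding power2_eq_square by (intro nn_integral_mono mult_right_mono gle) auto
    also have "\<dots> = (\<integral>\<^sup>+x. g i x \<partial>\<mu>)" unfolding \<mu> by (subst nn_integral_density) auto
    finally have X1: "?X \<le> (\<integral>\<^sup>+x. g i x \<partial>\<mu>)" .
    have "?X\<^sup>2 \<le> B * ?X"
    proof (rule ennreal_le_epsilon)
      fix d :: real assume d: "0 < d"
      have d': "0 < d / (b + 1)" using d b by simp
      obtain \<psi> where \<psi>: "\<psi> \<in> borel_measurable borel" "\<And>y. \<forall>\<^sub>F x in nhds y. \<psi> y \<le> \<psi> x" "\<And>x. g i x \<le> \<psi> x"
        "(\<integral>\<^sup>+x. (\<psi> x)\<^sup>2 \<partial>lborel) \<le> ?X + ennreal (d / (b + 1))"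
        using simple_function_lsc_majorant[OF gs gf d'] by metis
      have "?X\<^sup>2 \<le> (\<integral>\<^sup>+x. \<psi> x \<partial>\<mu>)\<^sup>2"
        by (intro power_mono order_trans[OF X1] nn_integral_mono \<psi>(3)) auto
      also have "\<dots> \<le> B * (\<integral>\<^sup>+x. (\<psi> x)\<^sup>2 \<partial>lborel)"
        by (rule nn_integral_square_le_of_mollify_bound[OF \<psi>(1,2) e lim B])
      also have "\<dots> \<le> B * (?X + ennreal (d / (b + 1)))" by (intro mult_left_mono \<psi>(4)) simp
      also have "\<dots> = B * ?X + ennreal b * ennreal (d / (b + 1))" by (simp add: distrib_left b)
      also have "ennreal b * ennreal (d / (b + 1)) \<le> ennreal d"
        using b d by (subst ennreal_mult[symmetric]) (auto intro!: ennreal_leI simp: divide_simps)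
      finally show "?X\<^sup>2 \<le> B * ?X + ennreal d" by (simp add: add_left_mono)
    qed
    obtain r where r: "?X = ennreal r" "0 \<le> r" using Xfin by (cases ?X) auto
    have "r\<^sup>2 \<le> b * r" using \<open>?X\<^sup>2 \<le> B * ?X\<close> b r by (simp add: ennreal_power ennreal_mult[symmetric])
    then have "r \<le> b" using r b by (cases "r = 0") (auto simp: power2_eq_square)
    then show ?thesis using r b by simp
  qed
  have "(h x)\<^sup>2 \<le> liminf (\<lambda>i. (g i x)\<^sup>2)" for x
  proof -
    have "(\<lambda>i. f i x) \<longlonglongrightarrow> (SUP i. f i x)"
      using f(2) by (intro LIMSEQ_SUP) (auto simp: incseq_def le_fun_def)
    moreover have "\<forall>\<^sub>F i in sequentially. f i x = g i x"
    proof -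
      obtain n where "norm x < real n" using reals_Archimedean2 by blast
      then show ?thesis by (auto simp: eventually_sequentially g_def intro!: exI[of _ n])
    qed
    ultimately have "(\<lambda>i. g i x) \<longlonglongrightarrow> h x" by (simp add: f(4) tendsto_cong)
    from tendsto_mult_ennreal[OF this this]
    have "(\<lambda>i. (g i x)\<^sup>2) \<longlonglongrightarrow> (h x)\<^sup>2"
      by (auto simp: power2_eq_square)
    then show ?thesis by (simp add: lim_imp_Liminf)
  qed
  then have "(\<integral>\<^sup>+x. (h x)\<^sup>2 \<partial>lborel) \<le> (\<integral>\<^sup>+x. liminf (\<lambda>i. (g i x)\<^sup>2) \<partial>lborel)"
    by (intro nn_integral_mono)
  also have "\<dots> \<le> liminf (\<lambda>i. \<integral>\<^sup>+x. (g i x)\<^sup>2 \<partial>lborel)"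
    by (rule nn_integral_liminf) measurable
  also have "\<dots> \<le> B" by (intro Liminf_le) (auto intro: always_eventually g2)
  finally show ?thesis .
qed

text \<open>
  Averaging against a probability density does not increase the \<open>L\<^sup>2\<close> norm.
\<close>

lemma mollify_square_le_density_square:
  assumes h [measurable]: "h \<in> borel_measurable borel" and \<mu>: "\<mu> = density lborel h" and e: "0 < e"
  shows "(\<integral>\<^sup>+x. (mollify e \<mu> x)\<^sup>2 \<partial>lborel) \<le> (\<integral>\<^sup>+x. (h x)\<^sup>2 \<partial>lborel)"
proof -
  have "(mollify e \<mu> x)\<^sup>2 \<le> (\<integral>\<^sup>+y. ennreal (heat_kernel e (x - y)) * (h y)\<^sup>2 \<partial>lborel)" for x
  proof -
    let ?r = "\<lambda>y. ennreal (sqrt (heat_kernel e (x - y)))"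
    have r: "(?r y)\<^sup>2 = ennreal (heat_kernel e (x - y))" for y
      using heat_kernel_nonneg[OF e, of "x - y"] by (simp add: ennreal_power)
    have "mollify e \<mu> x = (\<integral>\<^sup>+y. h y * ennreal (heat_kernel e (x - y)) \<partial>lborel)"
      unfolding mollify_def \<mu> by (subst nn_integral_density) auto
    also have "\<dots> = (\<integral>\<^sup>+y. ?r y * (?r y * h y) \<partial>lborel)"
      unfolding r[symmetric] by (simp only: power2_eq_square mult_ac)
    finally have "(mollify e \<mu> x)\<^sup>2 \<le> (\<integral>\<^sup>+y. (?r y)\<^sup>2 \<partial>lborel) * (\<integral>\<^sup>+y. (?r y * h y)\<^sup>2 \<partial>lborel)"
      by (simp only:) (rule Cauchy_Schwarz_nn_integral; measurable)
    also have "(\<integral>\<^sup>+y. (?r y)\<^sup>2 \<partial>lborel) = 1"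
    proof -
      have "heat_kernel e (x - y) = heat_kernel e (y - x)" for y
        by (simp add: heat_kernel_def norm_minus_commute)
      then show ?thesis unfolding r using nn_integral_heat_kernel[OF e, of x] by simp
    qed
    finally show ?thesis by (simp add: power_mult_distrib r)
  qed
  then have "(\<integral>\<^sup>+x. (mollify e \<mu> x)\<^sup>2 \<partial>lborel) \<le> (\<integral>\<^sup>+x. \<integral>\<^sup>+y. ennreal (heat_kernel e (x - y)) * (h y)\<^sup>2 \<partial>lborel \<partial>lborel)"
    by (intro nn_integral_mono)
  also have "\<dots> = (\<integral>\<^sup>+y. \<integral>\<^sup>+x. ennreal (heat_kernel e (x - y)) * (h y)\<^sup>2 \<partial>lborel \<partial>lborel)"
    by (rule lborel_pair.Fubini') measurable
  also have "\<dots> = (\<integral>\<^sup>+y. (h y)\<^sup>2 \<partial>lborel)"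
    by (simp add: nn_integral_multc nn_integral_heat_kernel[OF e])
  finally show ?thesis .
qed

end

section \<open>Convolution of the surface measure with itself\<close>

text \<open>
  The surface measure is the radial projection of volume, so it can be read off from a thin shell
  of thickness \<open>e\<close>. On the scale \<open>e\<close> of a Gaussian the shell is indistinguishable from the sphere,
  and integrals over the shell are volume integrals, which are easier to estimate.
\<close>

lemma nn_integral_sphere_shell:
  fixes F :: "real^3 \<Rightarrow> ennreal"
  assumes F [measurable]: "F \<in> borel_measurable borel" and e: "0 < e"
  shows "(\<integral>\<^sup>+z. F (sgn z) * indicator {z. 1 \<le> norm z \<and> norm z < 1 + e} z \<partial>lborel)
     = ennreal (((1 + e) ^ 3 - 1) / 3) * (\<integral>\<^sup>+x. F x \<partial>sphere_measure)"
proof -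
  let ?S = "{z :: real^3. 1 \<le> norm z \<and> norm z < 1 + e}"
  have [measurable]: "?S \<in> sets borel" by measurable
  let ?c = "((1 + e) ^ 3 - 1) / 3"
  have c: "0 \<le> ?c" using e by (simp add: one_le_power)
  have eq: "distr (density lborel (indicator ?S)) borel sgn = density sphere_measure (\<lambda>_. ennreal ?c)"
  proof (rule measure_eqI)
    fix A :: "(real^3) set" assume "A \<in> sets (distr (density lborel (indicator ?S)) borel sgn)"
    then have A [measurable]: "A \<in> sets borel" by simp
    have B [measurable]: "sgn -` A \<in> sets (borel :: (real^3) measure)"
      using measurable_sets_borel[OF borel_measurable_sgn_vec A] by simp
    let ?v = "emeasure lborel (ball 0 1 \<inter> sgn -` A :: (real^3) set)"
    have "?v \<le> emeasure lborel (ball (0::real^3) 1)" by (intro emeasure_mono) auto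
    also have "\<dots> < \<top>" using emeasure_lborel_ball_finite[of "0::real^3" 1] by simp
    finally obtain r where r: "?v = ennreal r" "0 \<le> r" by (cases ?v) auto
    have [measurable]: "(\<lambda>x. indicator (ball 0 (1 + e) \<inter> sgn -` A) x :: ennreal) \<in> borel_measurable (borel :: (real^3) measure)"
      using B by (intro borel_measurable_indicator sets.Int) auto
    have "emeasure lborel (ball 0 (1 + e) \<inter> sgn -` A :: (real^3) set)
        = (\<integral>\<^sup>+x. indicator (ball 0 (1 + e) \<inter> sgn -` A :: (real^3) set) x \<partial>lborel)"
      by simp
    also have "\<dots> = (\<integral>\<^sup>+z. ennreal (\<bar>1 + e\<bar> ^ 3) * indicator (ball 0 (1 + e) \<inter> sgn -` A :: (real^3) set) (0 + (1 + e) *\<^sub>R z) \<partial>lborel)"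
      using e by (subst lborel_affine[of "1 + e" "0 :: real^3"]) (simp_all add: nn_integral_density nn_integral_distr del: nn_integral_indicator)
    also have "\<dots> = (\<integral>\<^sup>+z. ennreal ((1 + e) ^ 3) * indicator (ball 0 1 \<inter> sgn -` A :: (real^3) set) z \<partial>lborel)"
      using e by (intro nn_integral_cong) (auto simp: sgn_scaleR split: split_indicator)
    also have "\<dots> = ennreal ((1 + e) ^ 3) * ?v"
      by (rule nn_integral_cmult_indicator) simp
    finally have R: "emeasure lborel (ball 0 (1 + e) \<inter> sgn -` A :: (real^3) set) = ennreal ((1 + e) ^ 3 * r)"
      using e r by (simp add: ennreal_mult)
    have "ball 0 (1 + e) \<inter> sgn -` A = (ball 0 1 \<inter> sgn -` A) \<union> (?S \<inter> sgn -` A)"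
      using e by auto
    then have "ennreal ((1 + e) ^ 3 * r) = ?v + emeasure lborel (?S \<inter> sgn -` A)"
      unfolding R[symmetric] by (simp only:) (rule plus_emeasure[symmetric]; auto)
    then have "ennreal ((1 + e) ^ 3 * r) - ennreal r = emeasure lborel (?S \<inter> sgn -` A)"
      unfolding r by simp
    then have S: "emeasure lborel (?S \<inter> sgn -` A) = ennreal (((1 + e) ^ 3 - 1) * r)"
      using r by (simp add: ennreal_minus algebra_simps)
    have "emeasure (distr (density lborel (indicator ?S)) borel sgn) A = (\<integral>\<^sup>+x. indicator ?S x * indicator (sgn -` A) x \<partial>lborel)"
      by (simp add: emeasure_distr emeasure_density)
    also have "\<dots> = emeasure lborel (?S \<inter> sgn -` A)"
    proof -
      have "indicator ?S x * indicator (sgn -` A) x = (indicator (?S \<inter> sgn -` A) x :: ennreal)" for x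
        by (simp add: indicator_inter_arith)
      then show ?thesis by simp
    qed
    also have "\<dots> = ennreal ?c * emeasure sphere_measure A"
    proof -
      have "ennreal (((1 + e) ^ 3 - 1) * r) = ennreal ?c * (ennreal 3 * ennreal r)"
        using c r by (simp only: ennreal_mult[symmetric] mult_nonneg_nonneg zero_le_numeral) simp
      then show ?thesis unfolding S by (simp add: emeasure_sphere_measure r)
    qed
    also have "\<dots> = emeasure (density sphere_measure (\<lambda>_. ennreal ?c)) A"
      by (simp add: emeasure_density nn_integral_cmult_indicator)
    finally show "emeasure (distr (density lborel (indicator ?S)) borel sgn) A = emeasure (density sphere_measure (\<lambda>_. ennreal ?c)) A" .
  qed simp
  have "(\<integral>\<^sup>+z. F (sgn z) * indicator ?S z \<partial>lborel) = (\<integral>\<^sup>+z. F (sgn z) \<partial>density lborel (indicator ?S))"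
    by (subst nn_integral_density) (simp_all add: mult.commute)
  also have "\<dots> = (\<integral>\<^sup>+x. F x \<partial>distr (density lborel (indicator ?S)) borel sgn)"
    by (subst nn_integral_distr) simp_all
  also have "\<dots> = ennreal ?c * (\<integral>\<^sup>+x. F x \<partial>sphere_measure)"
    unfolding eq by (simp add: nn_integral_density nn_integral_cmult)
  finally show ?thesis .
qed

lemma nn_integral_sphere_le_shell:
  fixes F :: "real^3 \<Rightarrow> ennreal"
  assumes F [measurable]: "F \<in> borel_measurable borel" and e: "0 < e"
  shows "ennreal e * (\<integral>\<^sup>+x. F x \<partial>sphere_measure)
     \<le> (\<integral>\<^sup>+z. F (sgn z) * indicator {z. 1 \<le> norm z \<and> norm z < 1 + e} z \<partial>lborel)"
proof -
  have "e \<le> ((1 + e) ^ 3 - 1) / 3"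
    using e by (simp add: power3_eq_cube algebra_simps)
  then show ?thesis unfolding nn_integral_sphere_shell[OF assms]
    by (intro mult_right_mono ennreal_leI) auto
qed

lemma nn_integral_sphere_uminus:
  assumes [measurable]: "F \<in> borel_measurable borel"
  shows "(\<integral>\<^sup>+x. F (- x) \<partial>sphere_measure) = (\<integral>\<^sup>+x. F x \<partial>sphere_measure)"
  by (subst (2) distr_sphere_measure_uminus[symmetric], subst nn_integral_distr) simp_all

lemma sgn_near:
  fixes z :: "'a::real_normed_vector"
  assumes "1 \<le> norm z" "norm z < 1 + e"
  shows "norm (z - sgn z) \<le> e"
proof -
  have "z \<noteq> 0" using assms by auto
  then have "z - sgn z = (norm z - 1) *\<^sub>R sgn z" by (simp add: sgn_div_norm algebra_simps)
  then show ?thesis using assms \<open>z \<noteq> 0\<close> by (simp add: norm_sgn)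
qed

lemma add_power2_le: "(x + y :: real)\<^sup>2 \<le> 2 * x\<^sup>2 + 2 * y\<^sup>2"
  using sum_squares_bound[of x y] by (simp add: power2_sum)

lemma gauss_kernel_3: "gauss_kernel e (w :: real^3) = (sqrt pi / e) ^ 3 * exp (- (norm w)\<^sup>2 / (4 * e\<^sup>2))"
proof -
  have "DIM(real^3) = 3" by simp
  then show ?thesis by (simp only: gauss_kernel_def)
qed

text \<open>
  The convolution of the surface measure with the Gaussian is a bump of height of order \<open>1 / e\<close> and
  width \<open>e\<close> around the unit sphere. One half of the Gaussian exponent gives the decay in
  \<open>norm y - 1\<close>; the other half is compared with its integral over all of space.
\<close>

lemma nn_integral_sphere_gauss_kernel_le:
  fixes y :: "real^3"
  assumes e: "0 < e"
  shows "(\<integral>\<^sup>+d. ennreal (gauss_kernel e (y + d)) \<partial>sphere_measure)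
     \<le> ennreal (64 * pi ^ 3 * exp (1 / 8) / e * exp (- (norm y - 1)\<^sup>2 / (8 * e\<^sup>2)))"
proof -
  let ?S = "{z :: real^3. 1 \<le> norm z \<and> norm z < 1 + e}"
  let ?E = "exp (- (norm y - 1)\<^sup>2 / (8 * e\<^sup>2))"
  let ?k = "(sqrt pi / e) ^ 3 * exp (1 / 8) * ?E"
  have k: "0 \<le> ?k" using e by simp
  have pw: "gauss_kernel e (y + sgn z) \<le> ?k * exp (- (1 / (4 * e))\<^sup>2 * (norm (z - (- y)))\<^sup>2)" if z: "z \<in> ?S" for z
  proof -
    let ?w = "norm (y + sgn z)"
    have "z \<noteq> 0" using z by auto
    then have n: "norm (sgn z) = 1" by (simp add: norm_sgn)
    have "\<bar>norm y - 1\<bar> \<le> ?w" using norm_triangle_ineq3[of y "- sgn z"] n by simp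
    then have 1: "(norm y - 1)\<^sup>2 \<le> ?w\<^sup>2" by (simp add: abs_le_square_iff[symmetric])
    have "norm (y + z) \<le> ?w + e"
      using norm_triangle_ineq[of "y + sgn z" "z - sgn z"] sgn_near[of z e] z by simp
    then have "(norm (y + z))\<^sup>2 \<le> (?w + e)\<^sup>2" by (intro power_mono) auto
    also have "\<dots> \<le> 2 * ?w\<^sup>2 + 2 * e\<^sup>2" by (rule add_power2_le)
    finally have 2: "(norm (y + z))\<^sup>2 \<le> 2 * ?w\<^sup>2 + 2 * e\<^sup>2" .
    have "2 * (norm y - 1)\<^sup>2 + (norm (y + z))\<^sup>2 \<le> 4 * ?w\<^sup>2 + 2 * e\<^sup>2" using 1 2 by linarith
    then have "(2 * (norm y - 1)\<^sup>2 + (norm (y + z))\<^sup>2) / (16 * e\<^sup>2) \<le> (4 * ?w\<^sup>2 + 2 * e\<^sup>2) / (16 * e\<^sup>2)"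
      by (intro divide_right_mono) auto
    then have "- ?w\<^sup>2 / (4 * e\<^sup>2) \<le> 1 / 8 + - (norm y - 1)\<^sup>2 / (8 * e\<^sup>2) + - (1 / (4 * e))\<^sup>2 * (norm (y + z))\<^sup>2"
      using e by (simp add: add_divide_distrib power_divide power_mult_distrib)
    then have "exp (- ?w\<^sup>2 / (4 * e\<^sup>2)) \<le> exp (1 / 8) * ?E * exp (- (1 / (4 * e))\<^sup>2 * (norm (y + z))\<^sup>2)"
      by (simp only: exp_add[symmetric] exp_le_cancel_iff)
    then have "(sqrt pi / e) ^ 3 * exp (- ?w\<^sup>2 / (4 * e\<^sup>2))
       \<le> (sqrt pi / e) ^ 3 * (exp (1 / 8) * ?E * exp (- (1 / (4 * e))\<^sup>2 * (norm (y + z))\<^sup>2))"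
      using e by (intro mult_left_mono) auto
    then show ?thesis by (simp only: gauss_kernel_3 mult.assoc add.commute diff_minus_eq_add)
  qed
  have "ennreal e * (\<integral>\<^sup>+d. ennreal (gauss_kernel e (y + d)) \<partial>sphere_measure)
     \<le> (\<integral>\<^sup>+z. ennreal (gauss_kernel e (y + sgn z)) * indicator ?S z \<partial>lborel)"
    by (rule nn_integral_sphere_le_shell[OF _ e]) measurable
  also have "\<dots> \<le> (\<integral>\<^sup>+z. ennreal ?k * ennreal (exp (- (1 / (4 * e))\<^sup>2 * (norm (z - (- y)))\<^sup>2)) \<partial>lborel)"
  proof (intro nn_integral_mono)
    fix z :: "real^3"
    show "ennreal (gauss_kernel e (y + sgn z)) * indicator ?S z \<le> ennreal ?k * ennreal (exp (- (1 / (4 * e))\<^sup>2 * (norm (z - (- y)))\<^sup>2))"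
    proof (cases "z \<in> ?S")
      case True
      then show ?thesis using pw[OF True] by (subst ennreal_mult[symmetric]) (auto intro: ennreal_leI simp: e k)
    qed simp
  qed
  also have "\<dots> = ennreal ?k * ennreal ((sqrt pi / (1 / (4 * e))) ^ 3)"
    using nn_integral_gaussian[of "1 / (4 * e)" "- y"] e by (subst nn_integral_cmult) simp_all
  also have "\<dots> = ennreal (?k * (sqrt pi / (1 / (4 * e))) ^ 3)"
    using e by (intro ennreal_mult[symmetric]) auto
  also have "?k * (sqrt pi / (1 / (4 * e))) ^ 3 = e * (64 * pi ^ 3 * exp (1 / 8) / e * ?E)"
  proof -
    have "sqrt pi * sqrt pi = pi" by simp
    then have "sqrt pi ^ 3 * sqrt pi ^ 3 = pi ^ 3" by (simp only: power_mult_distrib[symmetric])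
    then show ?thesis using e by (simp add: power_mult_distrib power_divide field_simps)
  qed
  also have "ennreal \<dots> = ennreal e * ennreal (64 * pi ^ 3 * exp (1 / 8) / e * ?E)"
    using e by (intro ennreal_mult) auto
  finally show ?thesis
    using e by (subst (asm) ennreal_mult_le_mult_iff) auto
qed

text \<open>
  An identification of \<open>\<real> \<times> \<real>\<^sup>2\<close> with \<open>\<real>\<^sup>3\<close> that preserves volume, for slicing \<open>\<real>\<^sup>3\<close> by parallel planes.
\<close>

definition triple_vec :: "real \<times> real \<times> real \<Rightarrow> real^3" where
  "triple_vec p = vector [fst p, fst (snd p), snd (snd p)]"

lemma triple_vec_nth [simp]: "triple_vec p $ 1 = fst p" "triple_vec p $ 2 = fst (snd p)" "triple_vec p $ 3 = snd (snd p)"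
  by (simp_all add: triple_vec_def vector_3)

lemma triple_vec_measurable [measurable]: "triple_vec \<in> borel_measurable borel"
proof (rule borel_measurable_continuous_onI)
  have "linear triple_vec"
    by (rule linearI) (simp_all add: vec_eq_iff forall_3)
  then show "continuous_on UNIV triple_vec"
    by (simp add: linear_continuous_on linear_linear)
qed

lemma lborel_eq_distr_triple_vec: "lborel = distr lborel borel triple_vec"
proof (rule lborel_eqI)
  fix l u :: "real^3" assume le: "\<And>b. b \<in> Basis \<Longrightarrow> l \<bullet> b \<le> u \<bullet> b"
  have lu: "l $ i \<le> u $ i" for i
    using le[of "axis i 1"] by (auto simp: Basis_vec_def inner_axis)
  have "triple_vec -` box l u = {l $ 1 <..< u $ 1} \<times> ({l $ 2 <..< u $ 2} \<times> {l $ 3 <..< u $ 3})"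
    by (auto simp: mem_box_cart forall_3)
  then have "emeasure (distr lborel borel triple_vec) (box l u)
      = emeasure (lborel \<Otimes>\<^sub>M (lborel \<Otimes>\<^sub>M lborel)) ({l $ 1 <..< u $ 1} \<times> ({l $ 2 <..< u $ 2} \<times> {l $ 3 <..< u $ 3}))"
    by (simp add: emeasure_distr lborel_prod)
  also have "\<dots> = ennreal (u $ 1 - l $ 1) * (ennreal (u $ 2 - l $ 2) * ennreal (u $ 3 - l $ 3))"
  proof -
    have sf: "sigma_finite_measure (lborel \<Otimes>\<^sub>M lborel :: (real \<times> real) measure)"
      unfolding lborel_prod by (rule lborel.sigma_finite_measure_axioms)
    show ?thesis
      using lu by (simp add: sigma_finite_measure.emeasure_pair_measure_Times[OF sf] lborel.emeasure_pair_measure_Times)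
  qed
  also have "\<dots> = ennreal ((u $ 1 - l $ 1) * ((u $ 2 - l $ 2) * (u $ 3 - l $ 3)))"
    using lu by (simp add: ennreal_mult)
  also have "(u $ 1 - l $ 1) * ((u $ 2 - l $ 2) * (u $ 3 - l $ 3)) = (\<Prod>b\<in>Basis. (u - l) \<bullet> b)"
  proof -
    have B: "(Basis :: (real^3) set) = range (\<lambda>i. axis i 1)" by (auto simp: Basis_vec_def)
    have "inj (\<lambda>i::3. axis i (1::real))" by (auto intro!: injI simp: axis_eq_axis)
    then have "(\<Prod>b\<in>Basis. (u - l) \<bullet> b) = (\<Prod>i\<in>UNIV. (u - l) $ i)"
      unfolding B by (subst prod.reindex) (simp_all add: inner_axis)
    also have "\<dots> = (u - l) $ 1 * ((u - l) $ 2 * (u - l) $ 3)"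
      unfolding UNIV_3 by simp
    finally show ?thesis by (simp only: vector_minus_component)
  qed
  finally show "emeasure (distr lborel borel triple_vec) (box l u) = ennreal (\<Prod>b\<in>Basis. (u - l) \<bullet> b)" .
qed simp

lemma lborel_eq_distr_orthogonal:
  fixes T :: "real^3 \<Rightarrow> real^3"
  assumes T: "orthogonal_transformation T"
  shows "lborel = distr lborel borel T"
proof (rule lborel_eqI)
  have lin: "linear T" using T by (rule orthogonal_transformation_linear)
  then have [measurable]: "T \<in> borel_measurable borel"
    by (intro borel_measurable_continuous_onI) (simp add: linear_continuous_on linear_linear)
  fix l u :: "real^3" assume le: "\<And>b. b \<in> Basis \<Longrightarrow> l \<bullet> b \<le> u \<bullet> b"
  have bij: "bij T" using T by (rule orthogonal_transformation_bij)
  have pre: "T -` box l u = inv T ` box l u" using bij by (rule bij_vimage_eq_inv_image)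
  have oi: "orthogonal_transformation (inv T)" using T by (rule orthogonal_transformation_inv)
  have lm: "T -` box l u \<in> lmeasurable" "measure lebesgue (T -` box l u) = measure lebesgue (box l u)"
    unfolding pre by (rule measurable_orthogonal_image[OF oi], simp) (rule measure_orthogonal_image[OF oi], simp)
  have m: "T -` box l u \<in> sets borel"
    by (rule measurable_sets_borel[of T borel]) simp_all
  have "emeasure (distr lborel borel T) (box l u) = emeasure lborel (T -` box l u)"
    by (simp add: emeasure_distr)
  also have "\<dots> = emeasure lebesgue (T -` box l u)" using m by (simp add: emeasure_completion)
  also have "\<dots> = emeasure lebesgue (box l u)"
    using lm by (simp add: emeasure_eq_measure2 fmeasurableD)
  also have "\<dots> = emeasure lborel (box l u)" by simp
  also have "\<dots> = ennreal (\<Prod>b\<in>Basis. (u - l) \<bullet> b)" using le by (simp add: emeasure_lborel_box)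
  finally show "emeasure (distr lborel borel T) (box l u) = ennreal (\<Prod>b\<in>Basis. (u - l) \<bullet> b)" .
qed simp

lemma shell_sets: "{z :: real^3. 1 \<le> norm z \<and> norm z < 1 + e} \<in> sets borel"
  by measurable

text \<open>
  Archimedes' theorem for a shell: a plane at height \<open>t\<close> meets it in the annulus with squared radii
  \<open>1 - t\<^sup>2\<close> and \<open>(1 + e)\<^sup>2 - t\<^sup>2\<close>, whose area \<open>\<pi> ((1 + e)\<^sup>2 - 1)\<close> does not depend on \<open>t\<close>. A rotation takes \<open>u\<close>
  to a coordinate axis.
\<close>

lemma nn_integral_shell_slices_le:
  fixes u :: "real^3" and \<phi> :: "real \<Rightarrow> ennreal"
  assumes u: "norm u = 1" and e: "0 < e" "e \<le> 1" and \<phi> [measurable]: "\<phi> \<in> borel_measurable borel"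
  shows "(\<integral>\<^sup>+z. \<phi> (u \<bullet> z) * indicator {z. 1 \<le> norm z \<and> norm z < 1 + e} z \<partial>lborel)
     \<le> ennreal (3 * pi * e) * (\<integral>\<^sup>+t. \<phi> t \<partial>lborel)"
proof -
  let ?S = "{z :: real^3. 1 \<le> norm z \<and> norm z < 1 + e}"
  obtain T :: "real^3 \<Rightarrow> real^3" where T: "orthogonal_transformation T" "T (axis 1 1) = u"
    using orthogonal_transformation_exists_1[of "axis 1 1 :: real^3" u] u by (auto simp: norm_axis_1)
  have lin: "linear T" using T(1) by (rule orthogonal_transformation_linear)
  then have [measurable]: "T \<in> borel_measurable borel"
    by (intro borel_measurable_continuous_onI) (simp add: linear_continuous_on linear_linear)
  have uT: "u \<bullet> T z = z $ 1" for z
  proof -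
    have "u \<bullet> T z = axis 1 1 \<bullet> z"
      using T unfolding orthogonal_transformation_def by blast
    then show ?thesis by (simp only: inner_commute[of _ z] cart_eq_inner_axis)
  qed
  have nT: "norm (T z) = norm z" for z
    using T(1) by (simp add: orthogonal_transformation_norm)
  have nV: "(norm (triple_vec (t, w)))\<^sup>2 = t\<^sup>2 + (norm w)\<^sup>2" for t w
    unfolding power2_norm_eq_inner inner_vec_def by (cases w) (simp add: sum_3 inner_prod_def power2_eq_square)
  let ?A = "\<lambda>t. {w :: real \<times> real. 1 - t\<^sup>2 \<le> (norm w)\<^sup>2 \<and> (norm w)\<^sup>2 < (1 + e)\<^sup>2 - t\<^sup>2}"
  have inS: "T (triple_vec (t, w)) \<in> ?S \<longleftrightarrow> w \<in> ?A t" for t w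
  proof -
    let ?n = "norm (triple_vec (t, w))"
    have "1 \<le> ?n \<longleftrightarrow> 1\<^sup>2 \<le> ?n\<^sup>2" by (subst power_mono_iff) auto
    moreover have "?n < 1 + e \<longleftrightarrow> ?n\<^sup>2 < (1 + e)\<^sup>2"
      using e power_strict_mono[of ?n "1 + e" 2] power2_less_imp_less[of ?n "1 + e"] by auto
    ultimately show ?thesis unfolding mem_Collect_eq nT nV by auto
  qed
  have area: "emeasure lborel (?A t) \<le> ennreal (3 * pi * e)" for t
  proof (cases "0 < (1 + e)\<^sup>2 - t\<^sup>2")
    case False
    have "\<not> (norm w)\<^sup>2 < (1 + e)\<^sup>2 - t\<^sup>2" for w :: "real \<times> real"
      using False zero_le_power2[of "norm w"] by linarith
    then have "?A t = {}" by blast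
    then show ?thesis by (simp only:) simp
  next
    case True
    define q where "q = (1 + e)\<^sup>2 - t\<^sup>2"
    define p where "p = max 0 (1 - t\<^sup>2)"
    have q: "0 < q" using True by (simp add: q_def)
    have p: "0 \<le> p" by (simp add: p_def)
    have "1 \<le> (1 + e)\<^sup>2" using e by (simp add: one_le_power)
    then have pq: "p \<le> q" using True by (auto simp: p_def q_def)
    have "q - p \<le> (1 + e)\<^sup>2 - 1" by (auto simp: p_def q_def)
    also have "\<dots> \<le> 3 * e" using e by (simp add: power2_eq_square algebra_simps mult_left_le)
    finally have qp: "q - p \<le> 3 * e" .
    have "?A t = ball 0 (sqrt q) - ball 0 (sqrt p)"
    proof -
      have sq: "norm w < sqrt r \<longleftrightarrow> (norm w)\<^sup>2 < r" for w :: "real \<times> real" and r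
        using real_sqrt_less_iff[of "(norm w)\<^sup>2" r] by simp
      have "w \<in> ?A t \<longleftrightarrow> w \<in> ball 0 (sqrt q) - ball 0 (sqrt p)" for w
        using zero_le_power2[of "norm w"] by (simp only: mem_Collect_eq Diff_iff mem_ball_0 sq p_def q_def max_less_iff_conj not_less max.bounded_iff less_max_iff_disj) linarith
      then show ?thesis by blast
    qed
    then have "emeasure lborel (?A t) = emeasure lborel (ball (0 :: real \<times> real) (sqrt q) - ball 0 (sqrt p))"
      by (simp only:)
    also have "\<dots> = emeasure lborel (ball (0 :: real \<times> real) (sqrt q)) - emeasure lborel (ball (0 :: real \<times> real) (sqrt p))"
    proof (rule emeasure_Diff)
      show "emeasure lborel (ball (0 :: real \<times> real) (sqrt p)) \<noteq> \<infinity>"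
        using emeasure_lborel_ball_finite[of "0 :: real \<times> real" "sqrt p"] by (simp only: infinity_ennreal_def less_top)
      show "ball (0 :: real \<times> real) (sqrt p) \<subseteq> ball 0 (sqrt q)"
        by (rule subset_ball) (use pq in simp)
    qed simp_all
    also have "\<dots> = ennreal (pi * q) - ennreal (pi * p)"
      using p q by (simp add: emeasure_ball unit_ball_vol_2)
    also have "\<dots> = ennreal (pi * (q - p))"
      using p by (simp add: ennreal_minus algebra_simps)
    also have "\<dots> \<le> ennreal (3 * pi * e)"
      using mult_left_mono[OF qp, of pi] by (intro ennreal_leI) (simp add: mult_ac)
    finally show ?thesis .
  qed
  define B where "B = {p :: real \<times> real \<times> real. 1 - (fst p)\<^sup>2 \<le> (norm (snd p))\<^sup>2 \<and> (norm (snd p))\<^sup>2 < (1 + e)\<^sup>2 - (fst p)\<^sup>2}"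
  have [measurable]: "B \<in> sets (borel \<Otimes>\<^sub>M borel)"
  proof -
    have "{p \<in> space (borel \<Otimes>\<^sub>M borel). 1 - (fst p)\<^sup>2 \<le> (norm (snd p :: real \<times> real))\<^sup>2 \<and> (norm (snd p))\<^sup>2 < (1 + e)\<^sup>2 - (fst p)\<^sup>2}
        \<in> sets (borel \<Otimes>\<^sub>M borel)"
      by measurable
    then show ?thesis by (simp add: B_def space_pair_measure)
  qed
  note shell_sets[measurable]
  define G where "G z = \<phi> (u \<bullet> z) * indicator ?S z" for z
  have G [measurable]: "G \<in> borel_measurable borel" unfolding G_def[abs_def] by measurable
  have GT: "G (T (triple_vec p)) = \<phi> (fst p) * indicator B p" for p
  proof -
    have "T (triple_vec p) \<in> ?S \<longleftrightarrow> p \<in> B"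
      using inS[of "fst p" "snd p"] unfolding B_def by (simp only: prod.collapse mem_Collect_eq)
    then have "indicator ?S (T (triple_vec p)) = (indicator B p :: ennreal)"
      by (simp only: indicator_def)
    then show ?thesis unfolding G_def uT by (simp only: triple_vec_nth)
  qed
  have "(\<integral>\<^sup>+z. G z \<partial>lborel) = (\<integral>\<^sup>+z. G z \<partial>distr lborel borel T)"
    by (simp only: lborel_eq_distr_orthogonal[OF T(1), symmetric])
  also have "\<dots> = (\<integral>\<^sup>+z. G (T z) \<partial>lborel)"
    by (rule nn_integral_distr) measurable
  also have "\<dots> = (\<integral>\<^sup>+z. G (T z) \<partial>distr lborel borel triple_vec)"
    by (simp only: lborel_eq_distr_triple_vec[symmetric])
  also have "\<dots> = (\<integral>\<^sup>+p. G (T (triple_vec p)) \<partial>lborel)"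
    by (rule nn_integral_distr) measurable
  also have "\<dots> = (\<integral>\<^sup>+p. \<phi> (fst p) * indicator B p \<partial>(lborel \<Otimes>\<^sub>M lborel))"
    unfolding lborel_prod GT by (rule refl)
  also have "\<dots> = (\<integral>\<^sup>+t. \<integral>\<^sup>+w. \<phi> (fst (t, w)) * indicator B (t, w) \<partial>lborel \<partial>lborel)"
    by (rule lborel.nn_integral_fst[symmetric]) measurable
  also have "\<dots> \<le> (\<integral>\<^sup>+t. \<phi> t * ennreal (3 * pi * e) \<partial>lborel)"
  proof (rule nn_integral_mono)
    fix t :: real
    have "?A t \<in> sets lborel" by measurable
    moreover have "indicator B (t, w) = (indicator (?A t) w :: ennreal)" for w
      by (simp add: B_def indicator_def)
    ultimately have "(\<integral>\<^sup>+w. \<phi> (fst (t, w)) * indicator B (t, w) \<partial>lborel) = \<phi> t * emeasure lborel (?A t)"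
      by (simp only: fst_conv nn_integral_cmult_indicator)
    also have "\<dots> \<le> \<phi> t * ennreal (3 * pi * e)"
      by (intro mult_left_mono area) simp
    finally show "(\<integral>\<^sup>+w. \<phi> (fst (t, w)) * indicator B (t, w) \<partial>lborel) \<le> \<phi> t * ennreal (3 * pi * e)" .
  qed
  also have "\<dots> = (\<integral>\<^sup>+t. \<phi> t \<partial>lborel) * ennreal (3 * pi * e)"
    by (rule nn_integral_multc) measurable
  finally show ?thesis unfolding G_def by (simp only: mult.commute)
qed

lemma nn_integral_gaussian_line:
  assumes k: "0 < k"
  shows "(\<integral>\<^sup>+t. ennreal (exp (- k\<^sup>2 * (s + t)\<^sup>2)) \<partial>lborel) = ennreal (sqrt pi / k)"
  using nn_integral_gaussian[OF k, of "- s"] by (simp add: add.commute)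

text \<open>
  The part of the sphere between two parallel planes at distance of order \<open>e\<close> has area of order \<open>e\<close>,
  wherever the planes are.
\<close>

lemma nn_integral_sphere_slab_le:
  fixes u :: "real^3"
  assumes u: "norm u = 1" and e: "0 < e" "e \<le> 1" and k: "0 < k"
  shows "(\<integral>\<^sup>+c. ennreal (exp (- k\<^sup>2 * (s + u \<bullet> c)\<^sup>2 / e\<^sup>2)) \<partial>sphere_measure)
     \<le> ennreal (exp (k\<^sup>2) * 3 * pi * sqrt (2 * pi) / k * e)"
proof -
  let ?S = "{z :: real^3. 1 \<le> norm z \<and> norm z < 1 + e}"
  let ?k = "k / (sqrt 2 * e)"
  have k': "0 < ?k" using k e by simp
  have pw: "exp (- k\<^sup>2 * (s + u \<bullet> sgn z)\<^sup>2 / e\<^sup>2) \<le> exp (k\<^sup>2) * exp (- ?k\<^sup>2 * (s + u \<bullet> z)\<^sup>2)" if z: "z \<in> ?S" for z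
  proof -
    have "\<bar>u \<bullet> (z - sgn z)\<bar> \<le> norm u * norm (z - sgn z)" by (rule Cauchy_Schwarz_ineq2)
    also have "\<dots> \<le> e" using u sgn_near[of z e] z by simp
    finally have "(u \<bullet> (z - sgn z))\<^sup>2 \<le> e\<^sup>2" using e by (simp add: abs_le_square_iff[symmetric])
    moreover have "(s + u \<bullet> z)\<^sup>2 \<le> 2 * (s + u \<bullet> sgn z)\<^sup>2 + 2 * (u \<bullet> (z - sgn z))\<^sup>2"
      using add_power2_le[of "s + u \<bullet> sgn z" "u \<bullet> (z - sgn z)"] by (simp add: inner_diff_right)
    ultimately have "(s + u \<bullet> z)\<^sup>2 \<le> 2 * (s + u \<bullet> sgn z)\<^sup>2 + 2 * e\<^sup>2" by linarith
    then have "k\<^sup>2 / (2 * e\<^sup>2) * (s + u \<bullet> z)\<^sup>2 \<le> k\<^sup>2 / (2 * e\<^sup>2) * (2 * (s + u \<bullet> sgn z)\<^sup>2 + 2 * e\<^sup>2)"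
      by (intro mult_left_mono) auto
    also have "\<dots> = k\<^sup>2 * (s + u \<bullet> sgn z)\<^sup>2 / e\<^sup>2 + k\<^sup>2"
      using e by (simp add: field_simps)
    finally have "- k\<^sup>2 * (s + u \<bullet> sgn z)\<^sup>2 / e\<^sup>2 \<le> k\<^sup>2 + - ?k\<^sup>2 * (s + u \<bullet> z)\<^sup>2"
      by (simp add: power_divide power_mult_distrib)
    then show ?thesis by (simp only: exp_add[symmetric] exp_le_cancel_iff)
  qed
  have "ennreal e * (\<integral>\<^sup>+c. ennreal (exp (- k\<^sup>2 * (s + u \<bullet> c)\<^sup>2 / e\<^sup>2)) \<partial>sphere_measure)
     \<le> (\<integral>\<^sup>+z. ennreal (exp (- k\<^sup>2 * (s + u \<bullet> sgn z)\<^sup>2 / e\<^sup>2)) * indicator ?S z \<partial>lborel)"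
    by (rule nn_integral_sphere_le_shell[OF _ e(1)]) measurable
  also have "\<dots> \<le> (\<integral>\<^sup>+z. ennreal (exp (k\<^sup>2) * exp (- ?k\<^sup>2 * (s + u \<bullet> z)\<^sup>2)) * indicator ?S z \<partial>lborel)"
  proof (intro nn_integral_mono)
    fix z :: "real^3"
    show "ennreal (exp (- k\<^sup>2 * (s + u \<bullet> sgn z)\<^sup>2 / e\<^sup>2)) * indicator ?S z
       \<le> ennreal (exp (k\<^sup>2) * exp (- ?k\<^sup>2 * (s + u \<bullet> z)\<^sup>2)) * indicator ?S z"
      by (cases "z \<in> ?S") (simp_all only: indicator_simps mult_1_right mult_zero_right order_refl not_False_eq_True ennreal_leI[OF pw])
  qed
  also have "\<dots> \<le> ennreal (3 * pi * e) * (\<integral>\<^sup>+t. ennreal (exp (k\<^sup>2) * exp (- ?k\<^sup>2 * (s + t)\<^sup>2)) \<partial>lborel)"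
    by (rule nn_integral_shell_slices_le[OF u e]) measurable
  also have "(\<integral>\<^sup>+t. ennreal (exp (k\<^sup>2) * exp (- ?k\<^sup>2 * (s + t)\<^sup>2)) \<partial>lborel) = ennreal (exp (k\<^sup>2)) * ennreal (sqrt pi / ?k)"
    unfolding nn_integral_gaussian_line[OF k', symmetric, of s]
    by (subst nn_integral_cmult[symmetric]) (simp_all add: ennreal_mult)
  also have "ennreal (3 * pi * e) * (ennreal (exp (k\<^sup>2)) * ennreal (sqrt pi / ?k)) = ennreal (3 * pi * e * (exp (k\<^sup>2) * (sqrt pi / ?k)))"
    using e k by (simp only: ennreal_mult[symmetric] mult_nonneg_nonneg exp_ge_zero pi_ge_zero zero_le_numeral less_imp_le real_sqrt_ge_zero divide_nonneg_nonneg)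
  also have "3 * pi * e * (exp (k\<^sup>2) * (sqrt pi / ?k)) = e * (exp (k\<^sup>2) * 3 * pi * sqrt (2 * pi) / k * e)"
    using e k by (simp add: real_sqrt_mult field_simps)
  also have "ennreal \<dots> = ennreal e * ennreal (exp (k\<^sup>2) * 3 * pi * sqrt (2 * pi) / k * e)"
    using e k by (intro ennreal_mult) auto
  finally show ?thesis
    using e by (subst (asm) ennreal_mult_le_mult_iff) auto
qed

text \<open>
  The product of the constants of \<open>nn_integral_sphere_gauss_kernel_le\<close> and of
  \<open>nn_integral_sphere_slab_le\<close> for \<open>k = 1 / sqrt 50\<close>.
\<close>

definition kernel_bound :: real where
  "kernel_bound = 64 * pi ^ 3 * exp (1 / 8) * (exp (1 / 50) * 3 * pi * sqrt (2 * pi) * sqrt 50)"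

text \<open>
  The convolution of the surface measure with itself has density \<open>2 \<pi> / |x|\<close> on the ball of radius \<open>2\<close>,
  hence it is bounded away from the origin, and so are its mollifications, uniformly in \<open>e\<close>. The inner
  integral is a bump in \<open>norm (x + c) - 1\<close>; the points \<open>c\<close> of the sphere where it is large lie in a slab
  orthogonal to \<open>x\<close>, because \<open>(norm (x + c))\<^sup>2 - 1 = (norm x)\<^sup>2 + 2 (x \<bullet> c)\<close> is affine in \<open>c\<close>. The slab has
  thickness of order \<open>e\<close>, which cancels the height \<open>1 / e\<close> of the bump.
\<close>

lemma nn_integral_sphere_sphere_gauss_kernel_le:
  fixes x :: "real^3"
  assumes x: "1 / 2 \<le> norm x" and e: "0 < e" "e \<le> 1"
  shows "(\<integral>\<^sup>+c. \<integral>\<^sup>+d. ennreal (gauss_kernel e (x + c + d)) \<partial>sphere_measure \<partial>sphere_measure) \<le> ennreal kernel_bound"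
proof -
  let ?A = "64 * pi ^ 3 * exp (1 / 8) / e"
  \<comment> \<open>Since \<open>norm x / (norm x + 2) \<ge> 1 / 5\<close>, the exponent \<open>(norm (x + c) - 1)\<^sup>2 / 8\<close> is at least
    \<open>4 / (8 * 25)\<close> times \<open>(norm x / 2 + u \<bullet> c)\<^sup>2\<close>.\<close>
  define k where "k = 1 / sqrt (50 :: real)"
  have k: "0 < k" and k2: "k\<^sup>2 = 1 / 50" by (auto simp: k_def power_divide)
  define u where "u = sgn x"
  have x0: "x \<noteq> 0" using x by auto
  have u: "norm u = 1" using x0 by (simp add: u_def norm_sgn)
  have xu: "x \<bullet> c = norm x * (u \<bullet> c)" for c
    using x0 by (simp add: u_def sgn_div_norm)
  have pw: "exp (- (norm (x + c) - 1)\<^sup>2 / (8 * e\<^sup>2)) \<le> exp (- k\<^sup>2 * (norm x / 2 + u \<bullet> c)\<^sup>2 / e\<^sup>2)"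
    if c: "norm c = 1" for c
  proof -
    let ?n = "norm (x + c)"
    have n2: "?n\<^sup>2 = (norm x)\<^sup>2 + 2 * (x \<bullet> c) + 1"
      using c by (simp add: power2_norm_eq_inner inner_add_left inner_add_right inner_commute norm_eq_1)
    have "\<bar>?n - 1\<bar> * (?n + 1) = \<bar>(?n - 1) * (?n + 1)\<bar>"
      unfolding abs_mult by simp
    also have "(?n - 1) * (?n + 1) = ?n\<^sup>2 - 1"
      by (simp add: power2_eq_square algebra_simps)
    also have "?n\<^sup>2 - 1 = norm x * (2 * (norm x / 2 + u \<bullet> c))"
      unfolding n2 xu by (simp add: power2_eq_square algebra_simps)
    finally have eq: "\<bar>?n - 1\<bar> * (?n + 1) = norm x * \<bar>2 * (norm x / 2 + u \<bullet> c)\<bar>"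
      by (simp add: abs_mult)
    have "?n + 1 \<le> norm x + 2" using norm_triangle_ineq[of x c] c by simp
    also have "\<dots> \<le> 5 * norm x" using x by simp
    finally have "\<bar>?n - 1\<bar> * (?n + 1) \<le> \<bar>?n - 1\<bar> * (5 * norm x)"
      by (intro mult_left_mono) auto
    moreover have "\<bar>5 * (?n - 1)\<bar> = 5 * \<bar>?n - 1\<bar>" by (simp only: abs_mult abs_numeral)
    ultimately have "norm x * \<bar>2 * (norm x / 2 + u \<bullet> c)\<bar> \<le> norm x * \<bar>5 * (?n - 1)\<bar>"
      unfolding eq by (simp only: mult_ac)
    then have "\<bar>2 * (norm x / 2 + u \<bullet> c)\<bar> \<le> \<bar>5 * (?n - 1)\<bar>" using x0 by simp
    then have "(2 * (norm x / 2 + u \<bullet> c))\<^sup>2 \<le> (5 * (?n - 1))\<^sup>2" by (simp only: abs_le_square_iff)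
    then have "(norm x / 2 + u \<bullet> c)\<^sup>2 / 50 \<le> (?n - 1)\<^sup>2 / 8"
      unfolding power_mult_distrib by simp
    then have "(norm x / 2 + u \<bullet> c)\<^sup>2 / 50 / e\<^sup>2 \<le> (?n - 1)\<^sup>2 / 8 / e\<^sup>2"
      by (rule divide_right_mono) simp
    then show ?thesis unfolding k2 by simp
  qed
  have "(\<integral>\<^sup>+c. \<integral>\<^sup>+d. ennreal (gauss_kernel e (x + c + d)) \<partial>sphere_measure \<partial>sphere_measure)
     \<le> (\<integral>\<^sup>+c. ennreal ?A * ennreal (exp (- k\<^sup>2 * (norm x / 2 + u \<bullet> c)\<^sup>2 / e\<^sup>2)) \<partial>sphere_measure)"
  proof (rule nn_integral_mono_AE)
    show "AE c in sphere_measure. (\<integral>\<^sup>+d. ennreal (gauss_kernel e (x + c + d)) \<partial>sphere_measure)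
       \<le> ennreal ?A * ennreal (exp (- k\<^sup>2 * (norm x / 2 + u \<bullet> c)\<^sup>2 / e\<^sup>2))"
      using AE_sphere_measure
    proof eventually_elim
      case (elim c)
      have "(\<integral>\<^sup>+d. ennreal (gauss_kernel e (x + c + d)) \<partial>sphere_measure)
        \<le> ennreal (?A * exp (- (norm (x + c) - 1)\<^sup>2 / (8 * e\<^sup>2)))"
        by (rule nn_integral_sphere_gauss_kernel_le[OF e(1)])
      also have "\<dots> \<le> ennreal (?A * exp (- k\<^sup>2 * (norm x / 2 + u \<bullet> c)\<^sup>2 / e\<^sup>2))"
        using pw[of c] elim e by (intro ennreal_leI mult_left_mono) auto
      also have "\<dots> = ennreal ?A * ennreal (exp (- k\<^sup>2 * (norm x / 2 + u \<bullet> c)\<^sup>2 / e\<^sup>2))"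
        using e by (intro ennreal_mult) auto
      finally show ?case .
    qed
  qed
  also have "\<dots> = ennreal ?A * (\<integral>\<^sup>+c. ennreal (exp (- k\<^sup>2 * (norm x / 2 + u \<bullet> c)\<^sup>2 / e\<^sup>2)) \<partial>sphere_measure)"
    by (rule nn_integral_cmult) measurable
  also have "\<dots> \<le> ennreal ?A * ennreal (exp (k\<^sup>2) * 3 * pi * sqrt (2 * pi) / k * e)"
    by (intro mult_left_mono nn_integral_sphere_slab_le[OF u e k]) simp
  also have "\<dots> = ennreal (?A * (exp (k\<^sup>2) * 3 * pi * sqrt (2 * pi) / k * e))"
    using e k by (intro ennreal_mult[symmetric]) auto
  also have "?A * (exp (k\<^sup>2) * 3 * pi * sqrt (2 * pi) / k * e) = kernel_bound"
    using e unfolding kernel_bound_def k2 by (simp add: k_def)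
  finally show ?thesis .
qed

section \<open>Fourfold integrals\<close>

definition integral4 :: "('a \<Rightarrow> 'a \<Rightarrow> 'a \<Rightarrow> 'a \<Rightarrow> ennreal) \<Rightarrow> 'a measure \<Rightarrow> ennreal" where
  "integral4 H M = (\<integral>\<^sup>+a. \<integral>\<^sup>+b. \<integral>\<^sup>+c. \<integral>\<^sup>+d. H a b c d \<partial>M \<partial>M \<partial>M \<partial>M)"

definition measurable4 :: "('a \<Rightarrow> 'a \<Rightarrow> 'a \<Rightarrow> 'a \<Rightarrow> ennreal) \<Rightarrow> 'a measure \<Rightarrow> bool" where
  "measurable4 H M \<longleftrightarrow> (\<lambda>(a, b, c, d). H a b c d) \<in> borel_measurable (M \<Otimes>\<^sub>M M \<Otimes>\<^sub>M M \<Otimes>\<^sub>M M)"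

lemma measurable4_compose:
  assumes H: "measurable4 H M"
    and [measurable]: "f \<in> measurable N M" "g \<in> measurable N M" "h \<in> measurable N M" "k \<in> measurable N M"
  shows "(\<lambda>x. H (f x) (g x) (h x) (k x)) \<in> borel_measurable N"
proof -
  have "(\<lambda>x. (f x, g x, h x, k x)) \<in> measurable N (M \<Otimes>\<^sub>M M \<Otimes>\<^sub>M M \<Otimes>\<^sub>M M)" by measurable
  from measurable_compose[OF this H[unfolded measurable4_def]] show ?thesis by simp
qed

lemma measurable4_swap:
  assumes "measurable4 H M"
  shows "measurable4 (\<lambda>a b c d. H b a c d) M" "measurable4 (\<lambda>a b c d. H a c b d) M" "measurable4 (\<lambda>a b c d. H a b d c) M"
  unfolding measurable4_def case_prod_beta by (rule measurable4_compose[OF assms]; measurable)+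

context sigma_finite_measure
begin

lemma integral4_swap12:
  assumes H: "measurable4 H M"
  shows "integral4 (\<lambda>a b c d. H b a c d) M = integral4 H M"
proof -
  interpret MM: pair_sigma_finite M M ..
  note [measurable (raw)] = measurable4_compose[OF H]
  show ?thesis unfolding integral4_def by (rule MM.Fubini') measurable
qed

lemma integral4_swap23:
  assumes H: "measurable4 H M"
  shows "integral4 (\<lambda>a b c d. H a c b d) M = integral4 H M"
proof -
  interpret MM: pair_sigma_finite M M ..
  note [measurable (raw)] = measurable4_compose[OF H]
  show ?thesis unfolding integral4_def by (rule nn_integral_cong, rule MM.Fubini') measurable
qed

lemma integral4_swap34:
  assumes H: "measurable4 H M"
  shows "integral4 (\<lambda>a b c d. H a b d c) M = integral4 H M"
proof -
  interpret MM: pair_sigma_finite M M ..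
  note [measurable (raw)] = measurable4_compose[OF H]
  show ?thesis unfolding integral4_def by (rule nn_integral_cong, rule nn_integral_cong, rule MM.Fubini') measurable
qed

lemma integral4_add:
  assumes H: "measurable4 H M" and K: "measurable4 K M"
  shows "integral4 (\<lambda>a b c d. H a b c d + K a b c d) M = integral4 H M + integral4 K M"
proof -
  note [measurable (raw)] = measurable4_compose[OF H] measurable4_compose[OF K]
  show ?thesis unfolding integral4_def by (simp add: nn_integral_add cong: nn_integral_cong)
qed

lemma integral4_cmult:
  assumes H: "measurable4 H M"
  shows "integral4 (\<lambda>a b c d. r * H a b c d) M = r * integral4 H M"
proof -
  note [measurable (raw)] = measurable4_compose[OF H]
  show ?thesis unfolding integral4_def by (simp add: nn_integral_cmult cong: nn_integral_cong)
qed

lemma integral4_mono_AE: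
  assumes P: "AE x in M. P x" and le: "\<And>a b c d. P a \<Longrightarrow> P b \<Longrightarrow> P c \<Longrightarrow> P d \<Longrightarrow> H a b c d \<le> K a b c d"
  shows "integral4 H M \<le> integral4 K M"
  unfolding integral4_def
proof (rule nn_integral_mono_AE, use P in eventually_elim)
  fix a assume a: "P a"
  show "(\<integral>\<^sup>+b. \<integral>\<^sup>+c. \<integral>\<^sup>+d. H a b c d \<partial>M \<partial>M \<partial>M) \<le> (\<integral>\<^sup>+b. \<integral>\<^sup>+c. \<integral>\<^sup>+d. K a b c d \<partial>M \<partial>M \<partial>M)"
  proof (rule nn_integral_mono_AE, use P in eventually_elim)
    fix b assume b: "P b"
    show "(\<integral>\<^sup>+c. \<integral>\<^sup>+d. H a b c d \<partial>M \<partial>M) \<le> (\<integral>\<^sup>+c. \<integral>\<^sup>+d. K a b c d \<partial>M \<partial>M)"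
    proof (rule nn_integral_mono_AE, use P in eventually_elim)
      fix c assume c: "P c"
      show "(\<integral>\<^sup>+d. H a b c d \<partial>M) \<le> (\<integral>\<^sup>+d. K a b c d \<partial>M)"
        by (rule nn_integral_mono_AE, use P in eventually_elim) (rule le[OF a b c])
    qed
  qed
qed

end

section \<open>Antipodal symmetrization of the quadrilinear form\<close>

text \<open>
  The pointwise inequality behind the symmetrization. With \<open>u = p + q\<close>, \<open>v = p - q\<close> and
  \<open>p + \<i> q = r exp (\<i> \<theta>)\<close> the six products add up to
  \<open>2 r1 r2 r3 r4 (cos (\<theta>1 + \<theta>2 + \<theta>3 + \<theta>4) + 2 (\<Prod> cos \<theta>j + \<Prod> sin \<theta>j))\<close>. The cosine is at most \<open>1\<close>, and so is
  \<open>\<Prod> cos \<theta>j + \<Prod> sin \<theta>j\<close>. Since \<open>u\<close> and \<open>v\<close> are nonnegative, \<open>|q| \<le> p\<close>, so two of the sines contribute at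
  most \<open>1 / 2\<close>; this leaves the surplus that is recorded by the products of the \<open>k\<close>, and it is the
  source of strictness.
\<close>

lemma six_products_le:
  fixes u v r k :: "nat \<Rightarrow> real"
  assumes u: "\<And>i. 0 \<le> u i" and v: "\<And>i. 0 \<le> v i"
    and r: "\<And>i. r i = sqrt (((u i)\<^sup>2 + (v i)\<^sup>2) / 2)" and k: "\<And>i. k i = ((u i - v i) / 2)\<^sup>2 / r i"
  shows "u 1 * u 2 * v 3 * v 4 + u 1 * v 2 * u 3 * v 4 + v 1 * u 2 * u 3 * v 4
     + u 1 * v 2 * v 3 * u 4 + v 1 * u 2 * v 3 * u 4 + v 1 * v 2 * u 3 * u 4
     + 3 / 2 * (k 1 * k 2 * k 3 * k 4) \<le> 6 * (r 1 * r 2 * r 3 * r 4)"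
proof -
  define p where "p i = (u i + v i) / 2" for i
  define q where "q i = (u i - v i) / 2" for i
  have up: "u i = p i + q i" and vp: "v i = p i - q i" for i by (simp_all add: p_def q_def field_simps)
  have p0: "0 \<le> p i" for i using u v by (simp add: p_def add_nonneg_nonneg)
  have qp: "\<bar>q i\<bar> \<le> p i" for i using u[of i] v[of i] by (simp add: p_def q_def abs_le_iff field_simps)
  have r0: "0 \<le> r i" for i by (simp add: r)
  have r2: "(r i)\<^sup>2 = (p i)\<^sup>2 + (q i)\<^sup>2" for i
    by (simp add: r p_def q_def power2_eq_square field_simps)
  have qr: "2 * (q i)\<^sup>2 \<le> (r i)\<^sup>2" for i
    using qp[of i] p0[of i] by (simp add: r2 abs_le_square_iff[symmetric])
  have pr: "p i \<le> r i" for i by (rule power2_le_imp_le) (simp_all add: r2 r0)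
  have kr: "k i * r i = (q i)\<^sup>2" for i
    using qr[of i] by (cases "r i = 0") (simp_all add: k q_def)
  have k0: "0 \<le> k i" for i using r0 by (simp add: k)
  have kler: "k i \<le> r i" for i
  proof (cases "r i = 0")
    case False
    then have "0 < r i" using r0[of i] by simp
    moreover have "k i * r i \<le> r i * r i"
      using qr[of i] zero_le_power2[of "q i"] unfolding kr power2_eq_square[of "r i", symmetric] by linarith
    ultimately show ?thesis by simp
  qed (simp add: k)
  \<comment> \<open>\<open>P P' - Q Q'\<close> is the real part of the product of the \<open>p i + \<i> q i\<close>, which have modulus \<open>r i\<close>.\<close>
  define P Q P' Q' where "P = p 1 * p 2 - q 1 * q 2" and "Q = p 1 * q 2 + q 1 * p 2"
    and "P' = p 3 * p 4 - q 3 * q 4" and "Q' = p 3 * q 4 + q 3 * p 4"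
  have "(P * P' - Q * Q')\<^sup>2 \<le> (P\<^sup>2 + Q\<^sup>2) * (P'\<^sup>2 + Q'\<^sup>2)"
  proof -
    have "(P\<^sup>2 + Q\<^sup>2) * (P'\<^sup>2 + Q'\<^sup>2) - (P * P' - Q * Q')\<^sup>2 = (P * Q' + Q * P')\<^sup>2"
      by (simp add: power2_eq_square algebra_simps)
    then show ?thesis using zero_le_power2[of "P * Q' + Q * P'"] by linarith
  qed
  also have "\<dots> = (r 1 * r 2 * r 3 * r 4)\<^sup>2"
  proof -
    have "P\<^sup>2 + Q\<^sup>2 = (r 1)\<^sup>2 * (r 2)\<^sup>2" "P'\<^sup>2 + Q'\<^sup>2 = (r 3)\<^sup>2 * (r 4)\<^sup>2"
      unfolding P_def Q_def P'_def Q'_def r2 by (simp_all add: power2_eq_square algebra_simps)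
    then show ?thesis by (simp add: power_mult_distrib)
  qed
  finally have cos: "P * P' - Q * Q' \<le> r 1 * r 2 * r 3 * r 4"
    by (rule power2_le_imp_le) (intro mult_nonneg_nonneg r0)
  \<comment> \<open>Cauchy--Schwarz for \<open>(p 1, |q 1| / 2)\<close> and \<open>(p 2, |q 2|)\<close>; the first vector has length
    \<open>sqrt ((r 1)\<^sup>2 - 3 / 4 (q 1)\<^sup>2)\<close>, and \<open>r 1 - 3 / 8 k 1\<close> is its bound to first order.\<close>
  have two: "p 1 * p 2 + \<bar>q 1 * q 2\<bar> / 2 \<le> (r 1 - 3 / 8 * k 1) * r 2"
  proof (rule power2_le_imp_le)
    have "((p 1)\<^sup>2 + (q 1)\<^sup>2 / 4) * ((p 2)\<^sup>2 + (q 2)\<^sup>2) - (p 1 * p 2 + \<bar>q 1\<bar> * \<bar>q 2\<bar> / 2)\<^sup>2 = (p 1 * \<bar>q 2\<bar> - \<bar>q 1\<bar> * p 2 / 2)\<^sup>2"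
      by (simp add: power2_eq_square field_simps)
    then have "(p 1 * p 2 + \<bar>q 1 * q 2\<bar> / 2)\<^sup>2 \<le> ((p 1)\<^sup>2 + (q 1)\<^sup>2 / 4) * (r 2)\<^sup>2"
      unfolding abs_mult r2 using zero_le_power2[of "p 1 * \<bar>q 2\<bar> - \<bar>q 1\<bar> * p 2 / 2"] by linarith
    also have "(p 1)\<^sup>2 + (q 1)\<^sup>2 / 4 \<le> (r 1 - 3 / 8 * k 1)\<^sup>2"
    proof -
      have "(r 1 - 3 / 8 * k 1)\<^sup>2 = (r 1)\<^sup>2 - 3 / 4 * (k 1 * r 1) + (3 / 8 * k 1)\<^sup>2"
        by (simp add: power2_eq_square algebra_simps)
      then show ?thesis unfolding kr r2 using zero_le_power2[of "3 / 8 * k 1"] by linarith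
    qed
    finally show "(p 1 * p 2 + \<bar>q 1 * q 2\<bar> / 2)\<^sup>2 \<le> ((r 1 - 3 / 8 * k 1) * r 2)\<^sup>2"
      by (simp add: power_mult_distrib mult_right_mono)
    show "0 \<le> (r 1 - 3 / 8 * k 1) * r 2"
      using kler[of 1] k0[of 1] r0[of 2] by (intro mult_nonneg_nonneg) auto
  qed
  have q34: "\<bar>q 3 * q 4\<bar> \<le> r 3 * r 4 / 2"
  proof (rule power2_le_imp_le)
    have "(2 * (q 3)\<^sup>2) * (2 * (q 4)\<^sup>2) \<le> (r 3)\<^sup>2 * (r 4)\<^sup>2" by (intro mult_mono qr) auto
    then show "\<bar>q 3 * q 4\<bar>\<^sup>2 \<le> (r 3 * r 4 / 2)\<^sup>2" by (simp add: power_mult_distrib power_divide)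
  qed (use r0 in simp)
  have "p 1 * p 2 * (p 3 * p 4) + q 1 * q 2 * (q 3 * q 4) \<le> p 1 * p 2 * (r 3 * r 4) + \<bar>q 1 * q 2\<bar> * (r 3 * r 4 / 2)"
  proof (rule add_mono)
    show "p 1 * p 2 * (p 3 * p 4) \<le> p 1 * p 2 * (r 3 * r 4)"
      by (intro mult_left_mono mult_mono pr) (auto simp: p0 r0)
    have "q 1 * q 2 * (q 3 * q 4) \<le> \<bar>q 1 * q 2\<bar> * \<bar>q 3 * q 4\<bar>"
      by (metis abs_ge_self abs_mult)
    also have "\<dots> \<le> \<bar>q 1 * q 2\<bar> * (r 3 * r 4 / 2)" by (intro mult_left_mono q34) simp
    finally show "q 1 * q 2 * (q 3 * q 4) \<le> \<bar>q 1 * q 2\<bar> * (r 3 * r 4 / 2)" .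
  qed
  also have "\<dots> = (p 1 * p 2 + \<bar>q 1 * q 2\<bar> / 2) * (r 3 * r 4)" by (simp add: algebra_simps)
  also have "\<dots> \<le> (r 1 - 3 / 8 * k 1) * r 2 * (r 3 * r 4)"
    by (intro mult_right_mono two) (simp add: r0)
  also have "\<dots> = r 1 * r 2 * r 3 * r 4 - 3 / 8 * (k 1 * r 2 * r 3 * r 4)" by (simp add: algebra_simps)
  also have "\<dots> \<le> r 1 * r 2 * r 3 * r 4 - 3 / 8 * (k 1 * k 2 * k 3 * k 4)"
  proof -
    have "k 1 * k 2 * k 3 * k 4 \<le> k 1 * r 2 * r 3 * r 4"
      by (intro mult_mono kler order_refl) (auto simp: k0 r0)
    then show ?thesis by simp
  qed
  finally have sum: "p 1 * p 2 * (p 3 * p 4) + q 1 * q 2 * (q 3 * q 4) \<le> r 1 * r 2 * r 3 * r 4 - 3 / 8 * (k 1 * k 2 * k 3 * k 4)" .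
  have "u 1 * u 2 * v 3 * v 4 + u 1 * v 2 * u 3 * v 4 + v 1 * u 2 * u 3 * v 4
     + u 1 * v 2 * v 3 * u 4 + v 1 * u 2 * v 3 * u 4 + v 1 * v 2 * u 3 * u 4
     = 2 * (P * P' - Q * Q') + 4 * (p 1 * p 2 * (p 3 * p 4) + q 1 * q 2 * (q 3 * q 4))"
    unfolding up vp P_def Q_def P'_def Q'_def by (simp add: algebra_simps)
  moreover have "X + 3 / 2 * K \<le> 6 * R" if "X = 2 * C + 4 * D" "C \<le> R" "D \<le> R - 3 / 8 * K" for X C D R K :: real
    using that by linarith
  ultimately show ?thesis using cos sum by blast
qed

definition antipodal_mean :: "('a::real_vector \<Rightarrow> real) \<Rightarrow> 'a \<Rightarrow> real" where
  "antipodal_mean f x = sqrt (((f x)\<^sup>2 + (f (- x))\<^sup>2) / 2)"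

text \<open>
  With \<open>p\<close> and \<open>q\<close> the even and odd parts of \<open>f\<close>, this is \<open>q\<^sup>2 / sqrt (p\<^sup>2 + q\<^sup>2)\<close>. It is of the same
  degree as \<open>f\<close>, so it can be inserted into the quadrilinear form; where the mean vanishes, so does \<open>q\<close>, and
  division by zero gives the right value \<open>0\<close>.
\<close>

definition antipodal_defect :: "('a::real_vector \<Rightarrow> real) \<Rightarrow> 'a \<Rightarrow> real" where
  "antipodal_defect f x = ((f x - f (- x)) / 2)\<^sup>2 / antipodal_mean f x"

text \<open>
  A form in four functions with a symmetric kernel in \<open>a + b + c + d\<close>. For real \<open>f\<close>, the convolution norm
  leads to \<open>a + b - c - d\<close>; substituting \<open>- c\<close> and \<open>- d\<close> makes the kernel symmetric and reflects two of the
  functions.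
\<close>

definition sphere_form :: "real \<Rightarrow> (real^3 \<Rightarrow> real) \<Rightarrow> (real^3 \<Rightarrow> real) \<Rightarrow> (real^3 \<Rightarrow> real) \<Rightarrow> (real^3 \<Rightarrow> real) \<Rightarrow> ennreal" where
  "sphere_form e f1 f2 f3 f4 =
     integral4 (\<lambda>a b c d. ennreal (f1 a * f2 b * f3 c * f4 d * gauss_kernel e (a + b + c + d))) sphere_measure"

interpretation sphere: finite_measure sphere_measure
  by (rule finite_measureI) (simp add: emeasure_sphere_measure_UNIV)

interpretation sphere_pair: pair_sigma_finite sphere_measure sphere_measure ..

lemma antipodal_mean_minus [simp]: "antipodal_mean f (- x) = antipodal_mean f x"
  and antipodal_defect_minus [simp]: "antipodal_defect f (- x) = antipodal_defect f x"
  by (simp_all add: antipodal_mean_def antipodal_defect_def add.commute power_divide power2_commute)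

lemma antipodal_mean_nonneg: "0 \<le> antipodal_mean f x"
  and antipodal_defect_nonneg: "0 \<le> antipodal_defect f x"
  by (simp_all add: antipodal_mean_def antipodal_defect_def)

lemma antipodal_defect_eq_0_iff: "antipodal_defect f x = 0 \<longleftrightarrow> f (- x) = f x"
proof -
  have "(f x)\<^sup>2 + (f (- x))\<^sup>2 = 0 \<Longrightarrow> f (- x) = f x"
    by (simp add: add_nonneg_eq_0_iff)
  then show ?thesis by (auto simp: antipodal_defect_def antipodal_mean_def)
qed

lemma antipodal_measurable [measurable]:
  fixes f :: "real^3 \<Rightarrow> real"
  assumes [measurable]: "f \<in> borel_measurable borel"
  shows "antipodal_mean f \<in> borel_measurable borel" "antipodal_defect f \<in> borel_measurable borel"
proof -
  show "antipodal_mean f \<in> borel_measurable borel" unfolding antipodal_mean_def[abs_def] by measurable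
  then show "antipodal_defect f \<in> borel_measurable borel" unfolding antipodal_defect_def[abs_def] by measurable
qed

lemma measurable4_sphere_form:
  assumes [measurable]: "f1 \<in> borel_measurable borel" "f2 \<in> borel_measurable borel" "f3 \<in> borel_measurable borel" "f4 \<in> borel_measurable borel"
  shows "measurable4 (\<lambda>a b c d. ennreal (f1 a * f2 b * f3 c * f4 d * gauss_kernel e (a + b + c + d))) sphere_measure"
  unfolding measurable4_def by measurable

lemma sphere_form_swap:
  assumes [measurable]: "f1 \<in> borel_measurable borel" "f2 \<in> borel_measurable borel" "f3 \<in> borel_measurable borel" "f4 \<in> borel_measurable borel"
  shows "sphere_form e f2 f1 f3 f4 = sphere_form e f1 f2 f3 f4"
    and "sphere_form e f1 f3 f2 f4 = sphere_form e f1 f2 f3 f4"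
    and "sphere_form e f1 f2 f4 f3 = sphere_form e f1 f2 f3 f4"
  unfolding sphere_form_def
    sphere.integral4_swap12[OF measurable4_sphere_form[OF assms], symmetric]
  subgoal by (simp only: mult_ac add_ac)
  subgoal unfolding sphere.integral4_swap12[OF measurable4_sphere_form[OF assms]]
    sphere.integral4_swap23[OF measurable4_sphere_form[OF assms], symmetric] by (simp only: mult_ac add_ac)
  subgoal unfolding sphere.integral4_swap12[OF measurable4_sphere_form[OF assms]]
    sphere.integral4_swap34[OF measurable4_sphere_form[OF assms], symmetric] by (simp only: mult_ac add_ac)
  done

text \<open>
  Because the form is symmetric in its arguments, it does not matter which two of the four copies of \<open>f\<close>
  are reflected. Adding the six choices produces the six products of \<open>six_products_le\<close> under the integral.
\<close>

theorem sphere_form_symmetrization: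
  fixes f :: "real^3 \<Rightarrow> real"
  assumes [measurable]: "f \<in> borel_measurable borel" and f: "\<And>x. 0 \<le> f x" and e: "0 < e"
  defines "f' \<equiv> \<lambda>x. f (- x)" and "g \<equiv> antipodal_mean f" and "k \<equiv> antipodal_defect f"
  shows "4 * sphere_form e f f f' f' + sphere_form e k k k k \<le> 4 * sphere_form e g g g g"
proof -
  have [measurable]: "f' \<in> borel_measurable borel" "g \<in> borel_measurable borel" "k \<in> borel_measurable borel"
    unfolding f'_def g_def k_def by measurable
  let ?H = "\<lambda>f1 f2 f3 f4 a b c d :: real^3. ennreal (f1 a * f2 b * f3 c * f4 d * gauss_kernel e (a + b + c + d))"
  let ?S = sphere_measure
  have m: "measurable4 (?H f1 f2 f3 f4) ?S"
    if "f1 \<in> borel_measurable borel" "f2 \<in> borel_measurable borel" "f3 \<in> borel_measurable borel" "f4 \<in> borel_measurable borel" for f1 f2 f3 f4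
    using that by (rule measurable4_sphere_form)
  let ?L = "sphere_form e"
  have E: "?L f f' f f' = ?L f f f' f'" by (rule sphere_form_swap) measurable
  have E3: "?L f' f f f' = ?L f f f' f'" unfolding E[symmetric] by (rule sphere_form_swap) measurable
  have E4: "?L f f' f' f = ?L f f f' f'" unfolding E[symmetric] by (rule sphere_form_swap) measurable
  have E5: "?L f' f f' f = ?L f f f' f'" unfolding E4[symmetric] by (rule sphere_form_swap) measurable
  have E6: "?L f' f' f f = ?L f f f' f'" unfolding E5[symmetric] by (rule sphere_form_swap) measurable
  let ?M1 = "?H f f f' f'" let ?M2 = "?H f f' f f'" let ?M3 = "?H f' f f f'"
  let ?M4 = "?H f f' f' f" let ?M5 = "?H f' f f' f" let ?M6 = "?H f' f' f f"
  let ?T = "\<lambda>a b c d. ?M1 a b c d + (?M2 a b c d + (?M3 a b c d + (?M4 a b c d + (?M5 a b c d + (?M6 a b c d + ennreal (3 / 2) * ?H k k k k a b c d)))))"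
  note ms = m[of f f f' f'] m[of f f' f f'] m[of f' f f f'] m[of f f' f' f] m[of f' f f' f] m[of f' f' f f] m[of k k k k]
  have madd: "measurable4 (\<lambda>a b c d. H a b c d + K a b c d) ?S" if "measurable4 H ?S" "measurable4 K ?S" for H K
    using that unfolding measurable4_def case_prod_beta by measurable
  have mc: "measurable4 (\<lambda>a b c d. r * H a b c d) ?S" if "measurable4 H ?S" for H r
    using that unfolding measurable4_def case_prod_beta by measurable
  have "integral4 ?T ?S = ?L f f f' f' + (?L f f' f f' + (?L f' f f f' + (?L f f' f' f + (?L f' f f' f + (?L f' f' f f + ennreal (3 / 2) * ?L k k k k)))))"
    unfolding sphere_form_def
    by (subst sphere.integral4_add sphere.integral4_cmult, (intro ms madd mc; measurable), (intro ms madd mc; measurable)?)+ (rule refl)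
  also have "\<dots> = 6 * ?L f f f' f' + ennreal (3 / 2) * ?L k k k k"
    unfolding E E3 E4 E5 E6
  proof -
    have "x + (x + (x + (x + (x + (x + y))))) = 6 * x + y" for x y :: ennreal
    proof -
      have "6 * x = (1 + 1 + 1 + 1 + 1 + 1) * x" by simp
      then show ?thesis by (simp only: distrib_right mult_1 add.assoc)
    qed
    then show "?L f f f' f' + (?L f f f' f' + (?L f f f' f' + (?L f f f' f' + (?L f f f' f' + (?L f f f' f' + ennreal (3 / 2) * ?L k k k k)))))
      = 6 * ?L f f f' f' + ennreal (3 / 2) * ?L k k k k" .
  qed
  finally have T: "integral4 ?T ?S = 6 * ?L f f f' f' + ennreal (3 / 2) * ?L k k k k" .
  have "integral4 ?T ?S \<le> integral4 (\<lambda>a b c d. 6 * ?H g g g g a b c d) ?S"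
  proof (rule sphere.integral4_mono_AE[where P = "\<lambda>_. True"])
    fix a b c d :: "real^3"
    define G where "G = gauss_kernel e (a + b + c + d)"
    have G: "0 \<le> G" using e by (simp add: G_def gauss_kernel_nonneg)
    define x where "x i = (if i = 1 then a else if i = 2 then b else if i = 3 then c else d)" for i :: nat
    have x: "x 1 = a" "x 2 = b" "x 3 = c" "x 4 = d" by (simp_all add: x_def)
    have f0: "0 \<le> f x" "0 \<le> f' x" "0 \<le> g x" "0 \<le> k x" for x
      by (simp_all add: f f'_def g_def k_def antipodal_mean_nonneg antipodal_defect_nonneg)
    have "(f a * f b * f' c * f' d + f a * f' b * f c * f' d + f' a * f b * f c * f' d
      + f a * f' b * f' c * f d + f' a * f b * f' c * f d + f' a * f' b * f c * f d + 3 / 2 * (k a * k b * k c * k d)) \<le> 6 * (g a * g b * g c * g d)"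
      using six_products_le[of "\<lambda>i. f (x i)" "\<lambda>i. f' (x i)" "\<lambda>i. g (x i)" "\<lambda>i. k (x i)", unfolded x]
      by (simp add: f f'_def g_def k_def antipodal_mean_def antipodal_defect_def)
    from mult_right_mono[OF this G]
    have "f a * f b * f' c * f' d * G + (f a * f' b * f c * f' d * G + (f' a * f b * f c * f' d * G
      + (f a * f' b * f' c * f d * G + (f' a * f b * f' c * f d * G + (f' a * f' b * f c * f d * G + 3 / 2 * (k a * k b * k c * k d * G)))))) \<le> 6 * (g a * g b * g c * g d * G)"
      by (simp add: algebra_simps)
    note le = ennreal_leI[OF this]
    define t where "t = (3 / 2 :: real)"
    have t: "0 \<le> t" by (simp add: t_def)
    show "?T a b c d \<le> 6 * ?H g g g g a b c d"
      using le unfolding G_def[symmetric] t_def[symmetric]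
      by (simp add: f0 G t ennreal_plus ennreal_mult mult_nonneg_nonneg add_nonneg_nonneg)
  qed simp
  also have "\<dots> = 6 * ?L g g g g"
    unfolding sphere_form_def by (rule sphere.integral4_cmult) (rule m; measurable)
  finally have *: "6 * ?L f f f' f' + ennreal (3 / 2) * ?L k k k k \<le> 6 * ?L g g g g"
    unfolding T .
  have "ennreal (2 / 3) * (6 * ?L f f f' f' + ennreal (3 / 2) * ?L k k k k) \<le> ennreal (2 / 3) * (6 * ?L g g g g)"
    by (intro mult_left_mono *) simp
  moreover have "ennreal (2 / 3) * (6 * X) = 4 * X" for X
  proof -
    have "ennreal (2 / 3) * ennreal 6 = ennreal 4" by (subst ennreal_mult[symmetric]) auto
    then show ?thesis by (simp add: mult.assoc[symmetric])
  qed
  moreover have "ennreal (2 / 3) * (ennreal (3 / 2) * X) = X" for X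
  proof -
    have "ennreal (2 / 3) * ennreal (3 / 2) = ennreal 1" by (subst ennreal_mult[symmetric]) auto
    then show ?thesis by (simp add: mult.assoc[symmetric])
  qed
  ultimately show ?thesis by (simp only: distrib_left)
qed

section \<open>Uniform bound for the quadrilinear form\<close>

lemma gauss_kernel_off_origin_le:
  fixes w :: "real^3"
  assumes w: "1 / 2 \<le> norm w" and e: "0 < e" "e \<le> 1"
  shows "gauss_kernel e w \<le> 512 * sqrt pi ^ 3"
proof -
  let ?x = "1 / (16 * e\<^sup>2)"
  have "(1 / 2)\<^sup>2 \<le> (norm w)\<^sup>2" using w by (intro power_mono) auto
  then have "?x \<le> (norm w)\<^sup>2 / (4 * e\<^sup>2)" using e by (simp add: field_simps power2_eq_square)
  then have "exp (- (norm w)\<^sup>2 / (4 * e\<^sup>2)) \<le> exp (- ?x)" by simp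
  also have "\<dots> \<le> 512 * e ^ 4"
  proof -
    have "0 \<le> ?x" by simp
    with exp_lower_Taylor_quadratic[of ?x] have "?x\<^sup>2 / 2 \<le> exp ?x" by linarith
    then have "exp (- ?x) \<le> 1 / (?x\<^sup>2 / 2)"
      using e by (simp add: exp_minus divide_simps) (simp add: mult.commute)
    also have "\<dots> = 512 * e ^ 4" using e by (simp add: field_simps power2_eq_square power4_eq_xxxx)
    finally show ?thesis .
  qed
  finally have "(sqrt pi / e) ^ 3 * exp (- (norm w)\<^sup>2 / (4 * e\<^sup>2)) \<le> (sqrt pi / e) ^ 3 * (512 * e ^ 4)"
    using e by (intro mult_left_mono) auto
  also have "\<dots> = 512 * sqrt pi ^ 3 * e"
    using e by (simp add: field_simps power3_eq_cube power4_eq_xxxx)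
  also have "\<dots> \<le> 512 * sqrt pi ^ 3 * 1" using e by (intro mult_left_mono) auto
  finally show ?thesis unfolding gauss_kernel_3 by simp
qed

text \<open>
  If the four vectors add up to \<open>w\<close>, then
  \<open>|a + b|\<^sup>2 + |a + c|\<^sup>2 + |a + d|\<^sup>2 = 4 + 2 (a \<bullet> w) \<ge> 3\<close>.
\<close>

lemma unit_vectors_pairwise_sums:
  fixes a b c d :: "'a::real_inner"
  assumes n: "norm a = 1" "norm b = 1" "norm c = 1" "norm d = 1" and w: "norm (a + b + c + d) < 1 / 2"
  shows "1 \<le> norm (a + b) \<or> 1 \<le> norm (a + c) \<or> 1 \<le> norm (a + d)"
proof (rule ccontr)
  assume "\<not> ?thesis"
  then have lt: "norm (a + b) < 1" "norm (a + c) < 1" "norm (a + d) < 1" by auto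
  have sq: "(norm (a + x))\<^sup>2 = 2 + 2 * (a \<bullet> x)" if "norm x = 1" for x
    using that n(1) by (simp add: power2_norm_eq_inner inner_add_left inner_add_right inner_commute norm_eq_1)
  have "(norm (a + b))\<^sup>2 < 1" "(norm (a + c))\<^sup>2 < 1" "(norm (a + d))\<^sup>2 < 1"
    using lt by (simp_all add: power_less_one_iff abs_square_less_1)
  then have "2 * (a \<bullet> b) + 2 * (a \<bullet> c) + 2 * (a \<bullet> d) < - 3"
    using n by (simp add: sq)
  moreover have "a \<bullet> (a + b + c + d) = 1 + a \<bullet> b + a \<bullet> c + a \<bullet> d"
    using n(1) by (simp add: inner_add_right norm_eq_1)
  ultimately have "a \<bullet> (a + b + c + d) < - 1 / 2" by linarith
  moreover have "\<bar>a \<bullet> (a + b + c + d)\<bar> \<le> norm a * norm (a + b + c + d)" by (rule Cauchy_Schwarz_ineq2)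
  ultimately show False using n(1) w by simp
qed

text \<open>
  An elementary form of the endpoint Stein--Tomas estimate on the sphere. The Gaussian is bounded unless
  \<open>a + b + c + d\<close> is small. If it is small, then one of \<open>a + b\<close>, \<open>a + c\<close>, \<open>a + d\<close>, say the first, is not short,
  and neither is \<open>c + d\<close>. Then \<open>m(a) m(b) m(c) m(d)\<close> is at most the sum of the squares of \<open>m(a) m(b)\<close> and of
  \<open>m(c) m(d)\<close>, and in each of the two terms the remaining variables integrate to the mollified convolution
  of the surface measure with itself away from the origin, where it is bounded. The three ways of pairing
  the variables give six integrals that differ by a permutation only.
\<close>

theorem sphere_form_bound:
  fixes m :: "real^3 \<Rightarrow> real"
  assumes [measurable]: "m \<in> borel_measurable borel" and m: "\<And>x. 0 \<le> m x" and e: "0 < e" "e \<le> 1"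
  shows "sphere_form e m m m m \<le> ennreal (512 * sqrt pi ^ 3) * (\<integral>\<^sup>+x. ennreal (m x) \<partial>sphere_measure) ^ 4
      + 6 * (ennreal kernel_bound * (\<integral>\<^sup>+x. ennreal ((m x)\<^sup>2) \<partial>sphere_measure)\<^sup>2)"
proof -
  let ?S = sphere_measure
  define Tr where "Tr a b c d = (if 1 / 2 \<le> norm (a + b) then (m a)\<^sup>2 * (m b)\<^sup>2 * gauss_kernel e (a + b + c + d) else 0)" for a b c d :: "real^3"
  let ?T = "\<lambda>a b c d. ennreal (Tr a b c d)"
  let ?M = "\<lambda>a b c d. ennreal (512 * sqrt pi ^ 3) * ennreal (m a * m b * m c * m d)"
  have Tr0: "0 \<le> Tr a b c d" for a b c d
    using e by (simp add: Tr_def gauss_kernel_nonneg)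
  have mT: "measurable4 ?T ?S" unfolding measurable4_def Tr_def by measurable
  have mM: "measurable4 (\<lambda>a b c d. ennreal (m a * m b * m c * m d)) ?S" unfolding measurable4_def by measurable
  note sw = measurable4_swap
  have I0: "integral4 ?T ?S \<le> ennreal kernel_bound * (\<integral>\<^sup>+x. ennreal ((m x)\<^sup>2) \<partial>?S)\<^sup>2"
  proof -
    have "integral4 ?T ?S \<le> (\<integral>\<^sup>+a. \<integral>\<^sup>+b. ennreal kernel_bound * (ennreal ((m a)\<^sup>2) * ennreal ((m b)\<^sup>2)) \<partial>?S \<partial>?S)"
      unfolding integral4_def
    proof (intro nn_integral_mono)
      fix a b :: "real^3"
      show "(\<integral>\<^sup>+c. \<integral>\<^sup>+d. ?T a b c d \<partial>?S \<partial>?S) \<le> ennreal kernel_bound * (ennreal ((m a)\<^sup>2) * ennreal ((m b)\<^sup>2))"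
      proof (cases "1 / 2 \<le> norm (a + b)")
        case True
        have "(\<integral>\<^sup>+c. \<integral>\<^sup>+d. ?T a b c d \<partial>?S \<partial>?S) =
           (\<integral>\<^sup>+c. \<integral>\<^sup>+d. ennreal ((m a)\<^sup>2) * ennreal ((m b)\<^sup>2) * ennreal (gauss_kernel e (a + b + c + d)) \<partial>?S \<partial>?S)"
          using True e by (simp add: Tr_def ennreal_mult gauss_kernel_nonneg)
        also have "\<dots> = ennreal ((m a)\<^sup>2) * ennreal ((m b)\<^sup>2) * (\<integral>\<^sup>+c. \<integral>\<^sup>+d. ennreal (gauss_kernel e (a + b + c + d)) \<partial>?S \<partial>?S)"
          by (simp add: nn_integral_cmult)
        also have "\<dots> \<le> ennreal ((m a)\<^sup>2) * ennreal ((m b)\<^sup>2) * ennreal kernel_bound"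
          by (intro mult_left_mono nn_integral_sphere_sphere_gauss_kernel_le True e) simp
        finally show ?thesis by (simp only: mult_ac)
      qed (simp add: Tr_def)
    qed
    also have "\<dots> = ennreal kernel_bound * (\<integral>\<^sup>+x. ennreal ((m x)\<^sup>2) \<partial>?S)\<^sup>2"
      by (simp add: nn_integral_cmult nn_integral_multc power2_eq_square)
    finally show ?thesis .
  qed
  let ?T2 = "\<lambda>a b c d. ?T a c b d" let ?T3 = "\<lambda>a b c d. ?T a d b c" let ?T4 = "\<lambda>a b c d. ?T b c a d"
  let ?T5 = "\<lambda>a b c d. ?T b d a c" let ?T6 = "\<lambda>a b c d. ?T c d a b"
  have m2: "measurable4 ?T2 ?S" by (rule sw(2)[OF mT])
  have m3: "measurable4 ?T3 ?S" by (rule sw(3)[OF m2])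
  have m4: "measurable4 ?T4 ?S" by (rule sw(1)[OF m2])
  have m5: "measurable4 ?T5 ?S" by (rule sw(3)[OF m4])
  have m6: "measurable4 ?T6 ?S" by (rule sw(2)[OF m5])
  have I2: "integral4 ?T2 ?S = integral4 ?T ?S" by (rule sphere.integral4_swap23[OF mT])
  have I3: "integral4 ?T3 ?S = integral4 ?T ?S" unfolding I2[symmetric] by (rule sphere.integral4_swap34[OF m2])
  have I4: "integral4 ?T4 ?S = integral4 ?T ?S" unfolding I2[symmetric] by (rule sphere.integral4_swap12[OF m2])
  have I5: "integral4 ?T5 ?S = integral4 ?T ?S" unfolding I4[symmetric] by (rule sphere.integral4_swap34[OF m4])
  have I6: "integral4 ?T6 ?S = integral4 ?T ?S" unfolding I5[symmetric] by (rule sphere.integral4_swap23[OF m5])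
  have madd: "measurable4 (\<lambda>a b c d. H a b c d + K a b c d) ?S" if "measurable4 H ?S" "measurable4 K ?S" for H K
    using that unfolding measurable4_def case_prod_beta by measurable
  have mc: "measurable4 ?M ?S"
    using mM unfolding measurable4_def case_prod_beta by measurable
  have "sphere_form e m m m m \<le> integral4 (\<lambda>a b c d. ?M a b c d + (?T a b c d + (?T2 a b c d + (?T3 a b c d + (?T4 a b c d + (?T5 a b c d + ?T6 a b c d)))))) ?S"
    unfolding sphere_form_def
  proof (rule sphere.integral4_mono_AE[OF AE_sphere_measure])
    fix a b c d :: "real^3"
    assume "a \<in> sphere 0 1" "b \<in> sphere 0 1" "c \<in> sphere 0 1" "d \<in> sphere 0 1"
    then have n: "norm a = 1" "norm b = 1" "norm c = 1" "norm d = 1" by auto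
    let ?G = "gauss_kernel e (a + b + c + d)" and ?p = "m a * m b * m c * m d"
    have G: "0 \<le> ?G" using e by (simp add: gauss_kernel_nonneg)
    have p: "0 \<le> ?p" by (intro mult_nonneg_nonneg m)
    have xy: "x * y \<le> x\<^sup>2 + y\<^sup>2" for x y :: real
      using sum_squares_bound[of x y] zero_le_power2[of x] zero_le_power2[of y] by linarith
    have "?p * ?G \<le> 512 * sqrt pi ^ 3 * ?p + (Tr a b c d + (Tr a c b d + (Tr a d b c + (Tr b c a d + (Tr b d a c + Tr c d a b)))))"
    proof (cases "1 / 2 \<le> norm (a + b + c + d)")
      case True
      have "?p * ?G \<le> ?p * (512 * sqrt pi ^ 3)"
        by (intro mult_left_mono gauss_kernel_off_origin_le[OF True e] p)
      moreover have "0 \<le> Tr a b c d + (Tr a c b d + (Tr a d b c + (Tr b c a d + (Tr b d a c + Tr c d a b))))"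
        by (intro add_nonneg_nonneg Tr0)
      ultimately show ?thesis by (simp add: mult.commute)
    next
      case False
      have pair: "m x * m y * (m z * m w) * ?G \<le> Tr x y z w + Tr z w x y"
        if s: "a + b + c + d = (x + y) + (z + w)" and xy1: "1 \<le> norm (x + y)" for x y z w
      proof -
        have "norm (x + y) - norm (z + w) \<le> norm (a + b + c + d)"
          unfolding s by (rule norm_diff_ineq)
        then have zw: "1 / 2 \<le> norm (z + w)" using False xy1 by linarith
        have s1: "x + y + z + w = a + b + c + d" "z + w + x + y = a + b + c + d"
          unfolding s by (simp_all add: ac_simps)
        have "m x * m y * (m z * m w) * ?G \<le> ((m x * m y)\<^sup>2 + (m z * m w)\<^sup>2) * ?G"
          by (intro mult_right_mono xy G)
        also have "\<dots> = Tr x y z w + Tr z w x y"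
          using xy1 zw unfolding Tr_def s1 by (simp add: power_mult_distrib distrib_right)
        finally show ?thesis .
      qed
      have "0 \<le> 512 * sqrt pi ^ 3 * ?p" using p by simp
      moreover have "?p * ?G \<le> Tr a b c d + Tr c d a b \<or> ?p * ?G \<le> Tr a c b d + Tr b d a c \<or> ?p * ?G \<le> Tr a d b c + Tr b c a d"
        using unit_vectors_pairwise_sums[OF n] False pair[of a b c d] pair[of a c b d] pair[of a d b c]
        by (simp add: ac_simps not_le) blast
      moreover note Tr0[of a b c d] Tr0[of a c b d] Tr0[of a d b c] Tr0[of b c a d] Tr0[of b d a c] Tr0[of c d a b]
      ultimately show ?thesis by linarith
    qed
    from ennreal_leI[OF this]
    show "ennreal (?p * ?G) \<le> ?M a b c d + (?T a b c d + (?T2 a b c d + (?T3 a b c d + (?T4 a b c d + (?T5 a b c d + ?T6 a b c d)))))"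
      by (simp add: Tr0 p ennreal_plus ennreal_mult' )
  qed
  also have "\<dots> = integral4 ?M ?S + (integral4 ?T ?S + (integral4 ?T2 ?S + (integral4 ?T3 ?S + (integral4 ?T4 ?S + (integral4 ?T5 ?S + integral4 ?T6 ?S)))))"
    by (subst sphere.integral4_add, (intro mc mT m2 m3 m4 m5 m6 madd), (intro mc mT m2 m3 m4 m5 m6 madd))+ (rule refl)
  also have "\<dots> = integral4 ?M ?S + 6 * integral4 ?T ?S"
  proof -
    have "6 * x = x + (x + (x + (x + (x + x))))" for x :: ennreal
    proof -
      have "6 * x = (1 + 1 + 1 + 1 + 1 + 1) * x" by simp
      then show ?thesis by (simp only: distrib_right mult_1 add.assoc)
    qed
    then show ?thesis by (simp only: I2 I3 I4 I5 I6)
  qed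
  also have "integral4 ?M ?S = ennreal (512 * sqrt pi ^ 3) * (\<integral>\<^sup>+x. ennreal (m x) \<partial>?S) ^ 4"
    unfolding sphere.integral4_cmult[OF mM]
    by (simp add: integral4_def ennreal_mult m nn_integral_cmult nn_integral_multc power4_eq_xxxx mult_ac)
  finally show ?thesis
    using I0 by (meson add_left_mono mult_left_mono order_trans zero_le)
qed

section \<open>The fourth power of the Fourier transform\<close>

lemma fourier_integral_measurable [measurable]:
  fixes s :: "'p \<Rightarrow> 'a::euclidean_space"
  assumes N: "sigma_finite_measure N" and [measurable]: "F \<in> borel_measurable N" "s \<in> borel_measurable N"
  shows "fourier_integral N s F \<in> borel_measurable borel"
proof -
  interpret sigma_finite_measure N by fact
  show ?thesis unfolding fourier_integral_def[abs_def] by measurable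
qed

lemma sphere_fourier_eq: "sphere_fourier f = fourier_integral sphere_measure (\<lambda>x. x) f"
  by (simp add: fun_eq_iff sphere_fourier_def fourier_integral_def)

lemma sphere_fourier_measurable [measurable]:
  assumes "f \<in> borel_measurable borel"
  shows "sphere_fourier f \<in> borel_measurable borel"
  unfolding sphere_fourier_eq
  by (rule fourier_integral_measurable) (use assms in \<open>auto simp: sphere.sigma_finite_measure_axioms\<close>)

lemma square_integrable_sphere_imp_integrable:
  fixes f :: "real^3 \<Rightarrow> 'b::{banach, second_countable_topology}"
  assumes "square_integrable sphere_measure f"
  shows "integrable sphere_measure f"
proof -
  have [measurable]: "f \<in> borel_measurable sphere_measure" using assms by (simp add: square_integrable_def)
  have "integrable sphere_measure (\<lambda>x. norm (f x))"
    by (rule sphere.square_integrable_imp_integrable) (use assms in \<open>auto simp: square_integrable_def\<close>)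
  then show ?thesis by (simp add: integrable_norm_iff)
qed

lemma square_integrable_sphere_measurable:
  "square_integrable sphere_measure f \<Longrightarrow> f \<in> borel_measurable borel"
  by (simp add: square_integrable_def cong: measurable_cong_sets)

definition fourier_L4 :: "(real^3 \<Rightarrow> complex) \<Rightarrow> ennreal" where
  "fourier_L4 f = (\<integral>\<^sup>+\<xi>. ennreal (norm (sphere_fourier f \<xi>)) ^ 4 \<partial>lborel)"

definition gauss_fourier_L4 :: "real \<Rightarrow> (real^3 \<Rightarrow> complex) \<Rightarrow> ennreal" where
  "gauss_fourier_L4 e f = (\<integral>\<^sup>+\<xi>. ennreal (norm (sphere_fourier f \<xi>) ^ 4 * exp (- e\<^sup>2 * (norm \<xi>)\<^sup>2)) \<partial>lborel)"

definition eps :: "nat \<Rightarrow> real" where "eps n = 1 / real (Suc n)"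

lemma eps: "0 < eps n" "eps n \<le> 1" "eps \<longlonglongrightarrow> 0"
proof -
  show "0 < eps n" "eps n \<le> 1" by (auto simp: eps_def)
  show "eps \<longlonglongrightarrow> 0" unfolding eps_def[abs_def] using LIMSEQ_inverse_real_of_nat by (simp only: inverse_eq_divide)
qed

lemma gauss_fourier_L4_le: "gauss_fourier_L4 e f \<le> fourier_L4 f"
  unfolding gauss_fourier_L4_def fourier_L4_def ennreal_power[OF norm_ge_zero]
  by (intro nn_integral_mono ennreal_leI) (simp add: mult_left_le)

text \<open>
  Monotonicity in \<open>e\<close> is evident on the Fourier side only; there it replaces any discussion of whether the
  Gaussian energies converge.
\<close>

lemma incseq_gauss_fourier_L4: "incseq (\<lambda>n. gauss_fourier_L4 (eps n) f)"
proof (rule incseq_SucI)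
  fix n
  have "(eps (Suc n))\<^sup>2 \<le> (eps n)\<^sup>2" by (intro power_mono) (auto simp: eps_def frac_le)
  then have "(eps (Suc n))\<^sup>2 * (norm \<xi>)\<^sup>2 \<le> (eps n)\<^sup>2 * (norm \<xi>)\<^sup>2" for \<xi> :: "real^3"
    by (intro mult_right_mono) auto
  then show "gauss_fourier_L4 (eps n) f \<le> gauss_fourier_L4 (eps (Suc n)) f"
    unfolding gauss_fourier_L4_def
    by (intro nn_integral_mono ennreal_leI mult_left_mono) auto
qed

lemma fourier_L4_eq_SUP:
  assumes [measurable]: "f \<in> borel_measurable borel"
  shows "fourier_L4 f = (SUP n. gauss_fourier_L4 (eps n) f)"
proof (rule antisym)
  have "fourier_L4 f = (\<integral>\<^sup>+\<xi>. liminf (\<lambda>n. ennreal (norm (sphere_fourier f \<xi>) ^ 4 * exp (- (eps n)\<^sup>2 * (norm \<xi>)\<^sup>2))) \<partial>lborel)"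
    unfolding fourier_L4_def ennreal_power[OF norm_ge_zero]
  proof (intro nn_integral_cong)
    fix \<xi> :: "real^3"
    have "(\<lambda>n. norm (sphere_fourier f \<xi>) ^ 4 * exp (- (eps n)\<^sup>2 * (norm \<xi>)\<^sup>2)) \<longlonglongrightarrow> norm (sphere_fourier f \<xi>) ^ 4 * exp (- 0\<^sup>2 * (norm \<xi>)\<^sup>2)"
      by (intro tendsto_intros eps)
    then have "(\<lambda>n. ennreal (norm (sphere_fourier f \<xi>) ^ 4 * exp (- (eps n)\<^sup>2 * (norm \<xi>)\<^sup>2))) \<longlonglongrightarrow> ennreal (norm (sphere_fourier f \<xi>) ^ 4)"
      by (intro tendsto_ennrealI) simp
    from lim_imp_Liminf[OF _ this]
    show "ennreal (norm (sphere_fourier f \<xi>) ^ 4) = liminf (\<lambda>n. ennreal (norm (sphere_fourier f \<xi>) ^ 4 * exp (- (eps n)\<^sup>2 * (norm \<xi>)\<^sup>2)))"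
      by (simp only: sequentially_bot not_False_eq_True)
  qed
  also have "\<dots> \<le> liminf (\<lambda>n. gauss_fourier_L4 (eps n) f)"
    unfolding gauss_fourier_L4_def by (rule nn_integral_liminf) measurable
  also have "\<dots> \<le> (SUP n. gauss_fourier_L4 (eps n) f)"
    by (rule Liminf_le) (auto intro!: always_eventually SUP_upper)
  finally show "fourier_L4 f \<le> (SUP n. gauss_fourier_L4 (eps n) f)" .
qed (intro SUP_least gauss_fourier_L4_le)

lemma gauss_energy_sphere_pair_iterated:
  assumes [measurable]: "r \<in> borel_measurable borel"
  shows "gauss_energy e (sphere_measure \<Otimes>\<^sub>M sphere_measure) (\<lambda>z. fst z + snd z) (\<lambda>z. r (fst z) * r (snd z))
    = (\<integral>\<^sup>+a. \<integral>\<^sup>+b. \<integral>\<^sup>+c. \<integral>\<^sup>+d. ennreal (r a * r b * (r c * r d) * gauss_kernel e (a + b - (c + d)))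
        \<partial>sphere_measure \<partial>sphere_measure \<partial>sphere_measure \<partial>sphere_measure)"
proof -
  let ?S = sphere_measure
  have "gauss_energy e (?S \<Otimes>\<^sub>M ?S) (\<lambda>z. fst z + snd z) (\<lambda>z. r (fst z) * r (snd z))
    = (\<integral>\<^sup>+p. \<integral>\<^sup>+q. ennreal (r (fst p) * r (snd p) * (r (fst q) * r (snd q)) * gauss_kernel e (fst p + snd p - (fst q + snd q))) \<partial>(?S \<Otimes>\<^sub>M ?S) \<partial>(?S \<Otimes>\<^sub>M ?S))"
    unfolding gauss_energy_def
    by (subst sphere_pair.nn_integral_fst[symmetric]) simp_all
  also have "\<dots> = (\<integral>\<^sup>+a. \<integral>\<^sup>+b. \<integral>\<^sup>+q. ennreal (r a * r b * (r (fst q) * r (snd q)) * gauss_kernel e (a + b - (fst q + snd q))) \<partial>(?S \<Otimes>\<^sub>M ?S) \<partial>?S \<partial>?S)"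
    by (subst sphere.nn_integral_fst[symmetric]) simp_all
  also have "\<dots> = (\<integral>\<^sup>+a. \<integral>\<^sup>+b. \<integral>\<^sup>+c. \<integral>\<^sup>+d. ennreal (r a * r b * (r c * r d) * gauss_kernel e (a + b - (c + d))) \<partial>?S \<partial>?S \<partial>?S \<partial>?S)"
    by (subst sphere.nn_integral_fst[symmetric]) simp_all
  finally show ?thesis .
qed

lemma gauss_energy_sphere_pair:
  assumes [measurable]: "r \<in> borel_measurable borel"
  shows "gauss_energy e (sphere_measure \<Otimes>\<^sub>M sphere_measure) (\<lambda>z. fst z + snd z) (\<lambda>z. r (fst z) * r (snd z))
    = sphere_form e r r (\<lambda>x. r (- x)) (\<lambda>x. r (- x))"
proof -
  let ?S = sphere_measure
  have "gauss_energy e (?S \<Otimes>\<^sub>M ?S) (\<lambda>z. fst z + snd z) (\<lambda>z. r (fst z) * r (snd z))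
    = (\<integral>\<^sup>+a. \<integral>\<^sup>+b. \<integral>\<^sup>+c. \<integral>\<^sup>+d. ennreal (r a * r b * (r c * r d) * gauss_kernel e (a + b - (c + d))) \<partial>?S \<partial>?S \<partial>?S \<partial>?S)"
    by (rule gauss_energy_sphere_pair_iterated[OF assms])
  also have "\<dots> = (\<integral>\<^sup>+a. \<integral>\<^sup>+b. \<integral>\<^sup>+c. \<integral>\<^sup>+d. ennreal (r a * r b * r (- c) * r (- d) * gauss_kernel e (a + b + c + d)) \<partial>?S \<partial>?S \<partial>?S \<partial>?S)"
  proof (rule nn_integral_cong, rule nn_integral_cong)
    fix a b :: "real^3"
    have "(\<integral>\<^sup>+c. \<integral>\<^sup>+d. ennreal (r a * r b * (r c * r d) * gauss_kernel e (a + b - (c + d))) \<partial>?S \<partial>?S)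
      = (\<integral>\<^sup>+c. \<integral>\<^sup>+d. ennreal (r a * r b * (r (- c) * r d) * gauss_kernel e (a + b - (- c + d))) \<partial>?S \<partial>?S)"
      by (rule nn_integral_sphere_uminus[symmetric]) measurable
    also have "\<dots> = (\<integral>\<^sup>+c. \<integral>\<^sup>+d. ennreal (r a * r b * (r (- c) * r (- d)) * gauss_kernel e (a + b - (- c + - d))) \<partial>?S \<partial>?S)"
      by (rule nn_integral_cong, rule nn_integral_sphere_uminus[symmetric]) measurable
    also have "\<dots> = (\<integral>\<^sup>+c. \<integral>\<^sup>+d. ennreal (r a * r b * r (- c) * r (- d) * gauss_kernel e (a + b + c + d)) \<partial>?S \<partial>?S)"
      by (simp add: algebra_simps)
    finally show "(\<integral>\<^sup>+c. \<integral>\<^sup>+d. ennreal (r a * r b * (r c * r d) * gauss_kernel e (a + b - (c + d))) \<partial>?S \<partial>?S)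
      = (\<integral>\<^sup>+c. \<integral>\<^sup>+d. ennreal (r a * r b * r (- c) * r (- d) * gauss_kernel e (a + b + c + d)) \<partial>?S \<partial>?S)" .
  qed
  finally show ?thesis unfolding sphere_form_def integral4_def .
qed

text \<open>
  The square of the transform of \<open>f\<close> is the transform of the product measure under the sum map, so the weighted
  Plancherel identity applies to it.
\<close>

lemma gauss_fourier_L4_sphere_form:
  fixes f :: "real^3 \<Rightarrow> complex"
  assumes f: "integrable sphere_measure f" and e: "0 < e"
  defines "r \<equiv> \<lambda>x. norm (f x)"
  shows "gauss_fourier_L4 e f \<le> sphere_form e r r (\<lambda>x. r (- x)) (\<lambda>x. r (- x))"
    and "(\<And>x. f x = complex_of_real (r x)) \<Longrightarrow> gauss_fourier_L4 e f = sphere_form e r r (\<lambda>x. r (- x)) (\<lambda>x. r (- x))"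
proof -
  let ?N = "sphere_measure \<Otimes>\<^sub>M sphere_measure" and ?s = "\<lambda>z :: (real^3) \<times> (real^3). fst z + snd z"
  let ?F = "\<lambda>z. f (fst z) * f (snd z)"
  have fm [measurable]: "f \<in> borel_measurable borel" using f by (auto dest: borel_measurable_integrable cong: measurable_cong_sets)
  have rm: "r \<in> borel_measurable borel" unfolding r_def by measurable
  have F: "integrable ?N ?F" by (rule sphere_pair.integrable_product_mult[OF f f])
  have N: "sigma_finite_measure ?N" by (rule sphere_pair.sigma_finite_measure_axioms)
  have s: "?s \<in> borel_measurable ?N" by measurable
  have sq: "fourier_integral ?N ?s ?F \<xi> = (sphere_fourier f \<xi>)\<^sup>2" for \<xi>
  proof -
    let ?f = "\<lambda>p. exp (- \<i> * complex_of_real (p \<bullet> \<xi>)) * f p"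
    have i: "integrable sphere_measure ?f"
      using integrable_unimodular_mult[OF f, of "\<lambda>x. x" \<xi>] by simp
    have "exp (- \<i> * complex_of_real ((fst z + snd z) \<bullet> \<xi>)) * (f (fst z) * f (snd z)) = ?f (fst z) * ?f (snd z)" for z
    proof -
      have "exp (- \<i> * complex_of_real ((fst z + snd z) \<bullet> \<xi>))
        = exp (- \<i> * complex_of_real (fst z \<bullet> \<xi>)) * exp (- \<i> * complex_of_real (snd z \<bullet> \<xi>))"
        by (simp add: mult_exp_exp inner_add_left algebra_simps)
      then show ?thesis by (simp only: mult_ac)
    qed
    then have "fourier_integral ?N ?s ?F \<xi> = (LINT z|?N. ?f (fst z) * ?f (snd z))"
      by (simp only: fourier_integral_def)
    also have "\<dots> = (sphere_fourier f \<xi>)\<^sup>2"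
      unfolding sphere_fourier_def power2_eq_square by (rule sphere_pair.integral_product_mult[OF i i])
    finally show ?thesis .
  qed
  have E: "gauss_energy e ?N ?s (\<lambda>p. norm (?F p)) = sphere_form e r r (\<lambda>x. r (- x)) (\<lambda>x. r (- x))"
    using gauss_energy_sphere_pair[OF rm, of e] by (simp add: norm_mult r_def)
  have L: "gauss_fourier_L4 e f = (\<integral>\<^sup>+\<xi>. ennreal ((norm (fourier_integral ?N ?s ?F \<xi>))\<^sup>2 * exp (- e\<^sup>2 * (norm \<xi>)\<^sup>2)) \<partial>lborel)"
    unfolding gauss_fourier_L4_def sq by (simp add: norm_power power_mult[symmetric])
  show "gauss_fourier_L4 e f \<le> sphere_form e r r (\<lambda>x. r (- x)) (\<lambda>x. r (- x))"
    unfolding L E[symmetric] by (rule nn_integral_fourier_le_gauss_energy(1)[OF N F s e])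
  assume fr: "\<And>x. f x = complex_of_real (r x)"
  have "?F p = complex_of_real (norm (?F p))" for p
  proof -
    have "f x = complex_of_real (norm (f x))" for x using fr[of x] unfolding r_def .
    then have "?F p = complex_of_real (norm (f (fst p))) * complex_of_real (norm (f (snd p)))" by metis
    then show ?thesis by (simp only: norm_mult of_real_mult norm_of_real abs_norm_cancel)
  qed
  then show "gauss_fourier_L4 e f = sphere_form e r r (\<lambda>x. r (- x)) (\<lambda>x. r (- x))"
    unfolding L E[symmetric] by (rule nn_integral_fourier_le_gauss_energy(2)[OF N F s e])
qed

section \<open>Symmetrization for convolutions and extremizers\<close>

abbreviation cpx :: "(real^3 \<Rightarrow> real) \<Rightarrow> real^3 \<Rightarrow> complex" where
  "cpx r \<equiv> \<lambda>x. complex_of_real (r x)"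

lemma gauss_fourier_L4_nonneg:
  fixes r :: "real^3 \<Rightarrow> real"
  assumes r: "\<And>x. 0 \<le> r x" and int: "integrable sphere_measure r" and e: "0 < e"
  shows "gauss_fourier_L4 e (cpx r) = sphere_form e r r (\<lambda>x. r (- x)) (\<lambda>x. r (- x))"
proof -
  have "integrable sphere_measure (cpx r)" using int by (simp only: complex_of_real_integrable_eq)
  from gauss_fourier_L4_sphere_form(2)[OF this e] r show ?thesis by simp
qed

lemma fourier_L4_le_norm:
  assumes f: "square_integrable sphere_measure f"
  shows "fourier_L4 f \<le> fourier_L4 (cpx (\<lambda>x. norm (f x)))"
proof -
  have i: "integrable sphere_measure f" using f by (rule square_integrable_sphere_imp_integrable)
  have [measurable]: "f \<in> borel_measurable borel" using f by (rule square_integrable_sphere_measurable)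
  have "gauss_fourier_L4 (eps n) f \<le> gauss_fourier_L4 (eps n) (cpx (\<lambda>x. norm (f x)))" for n
    using gauss_fourier_L4_sphere_form(1)[OF i eps(1)]
    by (subst gauss_fourier_L4_nonneg) (use i in \<open>auto simp: eps(1)\<close>)
  moreover have "cpx (\<lambda>x. norm (f x)) \<in> borel_measurable borel" by measurable
  ultimately show ?thesis
    by (subst (1 2) fourier_L4_eq_SUP) (auto intro!: SUP_mono)
qed

lemma fourier_L4_finite_even:
  fixes g :: "real^3 \<Rightarrow> real"
  assumes g: "\<And>x. 0 \<le> g x" and even: "\<And>x. g (- x) = g x" and sq: "square_integrable sphere_measure g"
  shows "fourier_L4 (cpx g) < \<top>"
proof -
  have [measurable]: "g \<in> borel_measurable borel" using sq by (rule square_integrable_sphere_measurable)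
  have i: "integrable sphere_measure g" using sq by (rule square_integrable_sphere_imp_integrable)
  let ?B = "ennreal (512 * sqrt pi ^ 3) * (\<integral>\<^sup>+x. ennreal (g x) \<partial>sphere_measure) ^ 4
      + 6 * (ennreal kernel_bound * (\<integral>\<^sup>+x. ennreal ((g x)\<^sup>2) \<partial>sphere_measure)\<^sup>2)"
  have "gauss_fourier_L4 (eps n) (cpx g) \<le> ?B" for n
    unfolding gauss_fourier_L4_nonneg[OF g i eps(1)] even
    by (intro sphere_form_bound g eps) measurable
  then have "fourier_L4 (cpx g) \<le> ?B"
    by (subst fourier_L4_eq_SUP) (auto intro: SUP_least)
  also have "?B < \<top>"
  proof -
    have "(\<integral>\<^sup>+x. ennreal (g x) \<partial>sphere_measure) < \<top>"
      using i g by (subst nn_integral_eq_integral) auto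
    moreover have "(\<integral>\<^sup>+x. ennreal ((g x)\<^sup>2) \<partial>sphere_measure) < \<top>"
      using sq by (subst nn_integral_eq_integral) (auto simp: square_integrable_def)
    ultimately show ?thesis
      by (simp add: ennreal_mult_less_top power_less_top_ennreal)
  qed
  finally show ?thesis .
qed

text \<open>
  Four unit vectors add up to a vector of length at most \<open>4\<close>, where the Gaussian with \<open>e = 1\<close> is bounded below.
  So the form bounds a multiple of \<open>(\<integral> k)\<^sup>4\<close>.
\<close>

lemma AE_zero_if_fourier_L4_zero:
  fixes k :: "real^3 \<Rightarrow> real"
  assumes k: "\<And>x. 0 \<le> k x" and i: "integrable sphere_measure k" and z: "fourier_L4 (cpx k) = 0"
  shows "AE x in sphere_measure. k x = 0"
proof -
  let ?S = sphere_measure and ?k' = "\<lambda>x. k (- x)"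
  have [measurable]: "k \<in> borel_measurable borel"
    using i by (auto dest: borel_measurable_integrable cong: measurable_cong_sets)
  let ?c = "sqrt pi ^ 3 * exp (- 4)"
  have c: "?c \<le> gauss_kernel 1 (a + b + c + d)" if "norm a = 1" "norm b = 1" "norm c = 1" "norm d = 1" for a b c d :: "real^3"
  proof -
    have "norm (a + b + c + d) \<le> 4"
      using norm_triangle_ineq[of "a + b + c" d] norm_triangle_ineq[of "a + b" c] norm_triangle_ineq[of a b] that by linarith
    then have "(norm (a + b + c + d))\<^sup>2 \<le> 4\<^sup>2" by (intro power_mono) auto
    then have "exp (- 4) \<le> exp (- (norm (a + b + c + d))\<^sup>2 / (4 * 1\<^sup>2) :: real)" by simp
    then have "?c \<le> sqrt pi ^ 3 * exp (- (norm (a + b + c + d))\<^sup>2 / (4 * 1\<^sup>2))"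
      by (intro mult_left_mono) auto
    then show ?thesis unfolding gauss_kernel_3 by simp
  qed
  let ?I = "\<integral>\<^sup>+x. ennreal (k x) \<partial>?S"
  have I': "(\<integral>\<^sup>+x. ennreal (k (- x)) \<partial>?S) = ?I"
    by (rule nn_integral_sphere_uminus) measurable
  have "ennreal ?c * ?I ^ 4 = integral4 (\<lambda>a b c d. ennreal (k a) * (ennreal (k b) * (ennreal (k (- c)) * (ennreal (k (- d)) * ennreal ?c)))) ?S"
    unfolding integral4_def
    by (simp add: nn_integral_cmult nn_integral_multc I' power4_eq_xxxx mult_ac)
  also have "\<dots> \<le> sphere_form 1 k k ?k' ?k'"
    unfolding sphere_form_def
  proof (rule sphere.integral4_mono_AE[OF AE_sphere_measure])
    fix a b c d :: "real^3"
    assume "a \<in> sphere 0 1" "b \<in> sphere 0 1" "c \<in> sphere 0 1" "d \<in> sphere 0 1"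
    then have "k a * k b * k (- c) * k (- d) * ?c \<le> k a * k b * k (- c) * k (- d) * gauss_kernel 1 (a + b + c + d)"
      by (intro mult_left_mono c mult_nonneg_nonneg k) auto
    from ennreal_leI[OF this]
    show "ennreal (k a) * (ennreal (k b) * (ennreal (k (- c)) * (ennreal (k (- d)) * ennreal ?c)))
       \<le> ennreal (k a * k b * ?k' c * ?k' d * gauss_kernel 1 (a + b + c + d))"
      using k by (simp add: ennreal_mult' mult.assoc)
  qed
  also have "\<dots> = gauss_fourier_L4 1 (cpx k)"
    by (rule gauss_fourier_L4_nonneg[OF k i, symmetric]) simp
  also have "\<dots> \<le> 0" using gauss_fourier_L4_le[of 1 "cpx k"] z by simp
  finally have "?I = 0" by simp
  then have "AE x in ?S. ennreal (k x) = 0" by (subst (asm) nn_integral_0_iff_AE) auto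
  then show ?thesis by eventually_elim (use k in \<open>simp add: ennreal_eq_0_iff antisym\<close>)
qed

lemma square_integrable_antipodal_mean:
  assumes "square_integrable sphere_measure r"
  shows "square_integrable sphere_measure (antipodal_mean r)"
  using antipodal_rearrangement_exists[OF assms]
  unfolding antipodal_rearrangement_def antipodal_mean_def[abs_def] by blast

lemma antipodal_defect_le_mean: "antipodal_defect f x \<le> antipodal_mean f x"
proof -
  let ?m = "antipodal_mean f x"
  have "((f x - f (- x)) / 2)\<^sup>2 \<le> ((f x)\<^sup>2 + (f (- x))\<^sup>2) / 2"
    using add_power2_le[of "f x" "- f (- x)"] by (simp add: power_divide)
  also have "\<dots> = ?m * ?m" by (simp add: antipodal_mean_def)
  finally have "((f x - f (- x)) / 2)\<^sup>2 \<le> ?m * ?m" .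
  then show ?thesis using antipodal_mean_nonneg[of f x]
    by (cases "?m = 0") (simp_all add: antipodal_defect_def divide_le_eq)
qed

text \<open>
  The inequality for the forms passes to the limit together with its surplus, the norm of the transform of
  the defect. That surplus vanishes only if the defect does, and it is not lost by cancellation because the
  right-hand side is finite.
\<close>

theorem fourier_L4_symmetrization:
  fixes r :: "real^3 \<Rightarrow> real"
  assumes r: "\<And>x. 0 \<le> r x" and sq: "square_integrable sphere_measure r"
  shows "fourier_L4 (cpx (antipodal_mean r)) < \<top>"
    and "fourier_L4 (cpx r) \<le> fourier_L4 (cpx (antipodal_mean r))"
    and "\<not> (AE x in sphere_measure. r (- x) = r x) \<Longrightarrow> fourier_L4 (cpx r) < fourier_L4 (cpx (antipodal_mean r))"
proof -
  let ?g = "antipodal_mean r" and ?k = "antipodal_defect r"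
  have [measurable]: "r \<in> borel_measurable borel" using sq by (rule square_integrable_sphere_measurable)
  have sqg: "square_integrable sphere_measure ?g" using sq by (rule square_integrable_antipodal_mean)
  have ir: "integrable sphere_measure r" and ig: "integrable sphere_measure ?g"
    using sq sqg by (auto intro: square_integrable_sphere_imp_integrable)
  have ik: "integrable sphere_measure ?k"
    by (rule Bochner_Integration.integrable_bound[OF ig])
       (auto simp: antipodal_defect_nonneg antipodal_mean_nonneg antipodal_defect_le_mean)
  have "4 * gauss_fourier_L4 (eps n) (cpx r) + gauss_fourier_L4 (eps n) (cpx ?k) \<le> 4 * gauss_fourier_L4 (eps n) (cpx ?g)" for n
    using sphere_form_symmetrization[of r "eps n"] r eps(1)
    by (simp add: gauss_fourier_L4_nonneg ir ig ik antipodal_mean_nonneg antipodal_defect_nonneg)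
  also have "4 * gauss_fourier_L4 (eps n) (cpx ?g) \<le> 4 * fourier_L4 (cpx ?g)" for n
    by (intro mult_left_mono gauss_fourier_L4_le) simp
  finally have "(SUP n. 4 * gauss_fourier_L4 (eps n) (cpx r) + gauss_fourier_L4 (eps n) (cpx ?k)) \<le> 4 * fourier_L4 (cpx ?g)"
    by (intro SUP_least)
  also have "(SUP n. 4 * gauss_fourier_L4 (eps n) (cpx r) + gauss_fourier_L4 (eps n) (cpx ?k))
     = 4 * fourier_L4 (cpx r) + fourier_L4 (cpx ?k)"
  proof -
    have "incseq (\<lambda>n. 4 * gauss_fourier_L4 (eps n) (cpx r))"
      using incseq_gauss_fourier_L4[of "cpx r"] by (auto simp: incseq_def intro!: mult_left_mono)
    then have "(SUP n. 4 * gauss_fourier_L4 (eps n) (cpx r) + gauss_fourier_L4 (eps n) (cpx ?k))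
      = (SUP n. 4 * gauss_fourier_L4 (eps n) (cpx r)) + (SUP n. gauss_fourier_L4 (eps n) (cpx ?k))"
      by (rule ennreal_SUP_add[OF _ incseq_gauss_fourier_L4])
    also have "(SUP n. 4 * gauss_fourier_L4 (eps n) (cpx r)) = 4 * (SUP n. gauss_fourier_L4 (eps n) (cpx r))"
      by (rule SUP_mult_left_ennreal[symmetric])
    finally show ?thesis by (subst (1 2) fourier_L4_eq_SUP) simp_all
  qed
  finally have main: "4 * fourier_L4 (cpx r) + fourier_L4 (cpx ?k) \<le> 4 * fourier_L4 (cpx ?g)" .
  show fin: "fourier_L4 (cpx ?g) < \<top>"
    by (rule fourier_L4_finite_even) (simp_all add: antipodal_mean_nonneg sqg)
  then obtain G where G: "fourier_L4 (cpx ?g) = ennreal G" "0 \<le> G" by (cases "fourier_L4 (cpx ?g)") auto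
  have four: "4 * ennreal t = ennreal (4 * t)" if "0 \<le> t" for t using that by (simp add: ennreal_mult')
  have lt: "4 * fourier_L4 (cpx r) + fourier_L4 (cpx ?k) < \<top>"
  proof (rule le_less_trans[OF main])
    show "4 * fourier_L4 (cpx ?g) < \<top>" using fin by (simp add: ennreal_mult_less_top)
  qed
  obtain R where R: "fourier_L4 (cpx r) = ennreal R" "0 \<le> R"
    using lt by (cases "fourier_L4 (cpx r)") (auto simp: ennreal_mult_top)
  obtain K where K: "fourier_L4 (cpx ?k) = ennreal K" "0 \<le> K"
    using lt by (cases "fourier_L4 (cpx ?k)") auto
  have RKG: "4 * R + K \<le> 4 * G"
    using main R K G by (simp add: four ennreal_plus[symmetric] del: ennreal_plus)
  then show "fourier_L4 (cpx r) \<le> fourier_L4 (cpx ?g)" using R G K by (auto intro: ennreal_leI)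
  assume nAE: "\<not> (AE x in sphere_measure. r (- x) = r x)"
  have "K \<noteq> 0"
  proof
    assume "K = 0"
    then have "AE x in sphere_measure. ?k x = 0"
      using K by (intro AE_zero_if_fourier_L4_zero ik) (simp_all add: antipodal_defect_nonneg)
    with nAE show False by (simp add: antipodal_defect_eq_0_iff)
  qed
  then have "R < G" using RKG K by simp
  then show "fourier_L4 (cpx r) < fourier_L4 (cpx ?g)" using R G by (simp add: ennreal_lessI)
qed

text \<open>
  Plancherel's theorem for the convolution: its Gaussian energies are those of the Fourier transform, they
  are bounded, hence there is a density in \<open>L\<^sup>2\<close>, and the square of its norm is the limit of the energies.
\<close>

lemma measure_L2_norm_sphere_convolution:
  fixes r :: "real^3 \<Rightarrow> real"
  assumes r: "\<And>x. 0 \<le> r x" and sq: "square_integrable sphere_measure r" and fin: "fourier_L4 (cpx r) < \<top>"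
  shows "measure_L2_norm (sphere_convolution r r) = ennroot 2 (ennreal (1 / (2 * pi) ^ 3) * fourier_L4 (cpx r))"
proof -
  let ?S = sphere_measure
  have [measurable]: "r \<in> borel_measurable borel" using sq by (rule square_integrable_sphere_measurable)
  have ir: "integrable ?S r" using sq by (rule square_integrable_sphere_imp_integrable)
  define \<nu> where "\<nu> = density ?S (\<lambda>x. ennreal (r x))"
  have [measurable_cong, simp]: "sets \<nu> = sets borel" by (simp add: \<nu>_def)
  have "emeasure \<nu> (space \<nu>) = (\<integral>\<^sup>+x. ennreal (r x) \<partial>?S)"
    unfolding \<nu>_def by (simp add: emeasure_density)
  also have "\<dots> < \<top>" using ir r by (subst nn_integral_eq_integral) auto
  finally interpret \<nu>: finite_measure \<nu> by (intro finite_measureI) auto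
  interpret \<nu>\<nu>: pair_sigma_finite \<nu> \<nu> ..
  define \<mu> where "\<mu> = convolution \<nu> \<nu>"
  have \<mu>: "sphere_convolution r r = \<mu>" by (simp add: sphere_convolution_def \<mu>_def \<nu>_def)
  have fm: "finite_measure \<mu>"
    unfolding \<mu>_def by (rule convolution_finite) (auto intro: \<nu>.finite_measure_axioms)
  interpret finite_borel_measure \<mu>
    using fm by (intro finite_borel_measure.intro finite_borel_measure_axioms.intro) (auto simp: \<mu>_def)
  have conv: "(\<integral>\<^sup>+x. F x \<partial>\<mu>) = (\<integral>\<^sup>+a. \<integral>\<^sup>+b. ennreal (r a) * (ennreal (r b) * F (a + b)) \<partial>?S \<partial>?S)"
    if [measurable]: "F \<in> borel_measurable borel" for F
  proof -
    have "(\<integral>\<^sup>+x. F x \<partial>\<mu>) = (\<integral>\<^sup>+a. \<integral>\<^sup>+b. F (a + b) \<partial>\<nu> \<partial>\<nu>)"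
      unfolding \<mu>_def by (rule nn_integral_convolution) (auto intro: \<nu>.finite_measure_axioms)
    also have "\<dots> = (\<integral>\<^sup>+a. \<integral>\<^sup>+b. ennreal (r a) * (ennreal (r b) * F (a + b)) \<partial>?S \<partial>?S)"
      unfolding \<nu>_def by (simp add: nn_integral_density nn_integral_cmult)
    finally show ?thesis .
  qed
  have energy: "gauss_energy e \<mu> (\<lambda>x. x) (\<lambda>_. 1) = gauss_fourier_L4 e (cpx r)" if e: "0 < e" for e
  proof -
    have "gauss_energy e \<mu> (\<lambda>x. x) (\<lambda>_. 1) = (\<integral>\<^sup>+x. \<integral>\<^sup>+y. ennreal (gauss_kernel e (x - y)) \<partial>\<mu> \<partial>\<mu>)"
      unfolding gauss_energy_def by (subst nn_integral_fst[symmetric]) auto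
    also have "\<dots> = (\<integral>\<^sup>+a. \<integral>\<^sup>+b. ennreal (r a) * (ennreal (r b) * (\<integral>\<^sup>+y. ennreal (gauss_kernel e (a + b - y)) \<partial>\<mu>)) \<partial>?S \<partial>?S)"
      by (rule conv) measurable
    also have "\<dots> = (\<integral>\<^sup>+a. \<integral>\<^sup>+b. ennreal (r a) * (ennreal (r b) * (\<integral>\<^sup>+c. \<integral>\<^sup>+d. ennreal (r c) * (ennreal (r d) * ennreal (gauss_kernel e (a + b - (c + d)))) \<partial>?S \<partial>?S)) \<partial>?S \<partial>?S)"
      by (subst conv) simp_all
    also have "\<dots> = (\<integral>\<^sup>+a. \<integral>\<^sup>+b. \<integral>\<^sup>+c. \<integral>\<^sup>+d. ennreal (r a * r b * (r c * r d) * gauss_kernel e (a + b - (c + d))) \<partial>?S \<partial>?S \<partial>?S \<partial>?S)"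
      by (simp add: nn_integral_cmult[symmetric] ennreal_mult r gauss_kernel_nonneg[OF e] mult.assoc)
    also have "\<dots> = gauss_energy e (?S \<Otimes>\<^sub>M ?S) (\<lambda>z. fst z + snd z) (\<lambda>z. r (fst z) * r (snd z))"
      by (rule gauss_energy_sphere_pair_iterated[symmetric]) measurable
    also have "\<dots> = gauss_fourier_L4 e (cpx r)"
      unfolding gauss_fourier_L4_nonneg[OF r ir e] by (rule gauss_energy_sphere_pair) measurable
    finally show ?thesis .
  qed
  let ?c = "ennreal (1 / (2 * pi) ^ 3)"
  let ?B = "?c * fourier_L4 (cpx r)"
  have moll: "(\<integral>\<^sup>+x. (mollify (eps n) \<mu> x)\<^sup>2 \<partial>lborel) = ?c * gauss_fourier_L4 (eps n) (cpx r)" for n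
    using nn_integral_mollify_square[OF eps(1), of n] energy[OF eps(1)[of n]] by simp
  have B: "(\<integral>\<^sup>+x. (mollify (eps n) \<mu> x)\<^sup>2 \<partial>lborel) \<le> ?B" for n
    unfolding moll by (intro mult_left_mono gauss_fourier_L4_le) simp
  have finB: "?B < \<top>" using fin by (simp add: ennreal_mult_less_top)
  have ac: "absolutely_continuous lborel \<mu>"
    by (rule absolutely_continuous_of_mollify_bound[OF eps(1) eps(3) finB B])
  define h where "h = RN_deriv lborel \<mu>"
  have [measurable]: "h \<in> borel_measurable borel" unfolding h_def by measurable
  have dens: "\<mu> = density lborel h"
    unfolding h_def by (rule sigma_finite_measure.density_RN_deriv[OF lborel.sigma_finite_measure_axioms ac, symmetric]) simp
  have "(\<integral>\<^sup>+x. (h x)\<^sup>2 \<partial>lborel) = ?B"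
  proof (rule antisym)
    show "(\<integral>\<^sup>+x. (h x)\<^sup>2 \<partial>lborel) \<le> ?B"
      by (rule density_square_le_of_mollify_bound[OF _ dens eps(1) eps(3) finB B]) measurable
    have "?B = (SUP n. ?c * gauss_fourier_L4 (eps n) (cpx r))"
      by (subst fourier_L4_eq_SUP) (simp_all add: SUP_mult_left_ennreal)
    also have "\<dots> \<le> (\<integral>\<^sup>+x. (h x)\<^sup>2 \<partial>lborel)"
      unfolding moll[symmetric] by (intro SUP_least mollify_square_le_density_square dens eps) measurable
    finally show "?B \<le> (\<integral>\<^sup>+x. (h x)\<^sup>2 \<partial>lborel)" .
  qed
  then show ?thesis
    unfolding \<mu> measure_L2_norm_def Lp_norm_def using ac by (simp add: h_def)
qed

lemma ennroot_strict_mono: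
  assumes "0 < p" "a < b"
  shows "ennroot p a < ennroot p b"
  using assms by (cases a; cases b) (auto simp: ennroot_def ennreal_less_iff)

lemma ennroot_mono:
  assumes "0 < p" "a \<le> b"
  shows "ennroot p a \<le> ennroot p b"
proof (cases "a = b")
  case False
  with assms have "a < b" by simp
  with assms(1) show ?thesis by (intro less_imp_le ennroot_strict_mono)
qed simp

theorem proposition2p5:
  shows "(\<forall>f f_star :: real^3 \<Rightarrow> real.
            square_integrable sphere_measure f \<longrightarrow>
            (AE x in sphere_measure. 0 \<le> f x) \<longrightarrow>
            antipodal_rearrangement f f_star \<longrightarrow>
              measure_L2_norm (sphere_convolution f f)
                \<le> measure_L2_norm (sphere_convolution f_star f_star) \<and>
              (\<not> (AE x in sphere_measure. f x = f_star x) \<longrightarrow>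
                 measure_L2_norm (sphere_convolution f f)
                   < measure_L2_norm (sphere_convolution f_star f_star)))
       \<and> (\<forall>f :: real^3 \<Rightarrow> complex.
            extremizer f \<longrightarrow> (AE x in sphere_measure. norm (f (- x)) = norm (f x)))"
proof (intro conjI allI impI)
  fix f f_star :: "real^3 \<Rightarrow> real"
  assume sq: "square_integrable sphere_measure f" and pos: "AE x in sphere_measure. 0 \<le> f x"
    and star: "antipodal_rearrangement f f_star"
  define r where "r x = \<bar>f x\<bar>" for x
  define g where "g = antipodal_mean r"
  have [measurable]: "f \<in> borel_measurable borel" using sq by (rule square_integrable_sphere_measurable)
  have [measurable]: "f_star \<in> borel_measurable borel"
    using star by (auto simp: antipodal_rearrangement_def intro: square_integrable_sphere_measurable)
  have r0: "0 \<le> r x" for x by (simp add: r_def)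
  have fr: "AE x in sphere_measure. f x = r x" using pos by eventually_elim (simp add: r_def)
  have sqr: "square_integrable sphere_measure r"
    using sq by (simp add: square_integrable_def r_def[abs_def])
  have sqg: "square_integrable sphere_measure g" unfolding g_def by (rule square_integrable_antipodal_mean[OF sqr])
  have [measurable]: "r \<in> borel_measurable borel" "g \<in> borel_measurable borel"
    using sqr sqg by (auto intro: square_integrable_sphere_measurable)
  have g0: "0 \<le> g x" for x by (simp add: g_def antipodal_mean_nonneg)
  have "antipodal_rearrangement f g"
    using antipodal_rearrangement_exists[OF sq] by (simp add: g_def antipodal_mean_def[abs_def] r_def)
  then have sg: "AE x in sphere_measure. f_star x = g x"
    by (rule antipodal_rearrangement_unique[OF star])
  have cong: "sphere_convolution u u = sphere_convolution v v"
    if [measurable]: "u \<in> borel_measurable borel" "v \<in> borel_measurable borel" and "AE x in sphere_measure. u x = v x" for u v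
  proof -
    have "density sphere_measure (\<lambda>x. ennreal (u x)) = density sphere_measure (\<lambda>x. ennreal (v x))"
      using that(3) by (intro density_cong) auto
    then show ?thesis by (simp add: sphere_convolution_def)
  qed
  note L = fourier_L4_symmetrization[OF r0 sqr, folded g_def]
  have finr: "fourier_L4 (cpx r) < \<top>" using L(1,2) by (rule le_less_trans[rotated])
  have Nf: "measure_L2_norm (sphere_convolution f f) = ennroot 2 (ennreal (1 / (2 * pi) ^ 3) * fourier_L4 (cpx r))"
    unfolding cong[of f r, OF _ _ fr, simplified] by (rule measure_L2_norm_sphere_convolution[OF r0 sqr finr])
  have Ng: "measure_L2_norm (sphere_convolution f_star f_star) = ennroot 2 (ennreal (1 / (2 * pi) ^ 3) * fourier_L4 (cpx g))"
    unfolding cong[of f_star g, OF _ _ sg, simplified] by (rule measure_L2_norm_sphere_convolution[OF g0 sqg L(1)])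
  show "measure_L2_norm (sphere_convolution f f) \<le> measure_L2_norm (sphere_convolution f_star f_star)"
    unfolding Nf Ng by (intro ennroot_mono mult_left_mono L(2)) auto
  assume ne: "\<not> (AE x in sphere_measure. f x = f_star x)"
  have "\<not> (AE x in sphere_measure. r (- x) = r x)"
  proof
    assume "AE x in sphere_measure. r (- x) = r x"
    then have "AE x in sphere_measure. g x = r x"
      by eventually_elim (simp add: g_def antipodal_mean_def r0)
    with fr sg have "AE x in sphere_measure. f x = f_star x" by eventually_elim simp
    with ne show False ..
  qed
  from L(3)[OF this] have "fourier_L4 (cpx r) < fourier_L4 (cpx g)" .
  then have "ennreal (1 / (2 * pi) ^ 3) * fourier_L4 (cpx r) < ennreal (1 / (2 * pi) ^ 3) * fourier_L4 (cpx g)"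
    by (intro ennreal_mult_strict_left_mono) auto
  then show "measure_L2_norm (sphere_convolution f f) < measure_L2_norm (sphere_convolution f_star f_star)"
    unfolding Nf Ng by (intro ennroot_strict_mono) auto
next
  fix f :: "real^3 \<Rightarrow> complex"
  assume ext: "extremizer f"
  define r where "r x = norm (f x)" for x
  define g where "g = antipodal_mean r"
  have nz: "f \<in> nonzero_L2" and eq: "fourier_L4_norm f = extension_constant * sphere_L2_norm f"
    using ext by (auto simp: extremizer_def)
  have sq: "square_integrable sphere_measure f" and fnz: "\<not> (AE x in sphere_measure. f x = 0)"
    using nz by (auto simp: nonzero_L2_def)
  have [measurable]: "f \<in> borel_measurable borel" using sq by (rule square_integrable_sphere_measurable)
  have r0: "0 \<le> r x" for x by (simp add: r_def)
  have sqr: "square_integrable sphere_measure r"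
    using sq by (simp add: square_integrable_def r_def[abs_def])
  have sqg: "square_integrable sphere_measure g" unfolding g_def by (rule square_integrable_antipodal_mean[OF sqr])
  have [measurable]: "r \<in> borel_measurable borel" "g \<in> borel_measurable borel"
    using sqr sqg by (auto intro: square_integrable_sphere_measurable)
  have g0: "0 \<le> g x" for x by (simp add: g_def antipodal_mean_nonneg)
  have g2: "(g x)\<^sup>2 = ((r x)\<^sup>2 + (r (- x))\<^sup>2) / 2" for x by (simp add: g_def antipodal_mean_def)
  have gnz: "cpx g \<in> nonzero_L2"
  proof -
    have "\<not> (AE x in sphere_measure. g x = 0)"
    proof
      assume "AE x in sphere_measure. g x = 0"
      then have "AE x in sphere_measure. f x = 0"
      proof eventually_elim
        case (elim x)
        then show ?case using g2[of x] by (simp add: r_def add_nonneg_eq_0_iff)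
      qed
      with fnz show False ..
    qed
    then show ?thesis using sqg by (simp add: nonzero_L2_def square_integrable_def)
  qed
  let ?s = "\<integral>\<^sup>+x. ennreal ((r x)\<^sup>2) \<partial>sphere_measure"
  have Nf: "sphere_L2_norm f = ennroot 2 ?s"
    by (simp add: sphere_L2_norm_def Lp_norm_def r_def ennreal_power)
  have "(\<integral>\<^sup>+x. ennreal ((g x)\<^sup>2) \<partial>sphere_measure) = (\<integral>\<^sup>+x. ennreal (1 / 2) * ennreal ((r x)\<^sup>2) + ennreal (1 / 2) * ennreal ((r (- x))\<^sup>2) \<partial>sphere_measure)"
  proof (rule nn_integral_cong)
    fix x
    have "(g x)\<^sup>2 = 1 / 2 * (r x)\<^sup>2 + 1 / 2 * (r (- x))\<^sup>2" unfolding g2 by simp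
    then have "ennreal ((g x)\<^sup>2) = ennreal (1 / 2 * (r x)\<^sup>2) + ennreal (1 / 2 * (r (- x))\<^sup>2)"
      by (simp only:) (rule ennreal_plus; simp)
    then show "ennreal ((g x)\<^sup>2) = ennreal (1 / 2) * ennreal ((r x)\<^sup>2) + ennreal (1 / 2) * ennreal ((r (- x))\<^sup>2)"
      by (simp only: ennreal_mult' zero_le_divide_1_iff zero_le_numeral zero_le_power2)
  qed
  also have "\<dots> = ennreal (1 / 2) * ?s + ennreal (1 / 2) * (\<integral>\<^sup>+x. ennreal ((r (- x))\<^sup>2) \<partial>sphere_measure)"
    by (simp add: nn_integral_add nn_integral_cmult)
  also have "(\<integral>\<^sup>+x. ennreal ((r (- x))\<^sup>2) \<partial>sphere_measure) = ?s"
    by (rule nn_integral_sphere_uminus) measurable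
  also have "ennreal (1 / 2) * ?s + ennreal (1 / 2) * ?s = ?s"
  proof -
    have "ennreal (1 / 2) + ennreal (1 / 2) = 1" by (subst ennreal_plus[symmetric]) (simp_all del: ennreal_plus)
    then show ?thesis by (simp only: distrib_right[symmetric] mult_1)
  qed
  finally have Ng: "sphere_L2_norm (cpx g) = ennroot 2 ?s"
    using g0 by (simp add: sphere_L2_norm_def Lp_norm_def ennreal_power)
  have "?s < \<top>"
    using sqr by (subst nn_integral_eq_integral) (auto simp: square_integrable_def)
  moreover have "?s \<noteq> 0"
  proof
    assume "?s = 0"
    then have "AE x in sphere_measure. ennreal ((r x)\<^sup>2) = 0" by (subst (asm) nn_integral_0_iff_AE) auto
    then have "AE x in sphere_measure. f x = 0" by eventually_elim (simp add: r_def ennreal_eq_0_iff)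
    with fnz show False ..
  qed
  ultimately have s: "ennroot 2 ?s \<noteq> 0" "ennroot 2 ?s \<noteq> \<top>"
    by (cases ?s; auto simp: ennroot_def ennreal_eq_0_iff real_root_le_0_iff)+
  have L4: "fourier_L4_norm u = ennroot 4 (fourier_L4 u)" for u
    by (simp add: fourier_L4_norm_def Lp_norm_def fourier_L4_def)
  have "fourier_L4_norm (cpx g) / ennroot 2 ?s \<le> extension_constant"
    unfolding extension_constant_def Ng[symmetric] by (rule SUP_upper[OF gnz])
  then have "fourier_L4_norm (cpx g) / ennroot 2 ?s * ennroot 2 ?s \<le> extension_constant * ennroot 2 ?s"
    by (rule mult_right_mono) simp
  also have "fourier_L4_norm (cpx g) / ennroot 2 ?s * ennroot 2 ?s = fourier_L4_norm (cpx g)"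
    using s by (simp add: ennreal_divide_times ennreal_divide_self less_top)
  also have "extension_constant * ennroot 2 ?s = fourier_L4_norm f" using eq Nf by simp
  finally have le: "ennroot 4 (fourier_L4 (cpx g)) \<le> ennroot 4 (fourier_L4 f)" unfolding L4 .
  show "AE x in sphere_measure. norm (f (- x)) = norm (f x)"
  proof (rule ccontr)
    assume "\<not> ?thesis"
    then have "fourier_L4 (cpx r) < fourier_L4 (cpx g)"
      using fourier_L4_symmetrization(3)[OF r0 sqr] by (simp add: g_def r_def)
    moreover have "fourier_L4 f \<le> fourier_L4 (cpx r)"
      using fourier_L4_le_norm[OF sq] by (simp add: r_def)
    ultimately have "ennroot 4 (fourier_L4 f) < ennroot 4 (fourier_L4 (cpx g))"
      by (intro ennroot_strict_mono) auto
    with le show False by simp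
  qed
qed

end
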